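(* Let $d\ge 2$. There exists $v_0>0$ such that for every $v\in(0,v_0)$ and every $\gamma>0$, $$\liminf_{N\to\infty} P[T_N > \gamma N^{2d}] \ge W\Big[\zeta\Big(\tfrac{v}{\sqrt{d+1}}\Big) > \gamma\Big].$$ In particular the laws of $N^{2d}/T_N$ under $P$, $N\ge 2$, are tight.
   Context: $\mathbb{T} = (\mathbb{Z}/N\mathbb{Z})^d$, $E = \mathbb{T}\times\mathbb{Z}$, and $P$ is the law of simple random walk $X_\cdot$ on $E$ started uniformly on $\mathbb{T}\times\{0\}$. A finite subset $S\subset E$ disconnects $E$ if for large $M$, $\mathbb{T}\times(-\infty,-M]$ and $\mathbb{T}\times[M,\infty)$ lie in distinct connected components (for nearest-neighbor adjacency) of $E\setminus S$. The disconnection time is $T_N = \inf\{n\ge 0: \{X_0,\dots,X_n\}\text{ disconnects } E\}$. $W$ is Wiener measure, $L(a,t)$ a jointly continuous version of the local time at level $a$ and time $t$ of the canonical Brownian motion, and $\zeta(u) = \inf\{t\ge 0: \sup_{a\in\mathbb{R}} L(a,t) \ge u\}$ for $u\ge 0$. *)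

theory Defs
  imports "HOL-Probability.Probability"
begin

text \<open>A point of the torus (Z/NZ)^d is encoded as a function x :: nat => int with
  0 <= x i < N for i < d and x i = 0 for i >= d.  A point of E is a pair (x, z).\<close>

type_synonym point = "(nat \<Rightarrow> int) \<times> int"

definition torus :: "nat \<Rightarrow> nat \<Rightarrow> (nat \<Rightarrow> int) set" where
  "torus N d = {x. \<forall>i. (i < d \<longrightarrow> 0 \<le> x i \<and> x i < int N) \<and> (d \<le> i \<longrightarrow> x i = 0)}"

definition cyl :: "nat \<Rightarrow> nat \<Rightarrow> point set" where
  "cyl N d = torus N d \<times> UNIV"

text \<open>Moves of simple random walk: Inl (i, b) is the step +-e_i in torus direction i < d
  (b = True for +), Inr b is the step +-1 in the Z direction.  There are 2d+2 moves.\<close>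

type_synonym move = "(nat \<times> bool) + bool"

definition moves :: "nat \<Rightarrow> move set" where
  "moves d = Inl ` ({..<d} \<times> UNIV) \<union> Inr ` UNIV"

definition sgn_step :: "bool \<Rightarrow> int" where
  "sgn_step b = (if b then 1 else -1)"

fun apply_move :: "nat \<Rightarrow> point \<Rightarrow> move \<Rightarrow> point" where
  "apply_move N (x, z) (Inl (i, b)) = (x(i := (x i + sgn_step b) mod int N), z)"
| "apply_move N (x, z) (Inr b) = (x, z + sgn_step b)"

definition adj :: "nat \<Rightarrow> nat \<Rightarrow> point \<Rightarrow> point \<Rightarrow> bool" where
  "adj N d p q \<longleftrightarrow> p \<in> cyl N d \<and> q \<in> cyl N d \<and> p \<noteq> q \<and> (\<exists>m\<in>moves d. q = apply_move N p m)"

definition conn_in :: "nat \<Rightarrow> nat \<Rightarrow> point set \<Rightarrow> point \<Rightarrow> point \<Rightarrow> bool" where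
  "conn_in N d S p q \<longleftrightarrow>
     p \<in> cyl N d - S \<and> q \<in> cyl N d - S \<and>
     (\<lambda>a b. adj N d a b \<and> a \<notin> S \<and> b \<notin> S)\<^sup>*\<^sup>* p q"

definition distinct_components :: "nat \<Rightarrow> nat \<Rightarrow> point set \<Rightarrow> point set \<Rightarrow> point set \<Rightarrow> bool" where
  "distinct_components N d S A B \<longleftrightarrow>
     (\<forall>p\<in>A. \<forall>p'\<in>A. conn_in N d S p p') \<and>
     (\<forall>q\<in>B. \<forall>q'\<in>B. conn_in N d S q q') \<and>
     (\<forall>p\<in>A. \<forall>q\<in>B. \<not> conn_in N d S p q)"

definition disconnects :: "nat \<Rightarrow> nat \<Rightarrow> point set \<Rightarrow> bool" where
  "disconnects N d S \<longleftrightarrow> finite S \<and> S \<subseteq> cyl N d \<and>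
     (\<exists>M0::int. \<forall>M\<ge>M0.
        distinct_components N d S (torus N d \<times> {..-M}) (torus N d \<times> {M..}))"

definition walk_space :: "nat \<Rightarrow> nat \<Rightarrow> ((nat \<Rightarrow> int) \<times> move stream) measure" where
  "walk_space N d = measure_pmf (pmf_of_set (torus N d)) \<Otimes>\<^sub>M
                    stream_space (measure_pmf (pmf_of_set (moves d)))"

fun walk_pos :: "nat \<Rightarrow> (nat \<Rightarrow> int) \<times> move stream \<Rightarrow> nat \<Rightarrow> point" where
  "walk_pos N \<omega> 0 = (fst \<omega>, 0)"
| "walk_pos N \<omega> (Suc n) = apply_move N (walk_pos N \<omega> n) (snd \<omega> !! n)"

definition disc_time :: "nat \<Rightarrow> nat \<Rightarrow> (nat \<Rightarrow> int) \<times> move stream \<Rightarrow> enat" where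
  "disc_time N d \<omega> =
     (if \<exists>n. disconnects N d (walk_pos N \<omega> ` {0..n})
      then enat (LEAST n. disconnects N d (walk_pos N \<omega> ` {0..n}))
      else \<infinity>)"

definition std_BM :: "'a measure \<Rightarrow> (real \<Rightarrow> 'a \<Rightarrow> real) \<Rightarrow> bool" where
  "std_BM M B \<longleftrightarrow> prob_space M \<and>
     (\<forall>t. B t \<in> borel_measurable M) \<and>
     (\<forall>\<omega>\<in>space M. B 0 \<omega> = 0 \<and> continuous_on {0..} (\<lambda>t. B t \<omega>)) \<and>
     (\<forall>s t. 0 \<le> s \<longrightarrow> s < t \<longrightarrow>
        distributed M lborel (\<lambda>\<omega>. B t \<omega> - B s \<omega>) (normal_density 0 (sqrt (t - s)))) \<and>
     (\<forall>(tt::nat \<Rightarrow> real) n. 0 \<le> tt 0 \<longrightarrow> strict_mono tt \<longrightarrow>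
        prob_space.indep_vars M (\<lambda>_. borel) (\<lambda>i \<omega>. B (tt (Suc i)) \<omega> - B (tt i) \<omega>) {..<n})"

definition local_time :: "'a measure \<Rightarrow> (real \<Rightarrow> 'a \<Rightarrow> real) \<Rightarrow> (real \<Rightarrow> real \<Rightarrow> 'a \<Rightarrow> real) \<Rightarrow> bool" where
  "local_time M B L \<longleftrightarrow>
     (\<forall>a t. L a t \<in> borel_measurable M) \<and>
     (\<forall>\<omega>\<in>space M. continuous_on (UNIV \<times> {0..}) (\<lambda>(a, t). L a t \<omega>)) \<and>
     (\<forall>\<omega>\<in>space M. \<forall>t\<ge>0. \<forall>A\<in>sets borel.
        set_integrable lborel A (\<lambda>a. L a t \<omega>) \<and>
        (LBINT s=0..t. indicator A (B s \<omega>)) = set_lebesgue_integral lborel A (\<lambda>a. L a t \<omega>))"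

definition zeta :: "(real \<Rightarrow> real \<Rightarrow> 'a \<Rightarrow> real) \<Rightarrow> 'a \<Rightarrow> real \<Rightarrow> ereal" where
  "zeta L \<omega> u = Inf {ereal t | t. 0 \<le> t \<and> (SUP a. ereal (L a t \<omega>)) \<ge> ereal u}"

end

(*
  Suppose that the walk has visited every level of the cylinder at most v1 N^d times. Look at the
  plane spanned by one torus direction and the Z direction, and at a coarse lattice of mesh L in a
  vertical strip of this plane. If the walk disconnects the cylinder, then there is a star-path of
  blocked coarse vertices from the left to the right side of the strip, hence a tree of 2^n
  well-separated blocked vertices, where 4^n is of order N and there are at most 112^(2^n) trees to
  choose from. A supermartingale built from a cut-off Green function shows that a fixed set of 2^n
  well-separated frames is entirely hit with probability at most C 2^n 448^(-2^n): each new frame is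
  hit, starting from an earlier one, with small probability if L is large, and the return of the
  walk from afar costs only the exponential of a constant times v1 2^n. So disconnection at low
  density is very unlikely.

  It remains to see that the densities of all levels are low. Comparing the two halves of dyadic
  intervals by exponential supermartingales reduces this to intervals whose length is a small
  multiple of N^d. The density of these macroscopic intervals is read off from the walk at finitely
  many times. By the central limit theorem it is low with asymptotically at least the probability
  that Brownian motion has local times below v / sqrt (d + 1) at time \<gamma>, provided v is small compared
  with v1. For the tightness statement the macroscopic densities are trivially low when \<gamma> is small.
*)
theory Submission
  imports Defs
begin

section \<open>Prefixes of the walk and supermartingales\<close>

text \<open>The walk on the cylinder is recurrent: there is no Green function, and in the long run
  every frame is hit almost surely. Hence the potential is cut off at radius \<open>N div 8\<close>.
  This costs a defect of order \<open>N^(-(d+1))\<close> per visit to one of the order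
  \<open>N\<close> nearby levels; with at most \<open>v1 N^d\<close> visits to each of them, the
  total defect per frame is of order \<open>v1\<close>, small against the gain per frame. This is
  where the density \<open>N^d\<close> enters. A union bound over whole star-paths fails because
  neighbouring frames tend to be hit together. Trees keep the number of choices exponential in the
  number of leaves while the leaves are far apart: a generation doubles the leaves and multiplies
  the distances by 4, so inverse distances are summable, just enough for the decay
  \<open>1/distance\<close> when \<open>d = 2\<close>. The rate 448 is \<open>4 * 112\<close>: the
  factor \<open>4^(-2^n)\<close> left after the union bound over trees absorbs the polynomially many
  heights of the root. The factor \<open>1 / sqrt (d + 1)\<close> is the standard deviation of one
  vertical step. All estimates hold for each fixed starting point.\<close>

lemma measurable_stake_pmf [measurable]:
  "stake n \<in> measurable (stream_space (measure_pmf (p::'a::countable pmf))) (count_space UNIV)"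
proof -
  have "sets (stream_space (measure_pmf p)) = sets (stream_space (count_space UNIV))"
    by (rule sets_stream_space_cong) simp
  then show ?thesis
    by (subst measurable_cong_sets[OF _ refl]) (auto intro: measurable_stake)
qed

text \<open>Peeling off the first letter on both sides. Events decided by finitely many moves can
  thus be estimated on lists, where induction on the length is available.\<close>

lemma distr_stake_stream_space:
  fixes p :: "'a::countable pmf"
  shows "distr (stream_space (measure_pmf p)) (count_space UNIV) (stake n) = measure_pmf (replicate_pmf n p)"
    (is "?D = _")
proof (rule measure_eqI)
  note m = measurable_stake_pmf[of _ p]
  show "sets ?D = sets (measure_pmf (replicate_pmf n p))" by simp
  fix X assume "X \<in> sets ?D"
  have "(\<integral>\<^sup>+s. f (stake n s) \<partial>stream_space (measure_pmf p)) = (\<integral>\<^sup>+xs. f xs \<partial>replicate_pmf n p)" for f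
  proof (induction n arbitrary: f)
    case 0
    interpret prob_space "stream_space (measure_pmf p)"
      by (rule prob_space.prob_space_stream_space) (rule measure_pmf.prob_space_axioms)
    show ?case by (simp add: emeasure_space_1)
  next
    case (Suc n)
    have [measurable]: "f \<in> borel_measurable (count_space UNIV)" by simp
    have "(\<integral>\<^sup>+s. f (stake (Suc n) s) \<partial>stream_space (measure_pmf p))
        = (\<integral>\<^sup>+x. (\<integral>\<^sup>+s. f (stake (Suc n) (x ## s)) \<partial>stream_space (measure_pmf p)) \<partial>p)"
      by (rule prob_space.nn_integral_stream_space[OF measure_pmf.prob_space_axioms])
         (rule measurable_compose[OF m], simp)
    also have "\<dots> = (\<integral>\<^sup>+x. (\<integral>\<^sup>+xs. f (x # xs) \<partial>replicate_pmf n p) \<partial>p)"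
      by (intro nn_integral_cong) (simp, rule Suc.IH)
    also have "\<dots> = (\<integral>\<^sup>+xs. f xs \<partial>replicate_pmf (Suc n) p)"
      by (simp add: nn_integral_bind_pmf)
    finally show ?case .
  qed
  note eq = this
  have "emeasure ?D X = (\<integral>\<^sup>+xs. indicator X xs \<partial>?D)" by simp
  also have "\<dots> = (\<integral>\<^sup>+s. indicator X (stake n s) \<partial>stream_space (measure_pmf p))"
    by (rule nn_integral_distr[OF m]) simp
  also have "\<dots> = emeasure (replicate_pmf n p) X"
    by (subst eq) simp
  finally show "emeasure ?D X = emeasure (replicate_pmf n p) X" .
qed

lemma prob_space_walk_space: "prob_space (walk_space N d)"
proof -
  interpret S: prob_space "stream_space (measure_pmf (pmf_of_set (moves d)))"
    by (rule prob_space.prob_space_stream_space) (rule measure_pmf.prob_space_axioms)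
  interpret P: pair_prob_space "measure_pmf (pmf_of_set (torus N d))" "stream_space (measure_pmf (pmf_of_set (moves d)))" ..
  show ?thesis unfolding walk_space_def by (rule P.prob_space_axioms)
qed

lemma space_walk_space [simp]: "space (walk_space N d) = UNIV"
  by (simp add: walk_space_def space_pair_measure space_stream_space)

text \<open>\<open>Q\<close> may be arbitrary: there are only countably many prefixes, and for each
  of them any set of starting points is measurable.\<close>

lemma sets_walk_space_stake:
  "{\<omega>. Q (fst \<omega>) (stake n (snd \<omega>))} \<in> sets (walk_space N d)"
proof -
  have "{\<omega>. Q (fst \<omega>) (stake n (snd \<omega>))} =
     (\<Union>ms::move list. {x. Q x ms} \<times> (stake n -` {ms} \<inter> space (stream_space (measure_pmf (pmf_of_set (moves d))))))"
    by (auto simp: space_stream_space)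
  also have "\<dots> \<in> sets (walk_space N d)"
    unfolding walk_space_def
    by (intro sets.countable_UN' pair_measureI) (auto intro!: measurable_sets[OF measurable_stake_pmf])
  finally show ?thesis .
qed

text \<open>Fubini over the starting point. It reduces everything to bounds for lists of moves that
  are uniform in the start.\<close>

lemma measure_walk_space_stake_le:
  assumes "finite (torus N d)" "torus N d \<noteq> {}"
    and "\<And>x. x \<in> torus N d \<Longrightarrow>
          measure_pmf.prob (replicate_pmf n (pmf_of_set (moves d))) {ms. Q x ms} \<le> c"
  shows "measure (walk_space N d) {\<omega>. Q (fst \<omega>) (stake n (snd \<omega>))} \<le> c"
proof -
  let ?S = "stream_space (measure_pmf (pmf_of_set (moves d)))" and ?T = "pmf_of_set (torus N d)"
  interpret S: prob_space ?S
    by (rule prob_space.prob_space_stream_space) (rule measure_pmf.prob_space_axioms)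
  interpret W: prob_space "walk_space N d" by (rule prob_space_walk_space)
  have c: "c \<ge> 0"
    using assms(2,3) by (meson ex_in_conv measure_nonneg order_trans)
  have "emeasure (walk_space N d) {\<omega>. Q (fst \<omega>) (stake n (snd \<omega>))}
      = (\<integral>\<^sup>+x. emeasure ?S (Pair x -` {\<omega>. Q (fst \<omega>) (stake n (snd \<omega>))}) \<partial>?T)"
    unfolding walk_space_def
    by (rule S.emeasure_pair_measure_alt) (rule sets_walk_space_stake[unfolded walk_space_def])
  also have "\<dots> \<le> (\<integral>\<^sup>+x. ennreal c \<partial>?T)"
  proof (rule nn_integral_mono_AE, rule AE_pmfI)
    fix x assume "x \<in> set_pmf ?T"
    then have x: "x \<in> torus N d" using assms(1,2) by simp
    have "emeasure ?S (Pair x -` {\<omega>. Q (fst \<omega>) (stake n (snd \<omega>))})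
        = emeasure ?S (stake n -` {ms. Q x ms} \<inter> space ?S)"
      by (simp add: space_stream_space)
    also have "\<dots> = emeasure (distr ?S (count_space UNIV) (stake n)) {ms. Q x ms}"
      by (subst emeasure_distr) auto
    also have "\<dots> = measure_pmf.prob (replicate_pmf n (pmf_of_set (moves d))) {ms. Q x ms}"
      by (simp add: distr_stake_stream_space measure_pmf.emeasure_eq_measure)
    also have "\<dots> \<le> ennreal c" using assms(3)[OF x] c by simp
    finally show "emeasure ?S (Pair x -` {\<omega>. Q (fst \<omega>) (stake n (snd \<omega>))}) \<le> ennreal c" .
  qed
  also have "\<dots> = ennreal c" by simp
  finally show ?thesis using c by (simp add: W.emeasure_eq_measure)
qed

lemma prob_replicate_pmf_of_set_Suc:
  assumes "finite A" "A \<noteq> {}"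
  shows "measure_pmf.prob (replicate_pmf (Suc n) (pmf_of_set A)) X =
     (\<Sum>m\<in>A. measure_pmf.prob (replicate_pmf n (pmf_of_set A)) {ms. m # ms \<in> X}) / card A"
proof -
  let ?R = "replicate_pmf n (pmf_of_set A)"
  have "ennreal (measure_pmf.prob (replicate_pmf (Suc n) (pmf_of_set A)) X)
      = (\<integral>\<^sup>+m. emeasure (measure_pmf ?R) {ms. m # ms \<in> X} \<partial>pmf_of_set A)"
    unfolding measure_pmf.emeasure_eq_measure[symmetric]
    by (simp add: emeasure_bind_pmf map_pmf_def[symmetric] vimage_def)
  also have "\<dots> = (\<Sum>m\<in>A. emeasure (measure_pmf ?R) {ms. m # ms \<in> X}) / card A"
    using assms by (simp add: nn_integral_pmf_of_set)
  also have "\<dots> = ennreal ((\<Sum>m\<in>A. measure_pmf.prob ?R {ms. m # ms \<in> X}) / card A)"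
    using assms
    by (simp add: measure_pmf.emeasure_eq_measure sum_nonneg divide_ennreal ennreal_of_nat_eq_real_of_nat card_gt_0_iff)
  finally show ?thesis
    by (simp add: sum_nonneg)
qed

text \<open>Doob's maximal inequality, by induction on the first step instead of stopping times: as
  long as the start is below \<open>c\<close>, a crossing must happen after the first move, and the
  supermartingale property averages the bounds of the successors. A start above \<open>c\<close> is
  trivial.\<close>

lemma prob_supermartingale_ge:
  fixes V :: "'b \<Rightarrow> real" and st :: "'b \<Rightarrow> 'a \<Rightarrow> 'b"
  assumes A: "finite A" "A \<noteq> {}" and c: "c > 0"
    and V0: "\<And>a. V a \<ge> 0"
    and super: "\<And>a. (\<Sum>m\<in>A. V (st a m)) \<le> card A * V a"
  shows "measure_pmf.prob (replicate_pmf n (pmf_of_set A)) {ms. \<exists>k\<le>n. V (foldl st a (take k ms)) \<ge> c} \<le> V a / c"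
proof (cases "V a \<ge> c")
  case True
  then show ?thesis using c by (intro order_trans[OF measure_pmf.prob_le_1]) (simp add: field_simps)
next
  case False
  then show ?thesis
  proof (induction n arbitrary: a)
    case 0
    then show ?case using V0[of a] c by simp
  next
    case (Suc n)
    let ?R = "replicate_pmf n (pmf_of_set A)"
    have eq: "(\<exists>k\<le>Suc n. V (foldl st a (take k (m # ms))) \<ge> c) \<longleftrightarrow> (\<exists>k\<le>n. V (foldl st (st a m) (take k ms)) \<ge> c)" for m ms
    proof
      assume "\<exists>k\<le>Suc n. V (foldl st a (take k (m # ms))) \<ge> c"
      then obtain k where k: "k \<le> Suc n" "V (foldl st a (take k (m # ms))) \<ge> c" by auto
      with Suc.prems have "k \<noteq> 0" by (intro notI) simp
      then obtain j where "k = Suc j" by (cases k) auto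
      with k show "\<exists>k\<le>n. V (foldl st (st a m) (take k ms)) \<ge> c" by (intro exI[of _ j]) simp
    next
      assume "\<exists>k\<le>n. V (foldl st (st a m) (take k ms)) \<ge> c"
      then obtain k where "k \<le> n" "V (foldl st (st a m) (take k ms)) \<ge> c" by auto
      then show "\<exists>k\<le>Suc n. V (foldl st a (take k (m # ms))) \<ge> c" by (intro exI[of _ "Suc k"]) simp
    qed
    have step: "measure_pmf.prob ?R {ms. \<exists>k\<le>n. V (foldl st b (take k ms)) \<ge> c} \<le> V b / c" for b
    proof (cases "V b \<ge> c")
      case True
      then show ?thesis using c by (intro order_trans[OF measure_pmf.prob_le_1]) (simp add: field_simps)
    qed (rule Suc.IH)
    have "measure_pmf.prob (replicate_pmf (Suc n) (pmf_of_set A)) {ms. \<exists>k\<le>Suc n. V (foldl st a (take k ms)) \<ge> c}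
       = (\<Sum>m\<in>A. measure_pmf.prob ?R {ms. \<exists>k\<le>n. V (foldl st (st a m) (take k ms)) \<ge> c}) / card A"
      using A by (subst prob_replicate_pmf_of_set_Suc) (simp_all del: replicate_pmf.simps add: eq)
    also have "\<dots> \<le> (\<Sum>m\<in>A. V (st a m) / c) / card A"
      by (intro divide_right_mono sum_mono step) simp
    also have "\<dots> = (\<Sum>m\<in>A. V (st a m)) / card A / c" by (simp add: sum_divide_distrib[symmetric] field_simps)
    also have "\<dots> \<le> V a / c"
      using super[of a] A c by (intro divide_right_mono) (auto simp: card_gt_0_iff field_simps)
    finally show ?case .
  qed
qed

corollary prob_supermartingale_final_ge:
  fixes V :: "'b \<Rightarrow> real" and st :: "'b \<Rightarrow> 'a \<Rightarrow> 'b"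
  assumes "finite A" "A \<noteq> {}" "c > 0"
    and "\<And>a. V a \<ge> 0"
    and "\<And>a. (\<Sum>m\<in>A. V (st a m)) \<le> card A * V a"
  shows "measure_pmf.prob (replicate_pmf n (pmf_of_set A)) {ms. V (foldl st a ms) \<ge> c} \<le> V a / c"
proof -
  have "measure_pmf.prob (replicate_pmf n (pmf_of_set A)) {ms. V (foldl st a ms) \<ge> c}
     = measure_pmf.prob (replicate_pmf n (pmf_of_set A)) {ms. V (foldl st a (take n ms)) \<ge> c}"
    by (intro measure_pmf.finite_measure_eq_AE AE_pmfI) (auto simp: set_replicate_pmf)
  also have "\<dots> \<le> measure_pmf.prob (replicate_pmf n (pmf_of_set A)) {ms. \<exists>k\<le>n. V (foldl st a (take k ms)) \<ge> c}"
    by (intro measure_pmf.finite_measure_mono) auto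
  also have "\<dots> \<le> V a / c" by (rule prob_supermartingale_ge[OF assms])
  finally show ?thesis .
qed

section \<open>The vertical coordinate and its occupation densities\<close>

lemma finite_moves: "finite (moves d)" and moves_nonempty: "moves d \<noteq> {}"
  by (auto simp: moves_def)

lemma sum_moves:
  fixes f :: "move \<Rightarrow> 'a::comm_monoid_add"
  shows "(\<Sum>m\<in>moves d. f m) = (\<Sum>i<d. f (Inl (i, True)) + f (Inl (i, False))) + (f (Inr True) + f (Inr False))"
proof -
  have "(\<Sum>m\<in>moves d. f m) = (\<Sum>p\<in>{..<d} \<times> UNIV. f (Inl p)) + (\<Sum>b\<in>UNIV. f (Inr b))"
    unfolding moves_def
    by (subst sum.union_disjoint) (auto simp: sum.reindex inj_on_def)
  moreover have "(\<Sum>p\<in>{..<d} \<times> UNIV. f (Inl p)) = (\<Sum>i<d. \<Sum>b\<in>UNIV. f (Inl (i, b)))"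
    unfolding sum.cartesian_product by (rule sum.cong) auto
  ultimately show ?thesis by (simp add: UNIV_bool add.commute)
qed

lemma card_moves: "card (moves d) = 2 * d + 2"
  using sum_moves[of "\<lambda>_. 1::nat" d] by simp

definition zmove :: "move \<Rightarrow> int" where
  "zmove m = (case m of Inl _ \<Rightarrow> 0 | Inr b \<Rightarrow> sgn_step b)"

definition altitude :: "move list \<Rightarrow> int" where
  "altitude ms = sum_list (map zmove ms)"

text \<open>The final position is not counted. In this form occupation numbers are exactly the time
  sums that occur in the exponential functionals below.\<close>

definition occ :: "int set \<Rightarrow> move list \<Rightarrow> nat" where
  "occ S ms = card {k. k < length ms \<and> altitude (take k ms) \<in> S}"

abbreviation rw :: "nat \<Rightarrow> nat \<Rightarrow> move list pmf" where
  "rw d T \<equiv> replicate_pmf T (pmf_of_set (moves d))"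

lemma set_rw: "ms \<in> set_pmf (rw d T) \<longleftrightarrow> set ms \<subseteq> moves d \<and> length ms = T"
  using finite_moves moves_nonempty by (auto simp: set_replicate_pmf)

lemma altitude_Nil [simp]: "altitude [] = 0"
  and altitude_Cons [simp]: "altitude (m # ms) = zmove m + altitude ms"
  and altitude_append [simp]: "altitude (ms @ ns) = altitude ms + altitude ns"
  by (simp_all add: altitude_def)

lemma sum_moves_zmove:
  "(\<Sum>m\<in>moves d. f (zmove m)) = (2 * real d) * f 0 + (f 1 + f (-1) :: real)"
  by (subst sum_moves) (simp add: zmove_def sgn_step_def algebra_simps)

lemma sum_occ: "(\<Sum>k<length ms. indicator S (altitude (take k ms)) :: real) = occ S ms"
  by (simp add: occ_def indicator_def sum.If_cases) (simp add: Int_def conj_commute)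

text \<open>Kolmogorov's inequality. The variance of a vertical step is \<open>1 / (d + 1)\<close>,
  here simply bounded by 1.\<close>

lemma prob_altitude_range_le:
  assumes "A > 0"
  shows "measure_pmf.prob (rw d T) {ms. \<exists>k\<le>T. \<bar>real_of_int (altitude (take k ms))\<bar> \<ge> A} \<le> T / A^2"
proof -
  \<comment> \<open>The square plus the remaining time. After time \<open>T\<close> the value drops
    to 0, so the supermartingale inequality holds in every state.\<close>
  define V :: "int \<times> nat \<Rightarrow> real" where
    "V = (\<lambda>(z, k). if k \<le> T then (of_int z)^2 + real (T - k) else 0)"
  define st where "st = (\<lambda>(z, k) m. (z + zmove m, k + 1 :: nat))"
  have fold: "foldl st (z, k) ms = (z + altitude ms, k + length ms)" for z k ms
    by (induction ms arbitrary: z k) (auto simp: st_def)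
  have "measure_pmf.prob (rw d T) {ms. \<exists>k\<le>T. V (foldl st (0, 0) (take k ms)) \<ge> A^2} \<le> V (0, 0) / A^2"
  proof (rule prob_supermartingale_ge)
    fix a :: "int \<times> nat"
    obtain z k where a: "a = (z, k)" by (cases a)
    show "(\<Sum>m\<in>moves d. V (st a m)) \<le> real (card (moves d)) * V a"
    proof (cases "Suc k \<le> T")
      case True
      have "(\<Sum>m\<in>moves d. V (st a m)) = (\<Sum>m\<in>moves d. (\<lambda>e. (of_int (z + e))^2 + real (T - Suc k)) (zmove m))"
        using True by (simp add: a st_def V_def)
      also have "\<dots> = (2 * d + 2) * ((of_int z)^2 + real (T - Suc k)) + 2"
        by (subst sum_moves_zmove) (simp add: power2_eq_square algebra_simps)
      also have "\<dots> \<le> (2 * d + 2) * ((of_int z)^2 + real (T - k))"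
        using True by (simp add: of_nat_diff algebra_simps)
      finally show ?thesis using True by (simp add: a V_def card_moves)
    qed (auto simp: a st_def V_def)
  next
    show "0 \<le> V a" for a by (auto simp: V_def split: prod.split)
  qed (use assms finite_moves moves_nonempty in auto)
  moreover have "measure_pmf.prob (rw d T) {ms. \<exists>k\<le>T. \<bar>real_of_int (altitude (take k ms))\<bar> \<ge> A}
      \<le> measure_pmf.prob (rw d T) {ms. \<exists>k\<le>T. V (foldl st (0, 0) (take k ms)) \<ge> A^2}"
  proof (rule measure_pmf.finite_measure_mono, safe)
    fix ms :: "move list" and k
    assume k: "k \<le> T" and "\<bar>real_of_int (altitude (take k ms))\<bar> \<ge> A"
    then have "(real_of_int (altitude (take k ms)))^2 \<ge> A^2"
      using assms by (metis abs_le_square_iff abs_of_pos)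
    moreover have "min (length ms) k \<le> T" using k by simp
    ultimately have "V (foldl st (0, 0) (take k ms)) \<ge> A^2"
      by (simp add: fold V_def)
    with k show "\<exists>k\<le>T. V (foldl st (0, 0) (take k ms)) \<ge> A^2" by blast
  qed simp
  ultimately show ?thesis by (simp add: V_def)
qed

text \<open>The exponential of the running sum of \<open>g\<close> plus the corrector
  \<open>b\<close> at the current altitude is a supermartingale; the hypothesis is its one-step
  inequality divided by \<open>exp (b z)\<close>. Markov's inequality at the final time gives the
  bound.\<close>

lemma prob_exp_altitude_functional_le:
  fixes b g :: "int \<Rightarrow> real"
  assumes "\<And>z. 2 * real d + exp (b (z + 1) - b z) + exp (b (z - 1) - b z) \<le> (2 * real d + 2) * exp (- g z)"
  shows "measure_pmf.prob (rw d T)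
     {ms. (\<Sum>k<length ms. g (altitude (take k ms))) + b (altitude ms) \<ge> y} \<le> exp (b 0 - y)"
proof -
  define V :: "int \<times> real \<Rightarrow> real" where "V = (\<lambda>(z, q). exp (q + b z))"
  define st where "st = (\<lambda>(z, q) m. (z + zmove m, q + g z))"
  have fold: "foldl st (z, q) ms = (z + altitude ms, q + (\<Sum>k<length ms. g (z + altitude (take k ms))))" for z q ms
  proof (induction ms arbitrary: z q)
    case (Cons m ms)
    have "foldl st (z, q) (m # ms) = foldl st (z + zmove m, q + g z) ms" by (simp add: st_def)
    also note Cons.IH
    finally show ?case
      by (simp add: sum.lessThan_Suc_shift algebra_simps del: sum.lessThan_Suc)
  qed (simp add: st_def)
  have "measure_pmf.prob (rw d T) {ms. V (foldl st (0, 0) ms) \<ge> exp y} \<le> V (0, 0) / exp y"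
  proof (rule prob_supermartingale_final_ge)
    fix a :: "int \<times> real"
    obtain z q where a: "a = (z, q)" by (cases a)
    have "(\<Sum>m\<in>moves d. V (st a m)) = (\<Sum>m\<in>moves d. (\<lambda>e. exp (q + g z + b (z + e))) (zmove m))"
      by (simp add: a st_def V_def)
    also have "\<dots> = exp (q + g z + b z) * (2 * real d + exp (b (z + 1) - b z) + exp (b (z - 1) - b z))"
      by (subst sum_moves_zmove) (simp add: distrib_left exp_add[symmetric] add.assoc)
    also have "\<dots> \<le> exp (q + g z + b z) * ((2 * real d + 2) * exp (- g z))"
      by (intro mult_left_mono assms) auto
    also have "\<dots> = (2 * real d + 2) * exp (q + b z)" by (simp add: exp_add exp_minus)
    finally show "(\<Sum>m\<in>moves d. V (st a m)) \<le> real (card (moves d)) * V a"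
      by (simp add: a V_def card_moves algebra_simps)
  qed (use finite_moves moves_nonempty in \<open>auto simp: V_def split: prod.split\<close>)
  then show ?thesis by (simp add: fold V_def exp_diff)
qed

section \<open>Comparing occupation densities on consecutive dyadic scales\<close>

definition tent :: "int \<Rightarrow> nat \<Rightarrow> int \<Rightarrow> int" where
  "tent lo H z = max 0 (int H - \<bar>z - lo + 1 - int H\<bar>)"

lemma tent_bounds: "0 \<le> tent lo H z" "tent lo H z \<le> int H"
  by (auto simp: tent_def)

lemma tent_eq_0: "z < lo \<or> z \<ge> lo + 2 * int H - 1 \<Longrightarrow> tent lo H z = 0"
  by (auto simp: tent_def)

text \<open>The tent peaks at \<open>lo + H - 1\<close>, which makes the backward difference exactly
  the left half minus the right half. A running sum of tents therefore has this step function as its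
  second difference.\<close>

lemma tent_difference:
  assumes "H > 0"
  shows "tent lo H z - tent lo H (z - 1) = (if lo \<le> z \<and> z < lo + H then 1 else if lo + H \<le> z \<and> z < lo + 2 * H then -1 else 0)"
  using assms by (auto simp: tent_def max_def abs_if)

lemma sum_tent_le:
  "(\<Sum>w\<in>{lo..<z}. tent lo H w) \<le> 2 * (int H)^2"
proof -
  have "(\<Sum>w\<in>{lo..<z}. tent lo H w) = (\<Sum>w\<in>{lo..<z} \<inter> {lo..<lo + 2 * int H}. tent lo H w)"
    by (intro sum.mono_neutral_right) (auto intro!: tent_eq_0)
  also have "\<dots> \<le> (\<Sum>w\<in>{lo..<lo + 2 * int H}. tent lo H w)"
    by (intro sum_mono2) (auto simp: tent_bounds)
  also have "\<dots> \<le> (\<Sum>w\<in>{lo..<lo + 2 * int H}. int H)"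
    by (intro sum_mono) (simp add: tent_bounds)
  also have "\<dots> = 2 * (int H)^2" by (simp add: power2_eq_square)
  finally show ?thesis .
qed

text \<open>One half of an interval is not visited much more densely than the whole interval: the
  exponent is the time integral of a function with zero mean, compensated by the tent-shaped
  solution of the corresponding Poisson equation.\<close>

lemma prob_density_of_half_ge:
  fixes H :: nat and lo :: int and \<eta> \<theta> :: real
  assumes H: "H > 0" and eta: "0 < \<eta>" "\<eta> \<le> 1"
    and child: "I = {lo..<lo + int H} \<or> I = {lo + int H..<lo + 2 * int H}"
  shows "measure_pmf.prob (rw d T)
     {ms. occ I ms / H \<ge> (1 + \<eta>) * (occ {lo..<lo + 2 * int H} ms / (2 * H)) + \<theta>}
     \<le> exp (2 * \<eta> - \<eta> * \<theta> / ((2 * real d + 2) * H))"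
proof -
  define J where "J = {lo..<lo + 2 * int H}"
  obtain sg :: real where sg: "sg = 1 \<and> I = {lo..<lo + int H} \<or> sg = -1 \<and> I = {lo + int H..<lo + 2 * int H}"
    using child by metis
  \<comment> \<open>With this size the quadratic Taylor errors of the two exponentials add up to at
    most \<open>\<mu>^2 / 2 = \<mu> * \<eta> / (2 * H)\<close>, which is precisely the relative
    excess \<open>\<eta>\<close> granted to the whole interval.\<close>
  define \<mu> where "\<mu> = \<eta> / H"
  have mu: "0 < \<mu>" "\<mu> \<le> 1" "\<mu> * H = \<eta>"
    using H eta by (auto simp: \<mu>_def field_simps)
  \<comment> \<open>The corrector is a running sum of tents, with a sign selecting the half. Its
    gradient is \<open>e\<close>, and the area of the tent bounds it by
    \<open>\<mu> * H = \<eta>\<close>.\<close>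
  define b :: "int \<Rightarrow> real" where "b z = - sg * (\<mu> / (2 * H)) * of_int (\<Sum>w\<in>{lo..<z}. tent lo H w)" for z
  define e :: "int \<Rightarrow> real" where "e z = - sg * (\<mu> / (2 * H)) * of_int (tent lo H z)" for z
  have b_step: "b (z + 1) - b z = e z" for z
  proof (cases "lo \<le> z")
    case True
    then have "{lo..<z + 1} = insert z {lo..<z}" by auto
    then show ?thesis by (simp add: b_def e_def algebra_simps)
  next
    case False
    then show ?thesis by (simp add: b_def e_def tent_eq_0)
  qed
  define g where "g z = \<mu> / (2 * real d + 2) * (indicator I z / H - (1 + \<eta>) / (2 * H) * indicator J z)" for z
  have e_abs: "\<bar>e z\<bar> \<le> \<mu> / 2" for z
  proof -
    have "\<bar>e z\<bar> = \<mu> / (2 * H) * of_int (tent lo H z)"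
      using sg mu tent_bounds[of lo H z] by (auto simp: e_def abs_mult)
    also have "\<dots> \<le> \<mu> / (2 * H) * H"
      using mu tent_bounds(2)[of lo H z] by (intro mult_left_mono) (auto simp: of_int_le_iff[of _ "int H", simplified])
    finally show ?thesis using H by simp
  qed
  have exp_le: "exp x \<le> 1 + x + x^2" if "\<bar>x\<bar> \<le> 1" for x :: real
  proof (cases "x \<ge> 0")
    case True
    then show ?thesis using that by (intro exp_bound) auto
  next
    case False
    have "exp x = 1 / exp (- x)" by (simp add: exp_minus field_simps)
    also have "\<dots> \<le> 1 / (1 + (- x))" using False by (intro divide_left_mono exp_ge_add_one_self) auto
    also have "\<dots> \<le> 1 + x + x^2"
    proof -
      have "(1 + x + x^2) * (1 - x) = 1 - x^3" by (simp add: power2_eq_square power3_eq_cube algebra_simps)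
      moreover have "x^3 \<le> 0" using False by (simp add: power3_eq_cube mult_nonneg_nonpos mult_nonpos_nonpos mult_le_0_iff zero_le_mult_iff)
      ultimately show ?thesis using False by (simp add: divide_le_eq)
    qed
    finally show ?thesis .
  qed
  have key: "2 * real d + exp (b (z + 1) - b z) + exp (b (z - 1) - b z) \<le> (2 * real d + 2) * exp (- g z)" for z
  proof -
    have bm: "b (z - 1) - b z = - e (z - 1)" using b_step[of "z - 1"] by simp
    have diff: "e z - e (z - 1) = \<mu> * (indicator J z / (2 * H) - indicator I z / H)"
    proof -
      have "e z - e (z - 1) = - sg * (\<mu> / (2 * H)) * of_int (tent lo H z - tent lo H (z - 1))"
        by (simp add: e_def algebra_simps)
      also have "\<dots> = \<mu> * (indicator J z / (2 * H) - indicator I z / H)"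
        unfolding tent_difference[OF H] using sg H
        by (auto simp: J_def indicator_def field_simps split: if_splits)
      finally show ?thesis .
    qed
    have sq: "(e z)^2 + (e (z - 1))^2 \<le> \<mu> * \<eta> / (2 * H) * indicator J z"
    proof (cases "z \<in> J")
      case True
      have "(e z)^2 \<le> (\<mu>/2)^2" "(e (z-1))^2 \<le> (\<mu>/2)^2"
        using e_abs[of z] e_abs[of "z-1"] mu by (metis abs_ge_zero power2_abs power_mono)+
      then have "(e z)^2 + (e (z - 1))^2 \<le> \<mu>^2 / 2" by (simp add: power2_eq_square)
      also have "\<dots> = \<mu> * \<eta> / (2 * H)" using H by (simp add: mu(3)[symmetric] power2_eq_square)
      finally show ?thesis using True by simp
    next
      case False
      then have "tent lo H z = 0" "tent lo H (z - 1) = 0" by (auto simp: J_def intro!: tent_eq_0)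
      then show ?thesis using False by (simp add: e_def)
    qed
    have "2 * real d + exp (b (z + 1) - b z) + exp (b (z - 1) - b z)
        \<le> 2 * real d + (1 + e z + (e z)^2) + (1 + (- e (z - 1)) + (- e (z - 1))^2)"
      unfolding b_step bm using e_abs[of z] e_abs[of "z-1"] mu
      by (intro add_mono exp_le order_refl) auto
    also have "\<dots> = 2 * real d + 2 + (e z - e (z - 1)) + ((e z)^2 + (e (z - 1))^2)" by simp
    also have "\<dots> \<le> 2 * real d + 2 + \<mu> * (indicator J z / (2 * H) - indicator I z / H) + \<mu> * \<eta> / (2 * H) * indicator J z"
      using sq by (simp add: diff)
    also have "\<dots> = (2 * real d + 2) * (1 + (- g z))"
    proof -
      have "(2 * real d + 2) * g z = \<mu> * (indicator I z / H - (1 + \<eta>) / (2 * H) * indicator J z)"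
      proof -
        have "2 * real d + 2 > 0" by simp
        then show ?thesis unfolding g_def by simp
      qed
      then show ?thesis by (simp add: algebra_simps add_divide_distrib)
    qed
    also have "\<dots> \<le> (2 * real d + 2) * exp (- g z)"
      by (intro mult_left_mono exp_ge_add_one_self) auto
    finally show ?thesis .
  qed
  have b_abs: "\<bar>b z\<bar> \<le> \<eta>" for z
  proof -
    have "0 \<le> (\<Sum>w\<in>{lo..<z}. tent lo H w)" by (intro sum_nonneg) (simp add: tent_bounds)
    then have "\<bar>b z\<bar> = \<mu> / (2 * H) * of_int (\<Sum>w\<in>{lo..<z}. tent lo H w)"
      using sg mu by (auto simp: b_def abs_mult simp del: of_int_sum)
    also have "\<dots> \<le> \<mu> / (2 * H) * of_int (2 * (int H)^2)"
      using mu sum_tent_le[of lo H z] by (intro mult_left_mono) (auto simp del: of_int_sum of_int_mult of_int_power)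
    also have "\<dots> = \<eta>" using H mu by (simp add: power2_eq_square)
    finally show ?thesis .
  qed
  define y where "y = \<mu> * \<theta> / (2 * real d + 2) - \<eta>"
  have "measure_pmf.prob (rw d T) {ms. occ I ms / H \<ge> (1 + \<eta>) * (occ J ms / (2 * H)) + \<theta>}
     \<le> measure_pmf.prob (rw d T) {ms. (\<Sum>k<length ms. g (altitude (take k ms))) + b (altitude ms) \<ge> y}"
  proof (rule measure_pmf.finite_measure_mono, safe)
    fix ms assume *: "occ I ms / H \<ge> (1 + \<eta>) * (occ J ms / (2 * H)) + \<theta>"
    have "(\<Sum>k<length ms. g (altitude (take k ms))) =
       \<mu> / (2 * real d + 2) * (occ I ms / H - (1 + \<eta>) * (occ J ms / (2 * H)))"
      unfolding g_def
      by (simp add: sum_distrib_left[symmetric] sum_subtractf sum_divide_distrib[symmetric] sum_occ)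
    also have "\<dots> \<ge> \<mu> / (2 * real d + 2) * \<theta>"
      using * mu by (intro mult_left_mono) auto
    finally show "(\<Sum>k<length ms. g (altitude (take k ms))) + b (altitude ms) \<ge> y"
      using b_abs[of "altitude ms"] by (simp add: y_def)
  qed simp
  also have "\<dots> \<le> exp (b 0 - y)" by (rule prob_exp_altitude_functional_le[OF key])
  also have "\<dots> \<le> exp (2 * \<eta> - \<mu> * \<theta> / (2 * real d + 2))" using b_abs[of 0] by (simp add: y_def)
  also have "\<mu> * \<theta> / (2 * real d + 2) = \<eta> * \<theta> / ((2 * real d + 2) * H)" by (simp add: \<mu>_def field_simps)
  finally show ?thesis by (simp add: J_def)
qed

lemma dyadic_window: "{z::int. z div 2^j = a} = {a * 2^j ..< a * 2^j + 2^j}"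
proof -
  have "z div b = a \<longleftrightarrow> a * b \<le> z \<and> z < a * b + b" if b: "b > 0" for z b :: int
  proof
    assume a: "z div b = a"
    have "z = z div b * b + z mod b" by (rule div_mult_mod_eq[symmetric])
    moreover have "0 \<le> z mod b" "z mod b < b" using b by simp_all
    ultimately show "a * b \<le> z \<and> z < a * b + b" unfolding a by linarith
  next
    assume *: "a * b \<le> z \<and> z < a * b + b"
    show "z div b = a"
      by (rule int_div_pos_eq[where r="z - a * b"]) (use * in \<open>simp_all add: mult.commute\<close>)
  qed
  from this[OF zero_less_power[of 2 j]] show ?thesis
    by (intro set_eqI) (simp only: mem_Collect_eq atLeastLessThan_iff zero_less_numeral)
qed

definition dens :: "nat \<Rightarrow> int \<Rightarrow> move list \<Rightarrow> real" where
  "dens j a ms = real (occ {z. z div 2^j = a} ms) / 2^j"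

lemma dens_nonneg: "dens j a ms \<ge> 0"
  by (simp add: dens_def)

lemma prob_dens_child_ge:
  assumes "0 < \<eta>" "\<eta> \<le> 1"
  shows "measure_pmf.prob (rw d T) {ms. dens j a ms \<ge> (1 + \<eta>) * dens (Suc j) (a div 2) ms + \<theta>}
     \<le> exp (2 * \<eta> - \<eta> * \<theta> / ((2 * real d + 2) * 2^j))"
proof -
  define lo where "lo = (a div 2) * 2^Suc j"
  have par: "{z. z div 2^Suc j = a div 2} = {lo..<lo + 2 * int (2^j)}"
    unfolding dyadic_window lo_def by simp
  obtain q where q: "q = a div 2" by simp
  then have "a = 2 * q \<or> a = 2 * q + 1" by presburger
  then have "a * 2^j = lo \<or> a * 2^j = lo + 2^j"
    unfolding lo_def q[symmetric] by (auto simp: algebra_simps)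
  then have "{z. z div 2^j = a} = {lo..<lo + int (2^j)} \<or> {z. z div 2^j = a} = {lo + int (2^j)..<lo + 2 * int (2^j)}"
    unfolding dyadic_window by auto
  from prob_density_of_half_ge[OF _ assms this, where d=d and T=T and \<theta>=\<theta>]
  show ?thesis unfolding dens_def par by (simp add: mult.commute)
qed

lemma exp_minus_le_fact: "x > 0 \<Longrightarrow> exp (- x) \<le> fact k / x ^ k" for x :: real
proof -
  assume x: "x > 0"
  have "x ^ k / fact k \<le> exp x"
  proof -
    have "(\<Sum>n\<in>{k}. x ^ n / fact n) \<le> (\<Sum>n. x ^ n / fact n)"
      using x summable_exp[of x] by (intro sum_le_suminf) (auto simp: field_simps)
    then show ?thesis by (simp add: exp_def field_simps)
  qed
  then show ?thesis using x by (simp add: exp_minus field_simps)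
qed

lemma occ_eq_0:
  assumes "\<And>k. k < length ms \<Longrightarrow> altitude (take k ms) \<notin> S"
  shows "occ S ms = 0"
  using assms by (auto simp: occ_def)

lemma sum_three_quarters: "(\<Sum>l=1..i. (3/4::real)^l) \<le> 3"
proof -
  have "(\<Sum>l=1..i. (3/4::real)^l) = 3 - 3 * (3/4)^i"
    by (induction i) (auto simp: algebra_simps)
  then show ?thesis by simp
qed

text \<open>At the \<open>i\<close>-th dyadic level below the top the density is allowed to grow by a relative and an
  absolute amount \<open>(3/4) ^ i\<close>. The product of the growth factors converges, while the exponents
  \<open>(3/4) ^ i * (3/4) ^ i * 2 ^ i = (9/8) ^ i\<close> beat the number of windows.\<close>

lemma prob_dens_cascade_le:
  fixes A v :: real
  assumes A: "A \<ge> 0" and v: "v > 0"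
  shows "measure_pmf.prob (rw d T)
    {ms. (\<forall>k\<le>T. \<bar>real_of_int (altitude (take k ms))\<bar> \<le> A) \<and> (\<forall>a. dens t a ms \<le> v) \<and>
         (\<exists>z. real (occ {z} ms) > 108 * v)}
    \<le> (2 * (A / 2^t) + 3) * exp 2 * fact 12 * ((2 * real d + 2) * 2^t / v) ^ 12"
proof -
  define \<eta> :: "nat \<Rightarrow> real" where "\<eta> i = (3/4)^i" for i
  have eta: "0 < \<eta> i" "\<eta> i \<le> 1" for i by (auto simp: \<eta>_def power_le_one)
  \<comment> \<open>The windows of this level that can meet altitudes in \<open>[-A, A]\<close>. All
    others have density 0, so the union bound is finite.\<close>
  define I where "I i = {- \<lfloor>A / 2^(t - i)\<rfloor> - 1 .. \<lfloor>A / 2^(t - i)\<rfloor>}" for i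
  define Bd where "Bd i a = {ms. dens (t - i) a ms \<ge> (1 + \<eta> i) * dens (Suc (t - i)) (a div 2) ms + v * \<eta> i}" for i a
  let ?E = "{ms. (\<forall>k\<le>T. \<bar>real_of_int (altitude (take k ms))\<bar> \<le> A) \<and> (\<forall>a. dens t a ms \<le> v) \<and>
         (\<exists>z. real (occ {z} ms) > 108 * v)}"
  let ?P = "measure_pmf.prob (rw d T)"
  have "?P ?E \<le> ?P (\<Union>i\<in>{1..t}. \<Union>a\<in>I i. Bd i a)"
  proof (rule measure_pmf.finite_measure_mono_AE, rule AE_pmfI, safe)
    fix ms z
    assume ms: "ms \<in> set_pmf (rw d T)" and rng: "\<forall>k\<le>T. \<bar>real_of_int (altitude (take k ms))\<bar> \<le> A"
      and top: "\<forall>a. dens t a ms \<le> v" and z: "real (occ {z} ms) > 108 * v"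
    have len: "length ms = T" using ms by (simp add: set_rw)
    show "ms \<in> (\<Union>i\<in>{1..t}. \<Union>a\<in>I i. Bd i a)"
    proof (rule ccontr)
      assume "ms \<notin> (\<Union>i\<in>{1..t}. \<Union>a\<in>I i. Bd i a)"
      then have nb: "dens (t - i) a ms < (1 + \<eta> i) * dens (Suc (t - i)) (a div 2) ms + v * \<eta> i"
        if "i \<in> {1..t}" "a \<in> I i" for i a
        using that by (force simp: Bd_def not_le)
      have out: "dens j a ms = 0" if ji: "j = t - i" and aI: "a \<notin> I i" for i j a
      proof -
        have "altitude (take k ms) div 2^j \<noteq> a" if k: "k < length ms" for k
        proof
          assume eq: "altitude (take k ms) div 2^j = a"
          define h where "h = altitude (take k ms)"
          have h: "\<bar>real_of_int h\<bar> \<le> A" using rng k len by (simp add: h_def)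
          have "h \<in> {z. z div 2^j = a}" using eq by (simp add: h_def)
          then have "a * 2^j \<le> h" "h < a * 2^j + 2^j" unfolding dyadic_window by auto
          then have "real_of_int (a * 2^j) \<le> real_of_int h" "real_of_int h < real_of_int (a * 2^j + 2^j)"
            by (simp_all only: of_int_le_iff of_int_less_iff)
          then have "real_of_int a * 2^j \<le> A" "- A < real_of_int (a + 1) * 2^j" using h by (auto simp: algebra_simps)
          then have "real_of_int a \<le> A / 2^j" "- (A / 2^j) < real_of_int (a + 1)"
            by (simp_all add: field_simps)
          then have "a \<in> I i" unfolding I_def ji[symmetric] by (simp add: le_floor_iff) linarith
          then show False using aI by simp
        qed
        then show ?thesis by (simp add: dens_def occ_eq_0)
      qed
      \<comment> \<open>Relative growth contributes the exponential of the partial sum, by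
        \<open>1 + x \<le> exp x\<close>; the absolute increments \<open>v * \<eta> l\<close>
        contribute the factor one plus the partial sum. Windows outside \<open>I\<close> satisfy the
        bound since their density is 0.\<close>
      have main: "dens (t - i) a ms \<le> v * exp (\<Sum>l=1..i. \<eta> l) * (1 + (\<Sum>l=1..i. \<eta> l))" if "i \<le> t" for i a
        using that
      proof (induction i arbitrary: a)
        case 0
        then show ?case using top by simp
      next
        case (Suc i)
        define S where "S = (\<Sum>l=1..i. \<eta> l)"
        have S: "S \<ge> 0" unfolding S_def using eta by (intro sum_nonneg) (auto intro: less_imp_le)
        have S': "(\<Sum>l=1..Suc i. \<eta> l) = S + \<eta> (Suc i)" by (simp add: S_def)
        have e: "\<eta> (Suc i) > 0" by (rule eta)
        show ?case
        proof (cases "a \<in> I (Suc i)")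
          case True
          have "dens (t - Suc i) a ms \<le> (1 + \<eta> (Suc i)) * dens (Suc (t - Suc i)) (a div 2) ms + v * \<eta> (Suc i)"
            using nb[of "Suc i" a] True Suc.prems by simp
          also have "Suc (t - Suc i) = t - i" using Suc.prems by simp
          also have "(1 + \<eta> (Suc i)) * dens (t - i) (a div 2) ms + v * \<eta> (Suc i)
             \<le> exp (\<eta> (Suc i)) * (v * exp S * (1 + S)) + v * \<eta> (Suc i) * exp (S + \<eta> (Suc i))"
          proof (rule add_mono)
            show "(1 + \<eta> (Suc i)) * dens (t - i) (a div 2) ms \<le> exp (\<eta> (Suc i)) * (v * exp S * (1 + S))"
              using Suc.IH[of "a div 2"] Suc.prems e v S unfolding S_def
              by (intro mult_mono) (auto simp: dens_nonneg)
            have "1 \<le> exp (S + \<eta> (Suc i))" using S e by simp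
            then show "v * \<eta> (Suc i) \<le> v * \<eta> (Suc i) * exp (S + \<eta> (Suc i))"
              using v e mult_left_mono[of 1 "exp (S + \<eta> (Suc i))" "v * \<eta> (Suc i)"] by simp
          qed
          also have "\<dots> = v * exp (S + \<eta> (Suc i)) * (1 + (S + \<eta> (Suc i)))"
            by (simp add: exp_add algebra_simps)
          finally show ?thesis unfolding S' .
        next
          case False
          then have "dens (t - Suc i) a ms = 0" using out by blast
          then show ?thesis using S e v unfolding S' by simp
        qed
      qed
      define S where "S = (\<Sum>l=1..t. \<eta> l)"
      have S: "0 \<le> S" "S \<le> 3" using sum_three_quarters[of t] eta
        by (auto simp: S_def \<eta>_def intro!: sum_nonneg)
      have "real (occ {z} ms) = dens (t - t) z ms" by (simp add: dens_def)
      also have "\<dots> \<le> v * exp S * (1 + S)" using main[of t z] by (simp add: S_def)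
      \<comment> \<open>The origin of 108: \<open>S \<le> 3\<close> gives
        \<open>exp S \<le> 27\<close> and \<open>1 + S \<le> 4\<close>.\<close>
      also have "\<dots> \<le> v * 27 * 4"
      proof (intro mult_mono)
        have "exp S \<le> exp 3" using S by simp
        also have "exp 3 = (exp 1 :: real)^3" by (simp add: exp_of_nat_mult[symmetric])
        also have "\<dots> \<le> 3^3" by (intro power_mono exp_le) auto
        finally show "exp S \<le> 27" by simp
      qed (use v S in auto)
      finally show False using z by simp
    qed
  qed simp
  also have "\<dots> \<le> (\<Sum>i\<in>{1..t}. ?P (\<Union>a\<in>I i. Bd i a))"
    by (intro measure_pmf.finite_measure_subadditive_finite) auto
  also have "\<dots> \<le> (\<Sum>i\<in>{1..t}. \<Sum>a\<in>I i. ?P (Bd i a))"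
    by (intro sum_mono measure_pmf.finite_measure_subadditive_finite) (auto simp: I_def)
  also have "\<dots> \<le> (\<Sum>i\<in>{1..t}. (2 * (A / 2^t) + 3) * exp 2 * fact 12 * ((2 * real d + 2) * 2^t / v) ^ 12 * (1/2)^i)"
  proof (rule sum_mono)
    fix i assume i: "i \<in> {1..t}"
    have tw: "(2::real)^(t - i) = 2^t / 2^i" using i by (simp add: power_diff)
    define x where "x = v / ((2 * real d + 2) * 2^t)"
    have x: "x > 0" using v by (simp add: x_def)
    have P1: "?P (Bd i a) \<le> exp 2 * (fact 12 * (1 / x)^12 * (1/4)^i)" for a
    proof -
      have "?P (Bd i a) \<le> exp (2 * \<eta> i - \<eta> i * (v * \<eta> i) / ((2 * real d + 2) * 2^(t - i)))"
        unfolding Bd_def by (rule prob_dens_child_ge[OF eta])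
      also have "\<eta> i * (v * \<eta> i) / ((2 * real d + 2) * 2^(t - i)) = x * (9/8)^i"
      proof -
        have "(3/4::real)^i * (3/4)^i * 2^i = (9/8)^i"
        proof -
          have "(3/4::real)^i * (3/4)^i * 2^i = ((3/4) * (3/4) * 2)^i" by (simp only: power_mult_distrib)
          then show ?thesis by simp
        qed
        moreover have "p * (v * p) / (D * (Tt / q)) = v / (D * Tt) * (p * p * q)" for p q D Tt :: real by simp
        ultimately show ?thesis unfolding tw x_def \<eta>_def by (simp only:)
      qed
      also have "exp (2 * \<eta> i - x * (9/8)^i) \<le> exp 2 * exp (- (x * (9/8)^i))"
        using eta[of i] by (simp add: exp_add[symmetric])
      \<comment> \<open>The power 12 is chosen because \<open>(9/8)^12 \<ge> 4\<close>: the decay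
        \<open>4^(-i)\<close> beats the number of windows, of order \<open>2^i\<close>, and leaves a
        geometric series.\<close>
      also have "exp (- (x * (9/8)^i)) \<le> fact 12 / (x * (9/8)^i)^12"
        using x by (intro exp_minus_le_fact) auto
      also have "\<dots> = fact 12 * (1/x)^12 / ((9/8)^12)^i"
      proof -
        have "((9/8::real)^i)^12 = ((9/8)^12)^i" by (simp only: power_mult[symmetric] mult.commute[of i])
        then show ?thesis by (simp only: power_mult_distrib power_one_over times_divide_eq_right mult_1_right divide_divide_eq_left)
      qed
      also have "\<dots> \<le> fact 12 * (1/x)^12 / 4^i"
      proof (rule divide_left_mono)
        have "(4::real) \<le> (9/8)^12" by (simp add: power_divide)
        then show "(4::real)^i \<le> ((9/8)^12)^i" by (intro power_mono) auto
      qed (use x in auto)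
      finally show ?thesis by (simp add: power_divide)
    qed
    have cardI: "real (card (I i)) \<le> (2 * (A / 2^t) + 3) * 2^i"
    proof -
      have "\<lfloor>A / 2^(t - i)\<rfloor> \<ge> 0" using A by simp
      then have "real (card (I i)) = 2 * real_of_int \<lfloor>A / 2^(t - i)\<rfloor> + 2" by (simp add: I_def)
      also have "\<dots> \<le> 2 * (A / 2^(t - i)) + 2" by linarith
      also have "\<dots> \<le> 2 * (A / 2^t) * 2^i + 3 * 2^i"
      proof -
        have eq: "A / 2^(t - i) = A / 2^t * 2^i" by (simp add: tw)
        show ?thesis unfolding eq mult.assoc using one_le_power[of "2::real" i] by linarith
      qed
      finally show ?thesis by (simp add: algebra_simps)
    qed
    have "(\<Sum>a\<in>I i. ?P (Bd i a)) \<le> real (card (I i)) * (exp 2 * (fact 12 * (1 / x)^12 * (1/4)^i))"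
      by (intro sum_bounded_above P1)
    also have "\<dots> \<le> (2 * (A / 2^t) + 3) * 2^i * (exp 2 * (fact 12 * (1 / x)^12 * (1/4)^i))"
      using x by (intro mult_right_mono cardI) auto
    also have "\<dots> = (2 * (A / 2^t) + 3) * exp 2 * fact 12 * (1 / x) ^ 12 * (2^i * (1/4)^i)"
      by (simp only: mult_ac)
    also have "(2::real)^i * (1/4)^i = (1/2)^i" by (simp only: power_mult_distrib[symmetric]) simp
    also have "1 / x = (2 * real d + 2) * 2^t / v" by (simp add: x_def)
    finally show "(\<Sum>a\<in>I i. ?P (Bd i a)) \<le> (2 * (A / 2^t) + 3) * exp 2 * fact 12 * ((2 * real d + 2) * 2^t / v) ^ 12 * (1/2)^i" .
  qed
  also have "\<dots> = (2 * (A / 2^t) + 3) * exp 2 * fact 12 * ((2 * real d + 2) * 2^t / v) ^ 12 * (\<Sum>i\<in>{1..t}. (1/2)^i)"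
    by (simp only: sum_distrib_left)
  also have "\<dots> \<le> (2 * (A / 2^t) + 3) * exp 2 * fact 12 * ((2 * real d + 2) * 2^t / v) ^ 12 * 1"
  proof (rule mult_left_mono)
    have "(\<Sum>i\<in>{1..t}. (1/2::real)^i) = 1 - (1/2)^t" by (induction t) (auto simp: algebra_simps)
    then show "(\<Sum>i\<in>{1..t}. (1/2::real)^i) \<le> 1" by simp
  qed (use A v in auto)
  finally show ?thesis by simp
qed

section \<open>A cut-off Green function\<close>

text \<open>Taylor's formula with Lagrange remainder, the fourth derivative being largest at
  \<open>1/2\<close>. The cubic term is kept because it gets a favourable sign once two opposite
  steps are added.\<close>

lemma powr_minus_le_Taylor4:
  fixes \<alpha> :: real
  assumes "\<alpha> > 0"
  obtains C where "C \<ge> 0"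
    "\<And>e. \<bar>e\<bar> \<le> 1/2 \<Longrightarrow> (1 + e) powr (-\<alpha>) \<le> 1 - \<alpha>*e + \<alpha>*(\<alpha>+1)/2*e^2 - \<alpha>*(\<alpha>+1)*(\<alpha>+2)/6*e^3 + C*e^4"
proof -
  define df where "df m t = (\<Prod>i<m. - (\<alpha> + real i)) * t powr (-\<alpha> - real m)" for m :: nat and t :: real
  define C where "C = \<alpha>*(\<alpha>+1)*(\<alpha>+2)*(\<alpha>+3)/24 * (1/2) powr (-\<alpha>-4)"
  have C: "C \<ge> 0" using assms by (simp add: C_def)
  have "(1 + e) powr (-\<alpha>) \<le> 1 - \<alpha>*e + \<alpha>*(\<alpha>+1)/2*e^2 - \<alpha>*(\<alpha>+1)*(\<alpha>+2)/6*e^3 + C*e^4" if e: "\<bar>e\<bar> \<le> 1/2" for e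
  proof (cases "e = 0")
    case False
    have "\<exists>t. (if 1 + e < 1 then 1 + e < t \<and> t < 1 else 1 < t \<and> t < 1 + e) \<and>
       (1 + e) powr (-\<alpha>) = (\<Sum>m<4. df m 1 / fact m * (1 + e - 1)^m) + df 4 t / fact 4 * (1 + e - 1)^4"
    proof (rule Taylor[where a="1/2" and b="3/2"])
      show "df 0 = (\<lambda>x. x powr (-\<alpha>))" by (simp add: df_def fun_eq_iff)
      show "\<forall>m t. m < 4 \<and> 1/2 \<le> t \<and> t \<le> 3/2 \<longrightarrow> (df m has_real_derivative df (Suc m) t) (at t)"
      proof safe
        fix m :: nat and t :: real assume t: "1/2 \<le> t" "t \<le> 3/2"
        have "((\<lambda>t. t powr (-\<alpha> - real m)) has_real_derivative (-\<alpha> - real m) * t powr (-\<alpha> - real m - 1)) (at t)"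
          using t by (intro has_real_derivative_powr) auto
        from DERIV_cmult[OF this, of "\<Prod>i<m. - (\<alpha> + real i)"]
        show "(df m has_real_derivative df (Suc m) t) (at t)"
          by (simp add: df_def[abs_def] algebra_simps)
      qed
    qed (use e False in auto)
    then obtain t where t: "if 1 + e < 1 then 1 + e < t \<and> t < 1 else 1 < t \<and> t < 1 + e"
      and eq: "(1 + e) powr (-\<alpha>) = (\<Sum>m<4. df m 1 / fact m * e^m) + df 4 t / fact 4 * e^4" by auto
    have t2: "t \<ge> 1/2" using t e by (auto split: if_splits)
    have "t powr (-\<alpha>-4) \<le> (1/2) powr (-\<alpha>-4)"
      using t2 assms by (intro powr_mono2') auto
    moreover have "df 4 t / fact 4 = \<alpha>*(\<alpha>+1)*(\<alpha>+2)*(\<alpha>+3)/24 * t powr (-\<alpha>-4)"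
      by (simp add: df_def numeral_eq_Suc algebra_simps)
    ultimately have "df 4 t / fact 4 \<le> C"
      unfolding C_def using assms by (metis add_nonneg_nonneg divide_nonneg_nonneg less_eq_real_def mult_left_mono mult_nonneg_nonneg zero_le_numeral zero_le_one)
    then have "df 4 t / fact 4 * e^4 \<le> C * e^4"
      by (intro mult_right_mono) auto
    moreover have "(\<Sum>m<4. df m 1 / fact m * e^m) = 1 - \<alpha>*e + \<alpha>*(\<alpha>+1)/2*e^2 - \<alpha>*(\<alpha>+1)*(\<alpha>+2)/6*e^3"
      by (simp add: df_def numeral_eq_Suc algebra_simps, simp add: field_simps)
    ultimately show ?thesis using eq by linarith
  qed simp
  with C show ?thesis by (rule that)
qed

text \<open>If \<open>\<rho>\<close> is \<open>\<kappa>\<close> plus a squared distance, a unit step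
  along a coordinate of value \<open>x\<close> changes \<open>\<rho>\<close> by
  \<open>1 + 2*x\<close> or \<open>1 - 2*x\<close>. Put \<open>a = 1/\<rho>\<close> and
  \<open>b = 2*x/\<rho>\<close>; then \<open>b^2 \<le> 4*a\<close>, so every term beyond
  \<open>a\<close> and \<open>b^2\<close> is either of order \<open>a^2\<close> or negative. The
  bound 64 ensures that the relative change is at most \<open>1/2\<close>.\<close>

lemma powr_minus_second_difference_le:
  fixes \<alpha> :: real
  assumes \<alpha>: "\<alpha> > 0"
  obtains C where "C \<ge> 0"
    "\<And>\<rho> x. \<rho> \<ge> 64 \<Longrightarrow> x^2 \<le> \<rho> \<Longrightarrow> (\<rho> + 1 + 2*x) powr (-\<alpha>) + (\<rho> + 1 - 2*x) powr (-\<alpha>)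
        \<le> \<rho> powr (-\<alpha>) * (2 - 2*\<alpha>/\<rho> + 4*\<alpha>*(\<alpha>+1)*x^2/\<rho>^2 + C/\<rho>^2)"
proof -
  obtain C where C: "C \<ge> 0" and T: "\<And>e. \<bar>e\<bar> \<le> 1/2 \<Longrightarrow>
     (1 + e) powr (-\<alpha>) \<le> 1 - \<alpha>*e + \<alpha>*(\<alpha>+1)/2*e^2 - \<alpha>*(\<alpha>+1)*(\<alpha>+2)/6*e^3 + C*e^4"
    by (rule powr_minus_le_Taylor4[OF \<alpha>]) (rule that)
  have "(\<rho> + 1 + 2*x) powr (-\<alpha>) + (\<rho> + 1 - 2*x) powr (-\<alpha>)
        \<le> \<rho> powr (-\<alpha>) * (2 - 2*\<alpha>/\<rho> + 4*\<alpha>*(\<alpha>+1)*x^2/\<rho>^2 + (\<alpha>*(\<alpha>+1) + 272*C)/\<rho>^2)"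
    if r: "\<rho> \<ge> 64" "x^2 \<le> \<rho>" for \<rho> x
  proof -
    define a b where "a = 1/\<rho>" and "b = 2*x/\<rho>"
    have a: "a > 0" using r by (simp add: a_def)
    have b2: "b^2 \<le> 4 * a"
      using r by (simp add: a_def b_def power_divide power2_eq_square field_simps)
    have a64: "a \<le> 1/64" using r by (simp add: a_def field_simps)
    have "b^2 \<le> (1/4)^2" using b2 a64 by (simp add: power2_eq_square)
    then have bb: "\<bar>b\<bar> \<le> 1/4" by (subst (asm) abs_le_square_iff[symmetric]) auto
    have e1: "\<bar>a + b\<bar> \<le> 1/2" "\<bar>a - b\<bar> \<le> 1/2" using a a64 bb by linarith+
    have f1: "\<rho> + 1 + 2*x = \<rho> * (1 + (a+b))" "\<rho> + 1 - 2*x = \<rho> * (1 + (a-b))"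
      using r by (auto simp: a_def b_def field_simps)
    have f2: "(\<rho> + 1 + 2*x) powr (-\<alpha>) = \<rho> powr (-\<alpha>) * (1 + (a+b)) powr (-\<alpha>)"
      unfolding f1 by (rule powr_mult)
    have f3: "(\<rho> + 1 - 2*x) powr (-\<alpha>) = \<rho> powr (-\<alpha>) * (1 + (a-b)) powr (-\<alpha>)"
      unfolding f1 by (rule powr_mult)
    have "(1 + (a+b)) powr (-\<alpha>) + (1 + (a-b)) powr (-\<alpha>) \<le>
       (1 - \<alpha>*(a+b) + \<alpha>*(\<alpha>+1)/2*(a+b)^2 - \<alpha>*(\<alpha>+1)*(\<alpha>+2)/6*(a+b)^3 + C*(a+b)^4) +
       (1 - \<alpha>*(a-b) + \<alpha>*(\<alpha>+1)/2*(a-b)^2 - \<alpha>*(\<alpha>+1)*(\<alpha>+2)/6*(a-b)^3 + C*(a-b)^4)"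
      by (intro add_mono T e1)
    also have "\<dots> = 2 - 2*\<alpha>*a + \<alpha>*(\<alpha>+1)*a^2 + \<alpha>*(\<alpha>+1)*b^2 - \<alpha>*(\<alpha>+1)*(\<alpha>+2)/6*(2*a^3+6*a*b^2)
         + 2*C*(a^4 + 6*a^2*b^2 + b^4)"
    proof -
      have "(1 - \<alpha>*(a+b) + P*(a+b)^2 - Q*(a+b)^3 + C*(a+b)^4) + (1 - \<alpha>*(a-b) + P*(a-b)^2 - Q*(a-b)^3 + C*(a-b)^4)
        = 2 - 2*\<alpha>*a + 2*P*a^2 + 2*P*b^2 - Q*(2*a^3+6*a*b^2) + 2*C*(a^4 + 6*a^2*b^2 + b^4)" for P Q
        by (simp add: power2_eq_square power3_eq_cube power4_eq_xxxx algebra_simps)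
      from this[of "\<alpha>*(\<alpha>+1)/2" "\<alpha>*(\<alpha>+1)*(\<alpha>+2)/6"] show ?thesis by simp
    qed
    also have "\<dots> \<le> 2 - 2*\<alpha>*a + \<alpha>*(\<alpha>+1)*a^2 + \<alpha>*(\<alpha>+1)*b^2 + 272*C*a^2"
    proof -
      have "0 \<le> \<alpha>*(\<alpha>+1)*(\<alpha>+2)/6*(2*a^3+6*a*b^2)" using \<alpha> a by simp
      moreover have "2*C*(a^4 + 6*a^2*b^2 + b^4) \<le> 272*C*a^2"
      proof -
        have "a^4 \<le> a^2 * 1" using a a64 by (simp add: power4_eq_xxxx power2_eq_square mult_le_one)
        moreover have "a^2*b^2 \<le> a^2 * 1" using b2 a64 by (intro mult_left_mono) auto
        moreover have "b^4 \<le> 16*a^2" using power_mono[OF b2, of 2] by (simp add: power_mult_distrib)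
        moreover have "0 \<le> a^2" by simp
        ultimately have "a^4 + 6*(a^2*b^2) + b^4 \<le> 136*a^2" by linarith
        then have "a^4 + 6*a^2*b^2 + b^4 \<le> 136*a^2" by (simp add: mult.assoc)
        then show ?thesis using mult_left_mono[of _ _ "2*C"] C by fastforce
      qed
      ultimately show ?thesis by linarith
    qed
    also have "\<dots> = 2 - 2*\<alpha>/\<rho> + 4*\<alpha>*(\<alpha>+1)*x^2/\<rho>^2 + (\<alpha>*(\<alpha>+1) + 272*C)/\<rho>^2"
      using r by (simp add: a_def b_def power_divide add_divide_distrib power_mult_distrib)
    finally show ?thesis unfolding f2 f3 distrib_left[symmetric] by (intro mult_left_mono) auto
  qed
  moreover have "\<alpha>*(\<alpha>+1) + 272*C \<ge> 0" using C \<alpha> by simp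
  ultimately show ?thesis by (rule that[rotated])
qed

text \<open>In the continuum \<open>(\<kappa> + |x|\<^sup>2) powr (- (D - 2) / 2)\<close> is superharmonic in dimension
  \<open>D = d + 1\<close>, with a negative Laplacian of order \<open>\<kappa> (\<kappa> + |x|\<^sup>2) powr (- (D + 2) / 2)\<close>. For large
  \<open>\<kappa>\<close> this absorbs the discretisation error, which has the same decay.\<close>

lemma powr_sum_squares_superharmonic:
  fixes d :: nat
  assumes d: "d \<ge> 2"
  defines "\<alpha> \<equiv> (real d - 1) / 2"
  obtains \<kappa> where "\<kappa> \<ge> 64"
    "\<And>c :: nat \<Rightarrow> real. (\<Sum>i\<le>d. (\<kappa> + (\<Sum>j\<le>d. (c j)^2) + 1 + 2 * c i) powr (-\<alpha>) + (\<kappa> + (\<Sum>j\<le>d. (c j)^2) + 1 - 2 * c i) powr (-\<alpha>))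
       \<le> 2 * real (d+1) * (\<kappa> + (\<Sum>j\<le>d. (c j)^2)) powr (-\<alpha>)"
proof -
  have \<alpha>: "\<alpha> > 0" using d by (simp add: \<alpha>_def)
  obtain C where C: "C \<ge> 0" and T: "\<And>\<rho> x. \<rho> \<ge> 64 \<Longrightarrow> x^2 \<le> \<rho> \<Longrightarrow> (\<rho> + 1 + 2*x) powr (-\<alpha>) + (\<rho> + 1 - 2*x) powr (-\<alpha>)
        \<le> \<rho> powr (-\<alpha>) * (2 - 2*\<alpha>/\<rho> + 4*\<alpha>*(\<alpha>+1)*x^2/\<rho>^2 + C/\<rho>^2)"
    by (rule powr_minus_second_difference_le[OF \<alpha>]) (rule that)
  define \<kappa> where "\<kappa> = max 64 (C / (2*\<alpha>))"
  have k: "\<kappa> \<ge> 64" "C \<le> 2*\<alpha>*\<kappa>" using \<alpha> by (auto simp: \<kappa>_def field_simps max_def)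
  have "(\<Sum>i\<le>d. (\<kappa> + (\<Sum>j\<le>d. (c j)^2) + 1 + 2 * c i) powr (-\<alpha>) + (\<kappa> + (\<Sum>j\<le>d. (c j)^2) + 1 - 2 * c i) powr (-\<alpha>))
       \<le> 2 * real (d+1) * (\<kappa> + (\<Sum>j\<le>d. (c j)^2)) powr (-\<alpha>)" for c :: "nat \<Rightarrow> real"
  proof -
    define Q where "Q = (\<Sum>j\<le>d. (c j)^2)"
    define \<rho> where "\<rho> = \<kappa> + Q"
    have Q0: "Q \<ge> 0" by (simp add: Q_def sum_nonneg)
    have ci: "(c i)^2 \<le> Q" if "i \<le> d" for i
      unfolding Q_def using that by (intro member_le_sum) auto
    have r: "\<rho> \<ge> 64" using k Q0 by (simp add: \<rho>_def)
    have "(\<Sum>i\<le>d. (\<rho> + 1 + 2 * c i) powr (-\<alpha>) + (\<rho> + 1 - 2 * c i) powr (-\<alpha>))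
       \<le> (\<Sum>i\<le>d. \<rho> powr (-\<alpha>) * (2 - 2*\<alpha>/\<rho> + 4*\<alpha>*(\<alpha>+1)*(c i)^2/\<rho>^2 + C/\<rho>^2))"
      using r k ci by (intro sum_mono T) (auto simp: \<rho>_def intro: add_increasing)
    also have "\<dots> = \<rho> powr (-\<alpha>) * (real (d+1) * (2 - 2*\<alpha>/\<rho> + C/\<rho>^2) + 4*\<alpha>*(\<alpha>+1)/\<rho>^2 * Q)"
      by (simp add: sum_distrib_left[symmetric] sum.distrib sum_subtractf Q_def algebra_simps sum_divide_distrib[symmetric])
    \<comment> \<open>This identity is what singles out the exponent: the first-order and
      second-order contributions cancel except for the share of \<open>\<kappa>\<close> in
      \<open>\<rho>\<close>, leaving \<open>C - 2*\<alpha>*\<kappa>\<close> over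
      \<open>\<rho>^2\<close>.\<close>
    also have "4*\<alpha>*(\<alpha>+1) = 2*\<alpha>*real (d+1)" by (simp add: \<alpha>_def field_simps)
    also have "\<rho> powr (-\<alpha>) * (real (d+1) * (2 - 2*\<alpha>/\<rho> + C/\<rho>^2) + 2*\<alpha>*real (d+1)/\<rho>^2 * Q)
       = \<rho> powr (-\<alpha>) * real (d+1) * (2 + (C - 2*\<alpha>*\<kappa>)/\<rho>^2)"
    proof -
      have "2*\<alpha>/\<rho> = 2*\<alpha>*(\<kappa>+Q)/\<rho>^2" using r by (simp add: \<rho>_def power2_eq_square)
      then show ?thesis by (simp add: field_simps add_divide_distrib diff_divide_distrib)
    qed
    also have "\<dots> \<le> \<rho> powr (-\<alpha>) * real (d+1) * 2"
      using k by (intro mult_left_mono) (auto simp: divide_nonpos_nonneg)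
    finally show ?thesis by (simp add: \<rho>_def Q_def algebra_simps)
  qed
  with k(1) show ?thesis by (rule that)
qed

text \<open>A piecewise quadratic cut-off, so that its second differences are \<open>O(1 / R\<^sup>2)\<close>.\<close>

definition cutoff :: "real \<Rightarrow> int \<Rightarrow> real" where
  "cutoff R t = ((max 0 (2*R - \<bar>of_int t\<bar>))^2 - 2 * (max 0 (3*R/2 - \<bar>of_int t\<bar>))^2
      + (max 0 (R - \<bar>of_int t\<bar>))^2) / (R^2/2)"

lemma pos_part_sq_second_difference:
  fixes u :: real
  shows "0 \<le> (max 0 (u+1))^2 + (max 0 (u-1))^2 - 2*(max 0 u)^2"
    and "(max 0 (u+1))^2 + (max 0 (u-1))^2 - 2*(max 0 u)^2 \<le> 2"
proof -
  consider "u \<le> -1" | "-1 \<le> u" "u \<le> 0" | "0 \<le> u" "u \<le> 1" | "1 \<le> u" by linarith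
  then have "0 \<le> (max 0 (u+1))^2 + (max 0 (u-1))^2 - 2*(max 0 u)^2 \<and>
     (max 0 (u+1))^2 + (max 0 (u-1))^2 - 2*(max 0 u)^2 \<le> 2"
  proof cases
    case 1
    then have "max 0 (u+1) = 0" "max 0 (u-1) = 0" "max 0 u = 0" by auto
    then show ?thesis by simp
  next
    case 2
    then have "(u+1)^2 \<le> 1^2" by (intro power_mono) auto
    with 2 show ?thesis by (simp add: max_def)
  next
    case 3
    have "(u+1)^2 - 2*u^2 = 2 - (u-1)^2" by (simp add: power2_eq_square algebra_simps)
    moreover have "(u-1)^2 \<le> 1" using 3 by (simp add: abs_square_le_1)
    ultimately show ?thesis using 3 by (simp add: max_def)
  next
    case 4
    then show ?thesis by (simp add: max_def power2_eq_square algebra_simps)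
  qed
  then show "0 \<le> (max 0 (u+1))^2 + (max 0 (u-1))^2 - 2*(max 0 u)^2"
    "(max 0 (u+1))^2 + (max 0 (u-1))^2 - 2*(max 0 u)^2 \<le> 2" by auto
qed

lemma pos_part_sq_difference:
  fixes u :: real
  assumes "b \<ge> 1" "u \<le> b"
  shows "\<bar>(max 0 u)^2 - (max 0 (u-1))^2\<bar> \<le> 2*b"
proof -
  consider "u \<le> 0" | "0 \<le> u" "u \<le> 1" | "1 \<le> u" by linarith
  then show ?thesis
  proof cases
    case 2
    then have "u^2 \<le> 1" by (simp add: abs_square_le_1)
    with 2 assms show ?thesis by (simp add: max_def)
  next
    case 3
    have "u^2 - (u-1)^2 = 2*u - 1" by (simp add: power2_eq_square algebra_simps)
    with 3 assms show ?thesis by (simp add: max_def)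
  qed (use assms in auto)
qed

lemma cutoff_eq_1: "R > 0 \<Longrightarrow> \<bar>of_int t\<bar> \<le> R \<Longrightarrow> cutoff R t = 1"
  by (simp add: cutoff_def max_def power2_eq_square field_simps)

lemma cutoff_eq_0: "R > 0 \<Longrightarrow> \<bar>of_int t\<bar> \<ge> 2*R \<Longrightarrow> cutoff R t = 0"
  by (simp add: cutoff_def max_def)

lemma cutoff_bounds:
  assumes R: "R > 0"
  shows "0 \<le> cutoff R t" "cutoff R t \<le> 1"
proof -
  define e where "e = \<bar>real_of_int t\<bar> - R"
  have eq: "\<bar>real_of_int t\<bar> = R + e" by (simp add: e_def)
  consider "e \<le> 0" | "0 \<le> e" "e \<le> R/2" | "R/2 \<le> e" "e \<le> R" | "R \<le> e" by linarith
  then have "0 \<le> cutoff R t \<and> cutoff R t \<le> 1"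
  proof cases
    case 1 then show ?thesis using cutoff_eq_1[OF R, of t] by (simp add: e_def)
  next
    case 2
    have "cutoff R t = ((R-e)^2 - 2*(R/2-e)^2)/(R^2/2)"
      using 2 R by (simp add: cutoff_def eq max_def)
    also have "\<dots> = (R^2/2 - e^2)/(R^2/2)" by (simp add: power2_eq_square algebra_simps)
    finally have *: "cutoff R t = (R^2/2 - e^2)/(R^2/2)" .
    have "e^2 \<le> (R/2)^2" using 2 by (intro power_mono) auto
    also have "\<dots> \<le> R^2/2" using R by (simp add: power2_eq_square)
    finally have "e^2 \<le> R^2/2" .
    then show ?thesis unfolding * using R by simp
  next
    case 3
    have "cutoff R t = (R-e)^2/(R^2/2)"
      using 3 R by (simp add: cutoff_def eq max_def)
    moreover have "(R-e)^2 \<le> (R/2)^2" using 3 R by (intro power_mono) auto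
    moreover have "(R/2)^2 \<le> R^2/2" by (simp add: power2_eq_square)
    ultimately show ?thesis using R by (simp add: divide_le_eq)
  next
    case 4 then show ?thesis using cutoff_eq_0[OF R, of t] by (simp add: e_def)
  qed
  then show "0 \<le> cutoff R t" "cutoff R t \<le> 1" by auto
qed

lemma cutoff_uminus [simp]: "cutoff R (-t) = cutoff R t"
  by (simp add: cutoff_def)

lemma cutoff_second_difference:
  assumes R: "R \<ge> 1"
  shows "\<bar>cutoff R (t+1) + cutoff R (t-1) - 2 * cutoff R t\<bar> \<le> 8/R^2"
proof -
  \<comment> \<open>For \<open>t \<ge> 1\<close> the three arguments are nonnegative, so the
    absolute values disappear and each squared positive part is differenced separately. Symmetry
    gives negative \<open>t\<close>; at 0 the cut-off is flat.\<close>
  have *: "\<bar>cutoff R (t+1) + cutoff R (t-1) - 2 * cutoff R t\<bar> \<le> 8/R^2" if t: "t \<ge> 1" for t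
  proof -
    define q where "q u = (max 0 u)^2" for u :: real
    define D where "D u = q (u+1) + q (u-1) - 2*q u" for u
    have D: "0 \<le> D u" "D u \<le> 2" for u
      using pos_part_sq_second_difference[of u] by (auto simp: D_def q_def)
    have "cutoff R (t+1) + cutoff R (t-1) - 2 * cutoff R t
        = (D (2*R - t) - 2 * D (3*R/2 - t) + D (R - t)) / (R^2/2)"
    proof -
      have "cutoff R (t+1) = (q ((2*R - t) - 1) - 2 * q ((3*R/2 - t) - 1) + q ((R - t) - 1)) / (R^2/2)"
        "cutoff R (t-1) = (q ((2*R - t) + 1) - 2 * q ((3*R/2 - t) + 1) + q ((R - t) + 1)) / (R^2/2)"
        "cutoff R t = (q (2*R - t) - 2 * q (3*R/2 - t) + q (R - t)) / (R^2/2)"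
        using t by (simp_all add: cutoff_def q_def algebra_simps)
      moreover have "a/K + b/K - 2*(c/K) = (a+b-2*c)/K" for a b c K :: real
        by (simp add: add_divide_distrib diff_divide_distrib)
      ultimately show ?thesis by (simp only: D_def) (rule arg_cong2[where f="(/)"], simp_all)
    qed
    also have "\<bar>\<dots>\<bar> \<le> 4 / (R^2/2)"
      unfolding abs_divide using R D[of "2*R-t"] D[of "3*R/2-t"] D[of "R-t"]
      by (intro frac_le) auto
    finally show ?thesis by simp
  qed
  show ?thesis
  proof (cases t "0::int" rule: linorder_cases)
    case greater then show ?thesis using *[of t] by simp
  next
    case equal
    then show ?thesis using R by (simp add: cutoff_eq_1)
  next
    case less
    have "-t-1 = -(t+1)" "-t+1 = -(t-1)" by auto
    then have "cutoff R (t+1) = cutoff R (-t-1)" "cutoff R (t-1) = cutoff R (-t+1)" "cutoff R t = cutoff R (-t)"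
      by (simp_all only: cutoff_uminus)
    then show ?thesis using *[of "-t"] less by (simp add: algebra_simps)
  qed
qed

lemma cutoff_difference:
  assumes R: "R \<ge> 1"
  shows "\<bar>cutoff R (t-1) - cutoff R t\<bar> \<le> 32/R"
proof -
  have *: "\<bar>cutoff R (t-1) - cutoff R t\<bar> \<le> 32/R" if t: "t \<ge> 1" for t
  proof -
    define q where "q u = (max 0 u)^2" for u :: real
    define D where "D u = q u - q (u-1)" for u
    have D: "\<bar>D u\<bar> \<le> 4*R" if "u \<le> 2*R" for u
      using pos_part_sq_difference[of "2*R" u] R that by (auto simp: D_def q_def)
    have "cutoff R (t-1) - cutoff R t
        = (D (2*R - t + 1) - 2 * D (3*R/2 - t + 1) + D (R - t + 1)) / (R^2/2)"
    proof -
      have "cutoff R (t-1) = (q (2*R - t + 1) - 2 * q (3*R/2 - t + 1) + q (R - t + 1)) / (R^2/2)"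
        "cutoff R t = (q (2*R - t + 1 - 1) - 2 * q (3*R/2 - t + 1 - 1) + q (R - t + 1 - 1)) / (R^2/2)"
        using t by (simp_all add: cutoff_def q_def algebra_simps)
      then show ?thesis
        by (simp only: D_def diff_divide_distrib[symmetric]) (rule arg_cong2[where f="(/)"], simp_all)
    qed
    also have "\<bar>\<dots>\<bar> \<le> (16*R) / (R^2/2)"
    proof -
      have "\<bar>D (2*R - t + 1) - 2 * D (3*R/2 - t + 1) + D (R - t + 1)\<bar> \<le> 16*R"
        using D[of "2*R-t+1"] D[of "3*R/2-t+1"] D[of "R-t+1"] t R by linarith
      then show ?thesis unfolding abs_divide using R by (intro frac_le) auto
    qed
    finally show ?thesis using R by (simp add: power2_eq_square)
  qed
  show ?thesis
  proof (cases "t \<ge> 1")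
    case False
    have "cutoff R (t-1) = cutoff R (1-t)" using cutoff_uminus[of R "t-1"] by simp
    then show ?thesis using *[of "1-t"] False by (simp add: abs_minus_commute)
  qed (rule *)
qed

lemma powr_minus_difference_le:
  fixes \<alpha> u w :: real
  assumes "\<alpha> > 0" "0 < u" "u \<le> w"
  shows "u powr (-\<alpha>) - w powr (-\<alpha>) \<le> \<alpha> * u powr (-\<alpha>-1) * (w - u)"
proof (cases "u = w")
  case False
  have "\<exists>z. u < z \<and> z < w \<and> w powr (-\<alpha>) - u powr (-\<alpha>) = (w - u) * (-\<alpha> * z powr (-\<alpha>-1))"
    using assms False by (intro MVT2) (auto intro!: derivative_eq_intros)
  then obtain z where z: "u < z" "z < w" "w powr (-\<alpha>) - u powr (-\<alpha>) = (w - u) * (-\<alpha> * z powr (-\<alpha>-1))" by blast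
  have "z powr (-\<alpha>-1) \<le> u powr (-\<alpha>-1)" using z assms by (intro powr_mono2') auto
  then have "(w - u) * \<alpha> * z powr (-\<alpha>-1) \<le> (w - u) * \<alpha> * u powr (-\<alpha>-1)"
    using assms by (intro mult_left_mono) auto
  then show ?thesis using z by (simp add: algebra_simps)
qed simp

text \<open>The kernel \<open>|x|^(-(D - 2))\<close> of dimension \<open>D = d + 1\<close>,
  regularised at the origin and cut off in every coordinate. Coordinate \<open>d\<close> is the
  vertical one.\<close>

definition cut_green :: "nat \<Rightarrow> real \<Rightarrow> real \<Rightarrow> (nat \<Rightarrow> int) \<Rightarrow> real" where
  "cut_green d \<kappa> R c = (\<kappa> + (\<Sum>i\<le>d. (of_int (c i))^2)) powr (- (real d - 1) / 2) * (\<Prod>i\<le>d. cutoff R (c i))"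

lemma cut_green_nonneg: "R > 0 \<Longrightarrow> cut_green d \<kappa> R c \<ge> 0"
  by (auto simp: cut_green_def cutoff_bounds intro!: mult_nonneg_nonneg prod_nonneg)

lemma cut_green_le:
  assumes "R > 0"
  shows "cut_green d \<kappa> R c \<le> (\<kappa> + (\<Sum>i\<le>d. (of_int (c i))^2)) powr (- (real d - 1) / 2)"
proof -
  have "(\<Prod>i\<le>d. cutoff R (c i)) \<le> 1"
    using assms by (intro prod_le_1) (auto simp: cutoff_bounds)
  then show ?thesis unfolding cut_green_def by (intro mult_left_le) auto
qed

lemma cut_green_eq:
  assumes "R > 0" "\<And>i. i \<le> d \<Longrightarrow> \<bar>of_int (c i)\<bar> \<le> R"
  shows "cut_green d \<kappa> R c = (\<kappa> + (\<Sum>i\<le>d. (of_int (c i))^2)) powr (- (real d - 1) / 2)"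
  using assms by (simp add: cut_green_def cutoff_eq_1)

lemma cut_green_eq_0:
  assumes "R > 0" "i \<le> d" "\<bar>of_int (c i)\<bar> \<ge> 2 * R"
  shows "cut_green d \<kappa> R c = 0"
proof -
  have "(\<Prod>i\<le>d. cutoff R (c i)) = 0"
    using assms cutoff_eq_0[of R "c i"] by (intro prod_zero) auto
  then show ?thesis by (simp add: cut_green_def)
qed

text \<open>The uncut kernel is superharmonic, so a defect arises only where some cut-off factor
  varies, at distance of order at least \<open>R\<close> from the origin. It is charged on the whole
  slab of vertical distance at most \<open>2 * R\<close>, because later only the vertical occupation
  of the walk is under control.\<close>

lemma cut_green_almost_superharmonic:
  fixes d :: nat
  assumes d: "d \<ge> 2"
  obtains \<kappa> C where "\<kappa> \<ge> 64" "C > 0"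
    "\<And>(R::nat) c. R \<ge> 2 \<Longrightarrow>
       (\<Sum>i\<le>d. cut_green d \<kappa> R (c(i := c i + 1)) + cut_green d \<kappa> R (c(i := c i - 1)))
       \<le> 2 * real (d+1) * cut_green d \<kappa> R c + (if \<bar>c d\<bar> \<le> 2 * int R then C / real R ^ (d+1) else 0)"
proof -
  define \<alpha> where "\<alpha> = (real d - 1) / 2"
  have \<alpha>: "\<alpha> > 0" using d by (simp add: \<alpha>_def)
  have \<alpha>2: "2 * \<alpha> = real (d - 1)" using d by (simp add: \<alpha>_def of_nat_diff)
  have \<alpha>3: "2 * (\<alpha> + 1) = real (d + 1)" by (simp add: \<alpha>_def field_simps)
  obtain \<kappa> where k: "\<kappa> \<ge> 64" and S:
    "\<And>c :: nat \<Rightarrow> real. (\<Sum>i\<le>d. (\<kappa> + (\<Sum>j\<le>d. (c j)^2) + 1 + 2 * c i) powr (-\<alpha>) + (\<kappa> + (\<Sum>j\<le>d. (c j)^2) + 1 - 2 * c i) powr (-\<alpha>))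
       \<le> 2 * real (d+1) * (\<kappa> + (\<Sum>j\<le>d. (c j)^2)) powr (-\<alpha>)"
    by (rule powr_sum_squares_superharmonic[OF d, folded \<alpha>_def]) (rule that)
  define C0 where "C0 = 8 * 2^d + 8 * \<alpha> * 32 * 2^d"
  define C where "C = real (d+1) * C0"
  have C0: "C0 > 0" using \<alpha> by (simp add: C0_def add_pos_pos)
  then have C: "C > 0" by (simp add: C_def)
  have "(\<Sum>i\<le>d. cut_green d \<kappa> R (c(i := c i + 1)) + cut_green d \<kappa> R (c(i := c i - 1)))
       \<le> 2 * real (d+1) * cut_green d \<kappa> R c + (if \<bar>c d\<bar> \<le> 2 * int R then C / real R ^ (d+1) else 0)"
    if R: "R \<ge> 2" for R :: nat and c
  proof (cases "\<bar>c d\<bar> \<le> 2 * int R")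
    case False
    have "cut_green d \<kappa> R (c(i := c i + e)) = 0" if "\<bar>e\<bar> \<le> 1" for e i
    proof (rule cut_green_eq_0)
      have "\<bar>(c(i := c i + e)) d\<bar> \<ge> 2 * int R" using that False by auto
      then show "\<bar>real_of_int ((c(i := c i + e)) d)\<bar> \<ge> 2 * real R" by linarith
    qed (use R in auto)
    from this[of 1] this[of "-1"] this[of 0] show ?thesis using False by simp
  next
    case True
    define \<rho> where "\<rho> = \<kappa> + (\<Sum>i\<le>d. (of_int (c i))^2 :: real)"
    define P where "P i = (\<Prod>j\<in>{..d}-{i}. cutoff R (c j))" for i
    define fp where "fp i = (\<rho> + 1 + 2 * of_int (c i)) powr (-\<alpha>)" for i
    define fm where "fm i = (\<rho> + 1 - 2 * of_int (c i)) powr (-\<alpha>)" for i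
    define X where "X = (\<Prod>i\<le>d. cutoff R (c i))"
    have P: "0 \<le> P i" "P i \<le> 1" for i
      using R unfolding P_def by (auto intro!: prod_nonneg prod_le_1 simp: cutoff_bounds)
    have X0: "0 \<le> X"
      using R unfolding X_def by (auto intro!: prod_nonneg simp: cutoff_bounds)
    have XP: "X = cutoff R (c i) * P i" if "i \<le> d" for i
      unfolding X_def P_def using that by (intro prod.remove) auto
    have alm: "- (real d - 1) / 2 = - \<alpha>" by (simp only: \<alpha>_def minus_divide_left)
    have gp: "cut_green d \<kappa> R (c(i := c i + e)) = (\<rho> + e^2 + 2 * e * of_int (c i)) powr (-\<alpha>) * (cutoff R (c i + e) * P i)"
      if "i \<le> d" for i e
    proof -
      have "(\<Prod>j\<le>d. cutoff R ((c(i := c i + e)) j)) = cutoff R (c i + e) * P i"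
        unfolding P_def using that by (subst prod.remove[of _ i]) (auto intro!: arg_cong2[where f="(*)"] prod.cong)
      moreover have "(\<Sum>j\<le>d. (of_int ((c(i := c i + e)) j))^2 :: real) = (of_int (c i + e))^2 + (\<Sum>j\<in>{..d}-{i}. (of_int (c j))^2)"
        using that by (subst sum.remove[of _ i]) (auto intro!: sum.cong)
      moreover have "(\<Sum>j\<le>d. (of_int (c j))^2 :: real) = (of_int (c i))^2 + (\<Sum>j\<in>{..d}-{i}. (of_int (c j))^2)"
        using that by (subst sum.remove[of _ i]) auto
      ultimately have g: "cut_green d \<kappa> R (c(i := c i + e)) =
          (\<kappa> + ((of_int (c i + e))^2 + (\<Sum>j\<in>{..d}-{i}. (of_int (c j))^2))) powr (-\<alpha>) * (cutoff R (c i + e) * P i)"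
        and r: "\<rho> = \<kappa> + ((of_int (c i))^2 + (\<Sum>j\<in>{..d}-{i}. (of_int (c j))^2))"
        unfolding cut_green_def \<rho>_def alm by (simp_all only:)
      have "\<kappa> + ((of_int (c i + e))^2 + (\<Sum>j\<in>{..d}-{i}. (of_int (c j))^2)) = \<rho> + e^2 + 2 * e * of_int (c i)"
        unfolding r by (simp add: power2_eq_square algebra_simps)
      then show ?thesis using g by (simp only:)
    qed
    have E: "fp i * cutoff R (c i + 1) + fm i * cutoff R (c i - 1) \<le> cutoff R (c i) * (fp i + fm i) + C0 / real R ^ (d+1)"
      if i: "i \<le> d" for i
    proof -
      let ?x = "real_of_int (c i)"
      \<comment> \<open>Discrete Leibniz rule: kernel times second difference of the cut-off, plus a
        product of two first differences. The orders are \<open>R^(-(d-1)) * R^(-2)\<close> and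
        \<open>R^(-d) * R^(-1)\<close>, the same power in total.\<close>
      have eq: "fp i * cutoff R (c i + 1) + fm i * cutoff R (c i - 1) = cutoff R (c i) * (fp i + fm i)
         + (fp i * (cutoff R (c i + 1) + cutoff R (c i - 1) - 2 * cutoff R (c i))
          + (fm i - fp i) * (cutoff R (c i - 1) - cutoff R (c i)))"
        by (simp add: algebra_simps)
      show ?thesis
      proof (cases "\<bar>c i\<bar> < int R")
        case True
        then have "\<bar>c i\<bar> \<le> int R" "\<bar>c i + 1\<bar> \<le> int R" "\<bar>c i - 1\<bar> \<le> int R" by auto
        then have "\<bar>real_of_int (c i)\<bar> \<le> real R" "\<bar>real_of_int (c i + 1)\<bar> \<le> real R" "\<bar>real_of_int (c i - 1)\<bar> \<le> real R"
          by linarith+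
        then have "cutoff R (c i) = 1" "cutoff R (c i + 1) = 1" "cutoff R (c i - 1) = 1"
          using R by (auto intro!: cutoff_eq_1 simp del: of_int_add of_int_diff)
        then show ?thesis unfolding eq using C0 by simp
      next
        case False
        define y where "y = \<bar>?x\<bar>"
        \<comment> \<open>From \<open>y \<ge> 2\<close> follows
          \<open>(y - 1)^2 \<ge> (y/2)^2\<close>: a unit step towards the origin at most halves the
          distance, and the kernel keeps its order.\<close>
        have y: "y \<ge> R" "y \<ge> 2" using False R by (auto simp: y_def)
        define m where "m = \<rho> + 1 - 2 * y"
        define m' where "m' = \<rho> + 1 + 2 * y"
        have "?x^2 \<le> (\<Sum>i\<le>d. (of_int (c i))^2)"
          using i by (intro member_le_sum) auto
        then have "m \<ge> y^2 + 1 - 2 * y" using k by (simp add: m_def \<rho>_def y_def)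
        moreover have "y^2 + 1 - 2 * y \<ge> (y/2)^2"
        proof -
          have "(y/2)^2 \<le> (y-1)^2" using y by (intro power_mono) auto
          then show ?thesis by (simp add: power2_eq_square algebra_simps)
        qed
        ultimately have m: "m \<ge> (y/2)^2" by linarith
        have mpos: "m > 0" using m y by (intro less_le_trans[OF _ m]) auto
        have sq: "((z/2)^2) powr (-b) = (2/z) powr (2*b)" if "z > 0" for z b :: real
        proof -
          have "(z/2)^2 = (z/2) powr 2" using that by simp
          then have "((z/2)^2) powr (-b) = (z/2) powr (-(2*b))"
            by (simp only: powr_powr) simp
          also have "\<dots> = (2/z) powr (2*b)" using that by (simp add: powr_minus_divide powr_divide)
          finally show ?thesis .
        qed
        have f1: "{fp i, fm i} = {m powr (-\<alpha>), m' powr (-\<alpha>)}"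
          by (auto simp: fp_def fm_def m_def m'_def y_def abs_if)
        have mm: "m \<le> m'" using y by (simp add: m_def m'_def)
        have le: "m' powr (-\<alpha>) \<le> m powr (-\<alpha>)" using mm mpos \<alpha> by (intro powr_mono2') auto
        have "m powr (-\<alpha>) \<le> ((real R/2)^2) powr (-\<alpha>)"
        proof (rule powr_mono2')
          have "(real R/2)^2 \<le> (y/2)^2" using y by (intro power_mono) auto
          then show "(real R/2)^2 \<le> m" using m by linarith
        qed (use \<alpha> R in auto)
        also have "\<dots> = (2/R) powr (real (d - 1))" using R \<alpha>2 by (subst sq) auto
        also have "\<dots> = (2/R)^(d-1)" using R by (simp add: powr_realpow)
        finally have b1: "m powr (-\<alpha>) \<le> (2/R)^(d-1)" .
        have "m powr (-\<alpha>-1) \<le> ((y/2)^2) powr (-\<alpha>-1)"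
          using m \<alpha> y by (intro powr_mono2') auto
        also have "((y/2)^2) powr (-\<alpha>-1) = (2/y) powr (real (d+1))"
          using sq[of y "\<alpha>+1", unfolded \<alpha>3] y by simp
        also have "\<dots> = (2/y)^(d+1)" using y by (intro powr_realpow) auto
        finally have p1: "m powr (-\<alpha>-1) \<le> (2/y)^(d+1)" .
        have "m powr (-\<alpha>) - m' powr (-\<alpha>) \<le> \<alpha> * m powr (-\<alpha>-1) * (m' - m)"
          using mm mpos \<alpha> by (intro powr_minus_difference_le) auto
        also have "\<dots> \<le> \<alpha> * (2/y)^(d+1) * (m' - m)"
          using p1 \<alpha> mm by (intro mult_right_mono mult_left_mono) auto
        also have "\<dots> = \<alpha> * (2/y)^(d+1) * (4*y)" by (simp add: m_def m'_def)
        also have "\<dots> = 8 * \<alpha> * (2/y)^d" using y by (simp add: field_simps)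
        also have "\<dots> \<le> 8 * \<alpha> * (2/R)^d" using y R \<alpha> by (intro mult_left_mono power_mono divide_left_mono) auto
        finally have b2: "m powr (-\<alpha>) - m' powr (-\<alpha>) \<le> 8 * \<alpha> * (2/R)^d" .
        have fp: "0 \<le> fp i" "fp i \<le> (2/R)^(d-1)" using f1 le b1 by (auto simp: fp_def doubleton_eq_iff)
        have fd: "\<bar>fm i - fp i\<bar> \<le> 8 * \<alpha> * (2/R)^d"
          using f1 le b2 by (auto simp: doubleton_eq_iff)
        have "fp i * (cutoff R (c i + 1) + cutoff R (c i - 1) - 2 * cutoff R (c i))
            \<le> (2/R)^(d-1) * (8/R^2)"
        proof -
          have "fp i * (cutoff R (c i + 1) + cutoff R (c i - 1) - 2 * cutoff R (c i)) \<le> fp i * (8/R^2)"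
            using cutoff_second_difference[of R "c i"] R fp by (intro mult_left_mono) auto
          also have "\<dots> \<le> (2/R)^(d-1) * (8/R^2)" using fp by (intro mult_right_mono) auto
          finally show ?thesis .
        qed
        moreover have "(fm i - fp i) * (cutoff R (c i - 1) - cutoff R (c i)) \<le> 8 * \<alpha> * (2/R)^d * (32/R)"
        proof -
          have "(fm i - fp i) * (cutoff R (c i - 1) - cutoff R (c i)) \<le> \<bar>fm i - fp i\<bar> * \<bar>cutoff R (c i - 1) - cutoff R (c i)\<bar>"
            by (metis abs_ge_self abs_mult)
          also have "\<dots> \<le> 8 * \<alpha> * (2/R)^d * (32/R)"
            using fd cutoff_difference[of R "c i"] R \<alpha> by (intro mult_mono) auto
          finally show ?thesis .
        qed
        moreover have "(2/R)^(d-1) * (8/R^2) + 8 * \<alpha> * (2/R)^d * (32/R) \<le> C0 / real R ^ (d+1)"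
        proof -
          obtain k where k: "d = Suc k" using d by (cases d) auto
          have "(2/R)^(d-1) * (8/R^2) = 8 * 2^k / real R ^ (d+1)"
            using R by (simp add: k power_divide power2_eq_square mult_ac)
          also have "\<dots> \<le> 8 * 2^d / real R ^ (d+1)" by (intro divide_right_mono) (auto simp: k)
          finally show ?thesis using R by (simp add: C0_def power_divide add_divide_distrib mult_ac)
        qed
        ultimately show ?thesis unfolding eq by linarith
      qed
    qed
    have "(\<Sum>i\<le>d. cut_green d \<kappa> R (c(i := c i + 1)) + cut_green d \<kappa> R (c(i := c i - 1)))
       \<le> (\<Sum>i\<le>d. X * (fp i + fm i) + C0 / real R ^ (d+1))"
    proof (rule sum_mono)
      fix i assume "i \<in> {..d}"
      then have i: "i \<le> d" by simp
      have "cut_green d \<kappa> R (c(i := c i + 1)) + cut_green d \<kappa> R (c(i := c i - 1))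
         = P i * (fp i * cutoff R (c i + 1) + fm i * cutoff R (c i - 1))"
        using gp[OF i, of 1] gp[OF i, of "-1"] by (simp add: fp_def fm_def algebra_simps)
      also have "\<dots> \<le> P i * (cutoff R (c i) * (fp i + fm i) + C0 / real R ^ (d+1))"
        using P by (intro mult_left_mono E i) auto
      also have "\<dots> = X * (fp i + fm i) + P i * (C0 / real R ^ (d+1))"
        by (simp add: XP[OF i] algebra_simps)
      also have "\<dots> \<le> X * (fp i + fm i) + C0 / real R ^ (d+1)"
        using P[of i] C0 by (intro add_left_mono mult_left_le_one_le) auto
      finally show "cut_green d \<kappa> R (c(i := c i + 1)) + cut_green d \<kappa> R (c(i := c i - 1)) \<le> X * (fp i + fm i) + C0 / real R ^ (d+1)" .
    qed
    also have "\<dots> = X * (\<Sum>i\<le>d. fp i + fm i) + C / real R ^ (d+1)"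
      by (simp add: C_def sum_distrib_left sum.distrib algebra_simps)
    also have "\<dots> \<le> X * (2 * real (d+1) * \<rho> powr (-\<alpha>)) + C / real R ^ (d+1)"
      using S[of "\<lambda>i. of_int (c i)"] X0 unfolding fp_def fm_def \<rho>_def
      by (intro add_right_mono mult_left_mono) auto
    also have "\<dots> = 2 * real (d+1) * cut_green d \<kappa> R c + C / real R ^ (d+1)"
      unfolding cut_green_def alm by (simp add: X_def \<rho>_def)
    finally show ?thesis using True by simp
  qed
  with k C show ?thesis by (rule that)
qed

section \<open>Blocking paths in a planar strip\<close>

definition sdist :: "int \<times> int \<Rightarrow> int \<times> int \<Rightarrow> int" where
  "sdist p q = max \<bar>fst p - fst q\<bar> \<bar>snd p - snd q\<bar>"

lemma sdist_self [simp]: "sdist p p = 0"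
  and sdist_commute: "sdist p q = sdist q p"
  and sdist_triangle: "sdist p r \<le> sdist p q + sdist q r"
  by (auto simp: sdist_def)

definition strip_step :: "nat \<Rightarrow> (int \<times> int \<Rightarrow> bool) \<Rightarrow> int \<times> int \<Rightarrow> int \<times> int \<Rightarrow> bool" where
  "strip_step m bad p q \<longleftrightarrow> 0 \<le> fst p \<and> fst p \<le> int m \<and> 0 \<le> fst q \<and> fst q \<le> int m \<and> \<not> bad p \<and> \<not> bad q \<and>
     \<bar>fst p - fst q\<bar> + \<bar>snd p - snd q\<bar> = 1"

definition star_step :: "(int \<times> int \<Rightarrow> bool) \<Rightarrow> int \<times> int \<Rightarrow> int \<times> int \<Rightarrow> bool" where
  "star_step bad p q \<longleftrightarrow> bad p \<and> bad q \<and> sdist p q \<le> 1"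

text \<open>Duality in a strip. The edge function \<open>f\<close> below is the part of the discrete gradient of the
  indicator of the reachable set that is carried by the blocking vertices star-connected to the
  left side. It is closed because blocking vertices of a common face are star-adjacent; its sum
  along the left side is \<open>-1\<close> and along the right side \<open>0\<close>.\<close>

lemma strip_crossing_or_blocked:
  fixes bad :: "int \<times> int \<Rightarrow> bool" and J :: int
  assumes J: "J > 0" and bad: "\<And>v. bad v \<Longrightarrow> \<bar>snd v\<bar> < J"
  shows "(strip_step m bad)\<^sup>*\<^sup>* (0, - J) (0, J) \<or>
     (\<exists>j j'. bad (0, j) \<and> (star_step bad)\<^sup>*\<^sup>* (0, j) (int m, j'))"
proof (rule ccontr)
  assume neg: "\<not> ?thesis"
  define A where "A = {v. (strip_step m bad)\<^sup>*\<^sup>* (0, - J) v}"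
  define Lf where "Lf = {v. \<exists>j. bad (0, j) \<and> (star_step bad)\<^sup>*\<^sup>* (0, j) v}"
  define al :: "int \<times> int \<Rightarrow> int" where "al v = (if v \<in> A then 1 else 0)" for v
  define la :: "int \<times> int \<Rightarrow> int" where "la v = (if v \<in> Lf then 1 else 0)" for v
  define f where "f u v = al v * la u - al u * la v" for u v
  have A_good: "\<not> bad v" if "v \<in> A" for v
  proof -
    have "(strip_step m bad)\<^sup>*\<^sup>* (0, - J) v" using that by (simp add: A_def)
    then show ?thesis
    proof (induction rule: rtranclp_induct)
      case base
      show ?case using bad[of "(0, - J)"] J by auto
    qed (auto simp: strip_step_def)
  qed
  have A_next: "v \<in> A \<or> bad v"
    if "u \<in> A" "0 \<le> fst u" "fst u \<le> int m" "0 \<le> fst v" "fst v \<le> int m" "\<bar>fst u - fst v\<bar> + \<bar>snd u - snd v\<bar> = 1" for u v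
  proof (rule disjCI)
    assume "\<not> bad v"
    then have "strip_step m bad u v" using that A_good by (auto simp: strip_step_def)
    then show "v \<in> A" using that(1) by (auto simp: A_def)
  qed
  have Lf_bad: "bad v" if "v \<in> Lf" for v
  proof -
    obtain j where j: "bad (0, j)" "(star_step bad)\<^sup>*\<^sup>* (0, j) v" using \<open>v \<in> Lf\<close> by (auto simp: Lf_def)
    from j(2,1) show ?thesis by (induction rule: rtranclp_induct) (auto simp: star_step_def)
  qed
  have Lf_next: "v \<in> Lf" if "u \<in> Lf" "bad v" "sdist u v \<le> 1" for u v
  proof -
    have "star_step bad u v" using that Lf_bad by (auto simp: star_step_def)
    then show ?thesis using that(1) by (auto simp: Lf_def intro: rtranclp.rtrancl_into_rtrancl)
  qed
  have disj: "v \<notin> Lf" if "v \<in> A" for v using that A_good Lf_bad by blast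
  have top: "(0, J) \<notin> A" and bot: "(0, - J) \<in> A" using neg by (auto simp: A_def)
  have right: "(int m, j) \<notin> Lf" for j using neg by (auto simp: Lf_def)
  have face: "f (i+1, j) (i+1, j+1) - f (i, j) (i, j+1) = f (i, j+1) (i+1, j+1) - f (i, j) (i+1, j)"
    if i: "0 \<le> i" "i < int m" for i j
  proof -
    let ?a = "(i, j)" and ?b = "(i+1, j)" and ?c = "(i+1, j+1)" and ?e = "(i, j+1)"
    have nn: "u \<in> A \<Longrightarrow> v \<in> A \<or> bad v"
      if "(u, v) \<in> {(?a,?b),(?b,?a),(?b,?c),(?c,?b),(?c,?e),(?e,?c),(?a,?e),(?e,?a)}" for u v
      using that i by (intro A_next[of u v]) auto
    have st: "u \<in> Lf \<Longrightarrow> bad v \<Longrightarrow> v \<in> Lf" if "u \<in> {?a,?b,?c,?e}" "v \<in> {?a,?b,?c,?e}" for u v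
      using that by (intro Lf_next[of u v]) (auto simp: sdist_def)
    have "al ?c * la ?b - al ?b * la ?c - (al ?e * la ?a - al ?a * la ?e) =
      al ?c * la ?e - al ?e * la ?c - (al ?b * la ?a - al ?a * la ?b)"
    proof -
      define Sq where "Sq = {?a,?b,?c,?e}"
      show ?thesis
      \<comment> \<open>Once one corner belongs to \<open>Lf\<close>, all blocked corners do. Every
        edge leaving \<open>A\<close> ends in a blocked vertex, so \<open>f\<close> equals the
        gradient of \<open>al\<close> on the four edges and sums to zero round the face. Otherwise
        all terms vanish.\<close>
      proof (cases "\<exists>u\<in>Sq. u \<in> Lf")
        case False
        then have "la ?a = 0" "la ?b = 0" "la ?c = 0" "la ?e = 0" by (auto simp: la_def Sq_def)
        then show ?thesis by simp
      next
        case True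
        then have all: "v \<in> Lf \<longleftrightarrow> bad v" if "v \<in> Sq" for v
          using st that Lf_bad unfolding Sq_def by blast
        have lab: "la v = (if bad v then 1 else 0)" if "v \<in> Sq" for v
          using all[OF that] by (simp add: la_def)
        have e: "al v * la u - al u * la v = al v - al u" if "u \<in> Sq" "v \<in> Sq"
           "u \<in> A \<Longrightarrow> v \<in> A \<or> bad v" "v \<in> A \<Longrightarrow> u \<in> A \<or> bad u" for u v
          using that A_good by (auto simp: al_def lab)
        have "al ?c * la ?b - al ?b * la ?c = al ?c - al ?b" "al ?e * la ?a - al ?a * la ?e = al ?e - al ?a"
          "al ?c * la ?e - al ?e * la ?c = al ?c - al ?e" "al ?b * la ?a - al ?a * la ?b = al ?b - al ?a"
          by (rule e; (simp add: Sq_def)?; rule nn; simp)+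
        then show ?thesis by simp
      qed
    qed
    then show ?thesis by (simp add: f_def)
  qed
  define sg where "sg i = (\<Sum>j\<in>{-J..<J}. f (i, j) (i, j+1))" for i
  have tele: "(\<Sum>j\<in>{-J..<J}. h (j+1) - h j) = h J - h (-J)" for h :: "int \<Rightarrow> int"
  proof -
    have "(\<Sum>j\<in>{-J..<-J + int n}. h (j+1) - h j) = h (-J + int n) - h (-J)" for n
    proof (induction n)
      case (Suc n)
      have "{-J..<-J + int (Suc n)} = insert (-J + int n) {-J..<-J + int n}" by auto
      with Suc show ?case by (simp add: algebra_simps)
    qed simp
    from this[of "nat (2 * J)"] show ?thesis using J by simp
  qed
  have f0: "f u v = 0" if "\<bar>snd u\<bar> = J" "\<bar>snd v\<bar> = J" for u v
  proof -
    have "u \<notin> Lf" "v \<notin> Lf" using that Lf_bad bad by (metis less_irrefl)+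
    then show ?thesis by (simp add: f_def la_def)
  qed
  have step: "sg (i+1) = sg i" if "0 \<le> i" "i < int m" for i
  proof -
    have "sg (i+1) - sg i = (\<Sum>j\<in>{-J..<J}. f (i, j+1) (i+1, j+1) - f (i, j) (i+1, j))"
      unfolding sg_def sum_subtractf[symmetric] by (intro sum.cong refl face that)
    also have "\<dots> = f (i, J) (i+1, J) - f (i, -J) (i+1, -J)"
      using tele[of "\<lambda>j. f (i, j) (i+1, j)"] by simp
    also have "\<dots> = 0" using J by (simp add: f0)
    finally show ?thesis by simp
  qed
  have "sg (int k) = sg 0" if "k \<le> m" for k
    using that
  proof (induction k)
    case (Suc k)
    have "sg (int (Suc k)) = sg (int k)" using step[of "int k"] Suc.prems by (simp add: add.commute)
    then show ?case using Suc by simp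
  qed simp
  then have eq: "sg (int m) = sg 0" by simp
  have "sg (int m) = 0" by (simp add: sg_def f_def la_def right)
  moreover have "sg 0 = -1"
  proof -
    \<comment> \<open>On the left side every blocked vertex is in \<open>Lf\<close>, so
      \<open>f\<close> is the full gradient of \<open>al\<close> there; it telescopes from 1 at the
      bottom to 0 at the top.\<close>
    have "sg 0 = (\<Sum>j\<in>{-J..<J}. al (0, j+1) - al (0, j))"
      unfolding sg_def
    proof (rule sum.cong[OF refl])
      fix j :: int
      have l0: "la (0, k) = (if bad (0, k) then 1 else 0)" for k
        using Lf_bad by (auto simp: la_def Lf_def)
      have "(0, j) \<in> A \<Longrightarrow> (0, j+1) \<in> A \<or> bad (0, j+1)" "(0, j+1) \<in> A \<Longrightarrow> (0, j) \<in> A \<or> bad (0, j)"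
        using A_next[of "(0, j)" "(0, j+1)"] A_next[of "(0, j+1)" "(0, j)"] by auto
      then show "f (0, j) (0, j+1) = al (0, j+1) - al (0, j)"
        using A_good by (auto simp: f_def al_def l0)
    qed
    also have "\<dots> = -1" using tele[of "\<lambda>j. al (0, j)"] top bot by (simp add: al_def)
    finally show ?thesis .
  qed
  ultimately show False using eq by simp
qed

section \<open>Binary trees with well-separated leaves in star-connected sets\<close>

lemma rtranclp_star_step_bad:
  "(star_step bad)\<^sup>*\<^sup>* x y \<Longrightarrow> bad x \<Longrightarrow> bad y"
  by (induction rule: rtranclp_induct) (auto simp: star_step_def)

text \<open>A discrete intermediate value theorem: along a star-path the distance from
  \<open>x\<close> grows by at most 1 per step.\<close>

lemma star_path_at_distance:
  assumes "(star_step bad)\<^sup>*\<^sup>* x w" "0 \<le> k" "k \<le> sdist x w"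
  obtains y where "(star_step bad)\<^sup>*\<^sup>* x y" "(star_step bad)\<^sup>*\<^sup>* y w" "sdist x y = k"
proof -
  from assms have "\<exists>y. (star_step bad)\<^sup>*\<^sup>* x y \<and> (star_step bad)\<^sup>*\<^sup>* y w \<and> sdist x y = k"
  proof (induction rule: rtranclp_induct)
    case base
    then have "sdist x x = k" by simp
    then show ?case by blast
  next
    case (step w w')
    show ?case
    proof (cases "k \<le> sdist x w")
      case True
      then show ?thesis using step by (meson rtranclp.rtrancl_into_rtrancl)
    next
      case False
      have "sdist x w' \<le> sdist x w + 1"
        using sdist_triangle[of x w' w] step.hyps(2) by (auto simp: star_step_def)
      then have "sdist x w' = k" using False step.prems by simp
      moreover have "(star_step bad)\<^sup>*\<^sup>* x w'"
        using step.hyps(1,2) by (rule rtranclp.rtrancl_into_rtrancl)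
      ultimately show ?thesis by blast
    qed
  qed
  then show ?thesis using that by blast
qed

text \<open>Every star-connected set of large diameter contains the leaves of one of few trees
  (\<open>card_trees_le\<close>), and the leaves are so spread out that the sum of the inverse
  distances from one leaf to all others is bounded.\<close>

fun trees :: "nat \<Rightarrow> int \<times> int \<Rightarrow> (int \<times> int) set set" where
  "trees 0 x = {{x}}"
| "trees (Suc n) x = (\<lambda>(y, S, S'). S \<union> S') ` (SIGMA y:{y. sdist x y = 3 * 4^n}. trees n x \<times> trees n y)"

text \<open>A star-path from \<open>x\<close> to distance \<open>4 * 4^n\<close> visits some
  \<open>y\<close> at distance \<open>3 * 4^n\<close>. By the triangle inequality its continuation
  from \<open>y\<close> still has to cover \<open>4^n\<close>, so both \<open>x\<close> and
  \<open>y\<close> are roots of blocked trees of order \<open>n\<close>, with the same target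
  \<open>w\<close>.\<close>

lemma bad_tree_of_star_path:
  assumes "bad x" "(star_step bad)\<^sup>*\<^sup>* x w" "sdist x w \<ge> 4^n"
  shows "\<exists>S\<in>trees n x. \<forall>s\<in>S. bad s"
  using assms
proof (induction n arbitrary: x)
  case (Suc n)
  have pw: "(4::int)^n \<ge> 0" "sdist x w \<ge> 4 * 4^n" using Suc.prems by simp_all
  then have "sdist x w \<ge> 3 * 4^n" by linarith
  then obtain y where y: "(star_step bad)\<^sup>*\<^sup>* x y" "(star_step bad)\<^sup>*\<^sup>* y w" "sdist x y = 3 * 4^n"
    using star_path_at_distance[OF Suc.prems(2), of "3 * 4^n"] by auto
  have "sdist y w \<ge> 4^n" using sdist_triangle[of x w y] y(3) pw by linarith
  moreover have "bad y" using y Suc.prems rtranclp_star_step_bad by blast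
  ultimately obtain S' where S': "S' \<in> trees n y" "\<forall>s\<in>S'. bad s" using Suc.IH[of y] y by blast
  have "4^n \<le> sdist x w" using pw by linarith
  then obtain S where S: "S \<in> trees n x" "\<forall>s\<in>S. bad s" using Suc.IH[OF Suc.prems(1,2)] by blast
  have "S \<union> S' \<in> trees (Suc n) x"
    unfolding trees.simps using S S' y by (intro image_eqI[of _ _ "(y, S, S')"]) auto
  then show ?case using S S' by blast
qed auto

lemma sphere_subset:
  "{y. sdist (a, b) y = r} \<subseteq> ({a - r, a + r} \<times> {b - r..b + r}) \<union> ({a - r..a + r} \<times> {b - r, b + r})"
  by (auto simp: sdist_def max_def split: if_splits)

lemma finite_sphere: "finite {y. sdist x y = r}"
proof -
  obtain a b where x: "x = (a, b)" by (cases x)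
  show ?thesis unfolding x by (rule finite_subset[OF sphere_subset]) simp
qed

lemma card_sphere_le:
  assumes "r > 0"
  shows "card {y. sdist x y = int r} \<le> 4 * (2 * r + 1)"
proof -
  obtain a b where x: "x = (a, b)" by (cases x)
  let ?r = "int r"
  have "card {y. sdist x y = ?r} \<le> card (({a - ?r, a + ?r} \<times> {b - ?r..b + ?r}) \<union> ({a - ?r..a + ?r} \<times> {b - ?r, b + ?r}))"
    unfolding x by (intro card_mono sphere_subset) auto
  also have "\<dots> \<le> card ({a - ?r, a + ?r} \<times> {b - ?r..b + ?r}) + card ({a - ?r..a + ?r} \<times> {b - ?r, b + ?r})"
    by (rule card_Un_le)
  also have "\<dots> = 4 * (2 * r + 1)"
    using assms by (simp add: card_cartesian_product)
  finally show ?thesis .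
qed

lemma finite_trees: "finite (trees n x)"
  by (induction n arbitrary: x) (auto intro!: finite_imageI finite_SigmaI finite_sphere)

text \<open>The sphere of radius \<open>3 * 4^n\<close> has at most \<open>28 * 4^n\<close> points.
  Since \<open>28 * 4^n * (112 * 4^(n+1)) = (112 * 4^n)^2\<close>, the weight
  \<open>112 * 4^n\<close> turns the recursion into plain squaring, starting from 112 at
  \<open>n = 0\<close>.\<close>

lemma card_trees_le: "card (trees n x) * (112 * 4^n) \<le> 112 ^ (2^n)"
proof (induction n arbitrary: x)
  case (Suc n)
  define K :: nat where "K = 112 ^ (2^n)"
  have IH: "card (trees n y) * (112 * 4^n) \<le> K" for y using Suc by (simp add: K_def)
  let ?Sp = "{y. sdist x y = 3 * 4^n}"
  have "card (trees (Suc n) x) \<le> card (SIGMA y:?Sp. trees n x \<times> trees n y)"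
    unfolding trees.simps by (intro card_image_le finite_SigmaI finite_cartesian_product finite_trees finite_sphere)
  also have "\<dots> = (\<Sum>y\<in>?Sp. card (trees n x) * card (trees n y))"
    by (subst card_SigmaI) (auto simp: finite_sphere finite_trees card_cartesian_product)
  finally have c: "card (trees (Suc n) x) \<le> (\<Sum>y\<in>?Sp. card (trees n x) * card (trees n y))" .
  define M :: nat where "M = 112 * 4^n"
  have "card (trees (Suc n) x) * (M * M) \<le> (\<Sum>y\<in>?Sp. card (trees n x) * card (trees n y)) * (M * M)"
    using c by (rule mult_le_mono1)
  also have "\<dots> = (\<Sum>y\<in>?Sp. (card (trees n x) * M) * (card (trees n y) * M))"
    unfolding sum_distrib_right by (intro sum.cong refl) (simp only: mult_ac)
  also have "\<dots> \<le> (\<Sum>y\<in>?Sp. K * K)"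
    unfolding M_def by (intro sum_mono mult_le_mono IH)
  also have "\<dots> = card ?Sp * K^2" by (simp add: power2_eq_square)
  also have "card ?Sp \<le> 28 * 4^n"
  proof -
    have "card {y. sdist x y = int (3 * 4^n)} \<le> 4 * (2 * (3 * 4^n) + 1)" by (rule card_sphere_le) simp
    also have "\<dots> \<le> 28 * 4^n" by simp
    finally show ?thesis by simp
  qed
  finally have "card (trees (Suc n) x) * (M * M) \<le> (28 * 4^n) * K^2" by simp
  moreover have "M * M = (28 * 4^n) * (112 * 4^Suc n)" by (simp add: M_def)
  ultimately have "(28 * 4^n) * (card (trees (Suc n) x) * (112 * 4^Suc n)) \<le> (28 * 4^n) * K^2"
    by (simp only: mult_ac)
  then have "card (trees (Suc n) x) * (112 * 4^Suc n) \<le> K^2"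
    by (rule mult_left_le_imp_le) simp
  also have "K^2 = 112 ^ (2^Suc n)" by (simp add: K_def power_mult[symmetric] mult.commute)
  finally show ?case .
qed simp

text \<open>The two halves are at least \<open>3 * 4^n - 2 * (4^n - 1) = 4^n + 2\<close> apart. So a
  generation adds \<open>2^n\<close> leaves with inverse distance at most \<open>4^(-n)\<close>,
  that is at most \<open>2^(-n)\<close>, to the sum seen from a leaf, and these add up to
  \<open>2 - 2 / 2^n\<close>. One is subtracted from the distance to account for the extent of the
  frames.\<close>

lemma trees_properties:
  assumes "S \<in> trees n x"
  shows "finite S" "card S = 2^n" "\<And>s. s \<in> S \<Longrightarrow> sdist x s \<le> 4^n - 1"
    "\<And>s t. s \<in> S \<Longrightarrow> t \<in> S \<Longrightarrow> s \<noteq> t \<Longrightarrow> sdist s t \<ge> 2"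
    "\<And>s. s \<in> S \<Longrightarrow> (\<Sum>t\<in>S - {s}. 1 / (real_of_int (sdist s t) - 1)) \<le> 2 - 2 / 2^n"
proof -
  have "finite S \<and> card S = 2^n \<and> (\<forall>s\<in>S. sdist x s \<le> 4^n - 1) \<and> (\<forall>s\<in>S. \<forall>t\<in>S. s \<noteq> t \<longrightarrow> sdist s t \<ge> 2) \<and>
    (\<forall>s\<in>S. (\<Sum>t\<in>S - {s}. 1 / (real_of_int (sdist s t) - 1)) \<le> 2 - 2 / 2^n)"
    using assms
  proof (induction n arbitrary: x S)
    case (Suc n)
    from Suc.prems obtain y U V where S: "S = U \<union> V" and y: "sdist x y = 3 * 4^n" and U: "U \<in> trees n x" and V: "V \<in> trees n y"
      by auto
    note IU = Suc.IH[OF U] and IV = Suc.IH[OF V]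
    have sep: "sdist s t \<ge> 4^n + 2" if "s \<in> U" "t \<in> V" for s t
    proof -
      have "sdist x y \<le> sdist x s + sdist s t + sdist t y"
        using sdist_triangle[of x y s] sdist_triangle[of s y t] by linarith
      moreover have "sdist x s \<le> 4^n - 1" "sdist t y \<le> 4^n - 1" using IU IV that by (auto simp: sdist_commute)
      ultimately show ?thesis using y by linarith
    qed
    have p: "(4::int)^n \<ge> 0" by simp
    have "s \<notin> V" if "s \<in> U" for s
    proof
      assume "s \<in> V"
      then have "(4::int)^n + 2 \<le> 0" using sep[OF that, of s] by simp
      then show False using p by linarith
    qed
    then have disj: "U \<inter> V = {}" by blast
    have half: "(\<Sum>t\<in>(P \<union> Q) - {s}. 1 / (real_of_int (sdist s t) - 1)) \<le> 2 - 2 / 2^Suc n"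
      if "s \<in> P" "finite P" "finite Q" "card Q = 2^n" "P \<inter> Q = {}" "\<And>t. t \<in> Q \<Longrightarrow> sdist s t \<ge> 4^n + 2"
        "(\<Sum>t\<in>P - {s}. 1 / (real_of_int (sdist s t) - 1)) \<le> 2 - 2 / 2^n" for P Q s
    proof -
      have "(P \<union> Q) - {s} = (P - {s}) \<union> Q" using that by auto
      then have "(\<Sum>t\<in>(P \<union> Q) - {s}. 1 / (real_of_int (sdist s t) - 1)) =
         (\<Sum>t\<in>P - {s}. 1 / (real_of_int (sdist s t) - 1)) + (\<Sum>t\<in>Q. 1 / (real_of_int (sdist s t) - 1))"
        using that by (simp only:) (rule sum.union_disjoint, auto)
      moreover have "(\<Sum>t\<in>Q. 1 / (real_of_int (sdist s t) - 1)) \<le> real (card Q) * (1 / 4^n)"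
      proof (rule sum_bounded_above)
        fix t assume "t \<in> Q"
        then have "real_of_int (4^n + 2) \<le> real_of_int (sdist s t)" using that(6) by (simp only: of_int_le_iff)
        then have "real_of_int (sdist s t) - 1 \<ge> 4^n" by simp
        then show "1 / (real_of_int (sdist s t) - 1) \<le> 1 / 4^n" by (intro divide_left_mono) (auto intro!: mult_pos_pos intro: less_le_trans[of 0 "4^n"])
      qed
      moreover have "real (card Q) * (1 / 4^n) = 1 / 2^n"
      proof -
        have "(4::real)^n = 2^n * 2^n" by (simp add: power_mult_distrib[symmetric])
        then show ?thesis using that(4) by simp
      qed
      moreover have "2 - 2 / 2^Suc n = 2 - 2 / 2^n + 1 / (2::real)^n" by (simp add: field_simps)
      ultimately show ?thesis using that(7) by linarith
    qed
    have "finite S" using IU IV S by auto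
    moreover have "card S = 2^Suc n" unfolding S using IU IV disj by (subst card_Un_disjoint) auto
    moreover have "\<forall>s\<in>S. sdist x s \<le> 4^Suc n - 1"
    proof
      fix s assume "s \<in> S"
      then consider "s \<in> U" | "s \<in> V" using S by auto
      then show "sdist x s \<le> 4^Suc n - 1"
      proof cases
        case 1
        then have "sdist x s \<le> 4^n - 1" using IU by blast
        moreover have "(4::int)^n \<ge> 0" by simp
        ultimately show ?thesis unfolding power_Suc by linarith
      next
        case 2
        then have "sdist y s \<le> 4^n - 1" using IV by blast
        then show ?thesis using sdist_triangle[of x s y] y unfolding power_Suc by linarith
      qed
    qed
    moreover have "\<forall>s\<in>S. \<forall>t\<in>S. s \<noteq> t \<longrightarrow> sdist s t \<ge> 2"
    proof (intro ballI impI)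
      fix s t assume st: "s \<in> S" "t \<in> S" "s \<noteq> t"
      consider "s \<in> U" "t \<in> U" | "s \<in> V" "t \<in> V" | "s \<in> U" "t \<in> V" | "t \<in> U" "s \<in> V" using st S by blast
      then show "sdist s t \<ge> 2"
      proof cases
        case 3
        then show ?thesis using sep[of s t] p by linarith
      next
        case 4
        then show ?thesis using sep[of t s] p by (subst sdist_commute) linarith
      qed (use st IU IV in blast)+
    qed
    moreover have "\<forall>s\<in>S. (\<Sum>t\<in>S - {s}. 1 / (real_of_int (sdist s t) - 1)) \<le> 2 - 2 / 2^Suc n"
    proof
      fix s assume "s \<in> S"
      then consider "s \<in> U" | "s \<in> V" using S by auto
      then show "(\<Sum>t\<in>S - {s}. 1 / (real_of_int (sdist s t) - 1)) \<le> 2 - 2 / 2^Suc n"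
      proof cases
        case 1
        then show ?thesis unfolding S using IU IV disj sep by (intro half) auto
      next
        case 2
        have "S = V \<union> U" using S by auto
        then show ?thesis using 2 IU IV disj sep by (simp only:) (intro half, auto simp: sdist_commute)
      qed
    qed
    ultimately show ?case by blast
  qed simp
  then show "finite S" "card S = 2^n" "\<And>s. s \<in> S \<Longrightarrow> sdist x s \<le> 4^n - 1"
    "\<And>s t. s \<in> S \<Longrightarrow> t \<in> S \<Longrightarrow> s \<noteq> t \<Longrightarrow> sdist s t \<ge> 2"
    "\<And>s. s \<in> S \<Longrightarrow> (\<Sum>t\<in>S - {s}. 1 / (real_of_int (sdist s t) - 1)) \<le> 2 - 2 / 2^n" by blast+
qed

section \<open>Hitting many distant frames\<close>

definition pos :: "nat \<Rightarrow> point \<Rightarrow> move list \<Rightarrow> point" where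
  "pos N p ms = foldl (apply_move N) p ms"

lemma pos_simps [simp]: "pos N p [] = p" "pos N p (m # ms) = pos N (apply_move N p m) ms"
  by (simp_all add: pos_def)

lemma snd_apply_move: "snd (apply_move N p m) = snd p + zmove m"
  by (cases p; cases m; auto simp: zmove_def)

lemma snd_pos: "snd (pos N p ms) = snd p + altitude ms"
  by (induction ms arbitrary: p) (auto simp: snd_apply_move)

text \<open>A supermartingale that gains a factor \<open>\<Lambda>\<close> whenever the walk enters one of the target sets
  for the first time. The gain is paid for by the potentials \<open>h s\<close> of the targets not yet
  visited, which requires the targets to be far apart (\<open>\<epsilon>\<close> small).\<close>

lemma prob_all_hit_le:
  fixes F :: "'s \<Rightarrow> point set" and h :: "'s \<Rightarrow> point \<Rightarrow> real" and w :: "'s \<Rightarrow> int \<Rightarrow> real"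
  assumes S: "finite S"
    and h0: "\<And>s p. s \<in> S \<Longrightarrow> h s p \<ge> 0" and h1: "\<And>s p. s \<in> S \<Longrightarrow> p \<in> F s \<Longrightarrow> h s p \<ge> 1"
    and disj: "\<And>s t p. s \<in> S \<Longrightarrow> t \<in> S \<Longrightarrow> p \<in> F s \<Longrightarrow> p \<in> F t \<Longrightarrow> s = t"
    and eps: "\<And>s p. s \<in> S \<Longrightarrow> p \<in> F s \<Longrightarrow> (\<Sum>t\<in>S - {s}. h t p) \<le> \<epsilon>"
    and Lam: "\<Lambda> \<ge> 1" "4 * \<Lambda> * \<epsilon> \<le> 1"
    and w0: "\<And>s z. s \<in> S \<Longrightarrow> w s z \<ge> 0"
    and super: "\<And>s p. s \<in> S \<Longrightarrow> (\<Sum>m\<in>moves d. h s (apply_move N p m)) \<le> (2 * real d + 2) * (h s p + w s (snd p))"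
  shows "measure_pmf.prob (rw d T)
      {ms. (\<forall>s\<in>S. \<exists>k\<le>length ms. pos N p (take k ms) \<in> F s) \<and>
           (\<Sum>k<length ms. \<Sum>s\<in>S. 4 * \<Lambda> * w s (snd (pos N p (take k ms)))) \<le> B}
    \<le> (1 + 4 * \<Lambda> * (\<Sum>s\<in>S. h s p)) * exp B / \<Lambda> ^ card S"
proof -
  define a where "a = 4 * \<Lambda>"
  have a: "a > 0" "a * \<epsilon> \<le> 1" using Lam by (simp_all add: a_def)
  define v where "v z = (\<Sum>s\<in>S. a * w s z)" for z
  have v0: "v z \<ge> 0" for z using w0 a by (auto simp: v_def intro!: sum_nonneg)
  define U where "U H = {s\<in>S. F s \<inter> H = {}}" for H
  have U: "U H \<subseteq> S" "finite (U H)" for H using S by (auto simp: U_def)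
  define \<phi> where "\<phi> V p = 1 + a * (\<Sum>s\<in>V. h s p)" for V p
  have phi1: "\<phi> V p \<ge> 1" if "V \<subseteq> S" for V p
  proof -
    have "0 \<le> (\<Sum>s\<in>V. h s p)" using that by (intro sum_nonneg h0) auto
    then show ?thesis using a by (simp add: \<phi>_def)
  qed
  have enter: "\<phi> (U (insert p H)) p * \<Lambda> ^ card (S - U (insert p H)) \<le> \<phi> (U H) p * \<Lambda> ^ card (S - U H)" for p H
  proof (cases "\<exists>s\<in>U H. p \<in> F s")
    case False
    then have "U (insert p H) = U H" by (auto simp: U_def)
    then show ?thesis by simp
  next
    case True
    then obtain s where s: "s \<in> U H" "p \<in> F s" by blast
    then have sS: "s \<in> S" using U by blast
    have eq: "U (insert p H) = U H - {s}" using s disj[OF sS _ s(2)] unfolding U_def by blast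
    have "S - (U H - {s}) = insert s (S - U H)" using sS by blast
    then have card: "card (S - (U H - {s})) = Suc (card (S - U H))" using S s by simp
    \<comment> \<open>Inside \<open>F s\<close> the other potentials sum to at most
      \<open>\<epsilon>\<close>, so what remains of \<open>\<phi>\<close> is at most 2. The dropped
      term \<open>a * h s p\<close> is at least \<open>4 * \<Lambda>\<close> and pays for the new
      factor \<open>\<Lambda>\<close>.\<close>
    have "\<phi> (U H - {s}) p * \<Lambda> \<le> \<phi> (U H) p"
    proof -
      have "(\<Sum>t\<in>U H - {s}. h t p) \<le> (\<Sum>t\<in>S - {s}. h t p)"
        using S U(1)[of H] by (intro sum_mono2 h0) auto
      also have "\<dots> \<le> \<epsilon>" using eps[OF sS s(2)] .
      finally have "a * (\<Sum>t\<in>U H - {s}. h t p) \<le> a * \<epsilon>" using a by (intro mult_left_mono) auto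
      then have "\<phi> (U H - {s}) p \<le> 2" unfolding \<phi>_def using a by linarith
      then have "\<phi> (U H - {s}) p * \<Lambda> \<le> 2 * \<Lambda>" using Lam by (intro mult_right_mono) auto
      also have "\<dots> \<le> a * 1" using Lam by (simp add: a_def)
      also have "\<dots> \<le> a * h s p" using h1[OF sS s(2)] a by (intro mult_left_mono) auto
      also have "\<dots> \<le> a * (\<Sum>t\<in>U H. h t p)"
        using s U(1)[of H] U(2)[of H] a by (intro mult_left_mono member_le_sum h0) auto
      finally show ?thesis unfolding \<phi>_def by linarith
    qed
    then have "\<phi> (U H - {s}) p * \<Lambda> * \<Lambda> ^ card (S - U H) \<le> \<phi> (U H) p * \<Lambda> ^ card (S - U H)"
      using Lam by (intro mult_right_mono) auto
    then show ?thesis unfolding eq card by (simp add: mult.assoc)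
  qed
  \<comment> \<open>Potential of the unvisited targets, times \<open>\<Lambda>\<close> per visited
    target, discounted by the defects paid so far. The current position counts as visited, but its
    defect is paid only when it is left.\<close>
  define V :: "point \<times> point list \<Rightarrow> real" where
    "V = (\<lambda>(p, past). \<phi> (U (insert p (set past))) p * \<Lambda> ^ card (S - U (insert p (set past))) * exp (- (\<Sum>q\<leftarrow>past. v (snd q))))"
  define st where "st = (\<lambda>(p, past) m. (apply_move N p m, p # past))"
  have fold: "foldl st (p, past) ms = (pos N p ms, rev (map (\<lambda>k. pos N p (take k ms)) [0..<length ms]) @ past)" for p past ms
  proof (induction ms arbitrary: p past)
    case (Cons m ms)
    have "foldl st (p, past) (m # ms) = foldl st (apply_move N p m, p # past) ms" by (simp add: st_def)
    also note Cons.IH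
    also have "rev (map (\<lambda>k. pos N (apply_move N p m) (take k ms)) [0..<length ms]) @ p # past
      = rev (map (\<lambda>k. pos N p (take k (m # ms))) [0..<length (m # ms)]) @ past"
      by (simp only: list.size(4) add_0_right add_Suc_right upt_conv_Cons[of 0] zero_less_Suc map_Suc_upt[symmetric])
         (simp add: comp_def)
    finally show ?case by simp
  qed simp
  have "measure_pmf.prob (rw d T) {ms. V (foldl st (p, []) ms) \<ge> \<Lambda> ^ card S * exp (- B)} \<le> V (p, []) / (\<Lambda> ^ card S * exp (- B))"
  proof (rule prob_supermartingale_final_ge)
    fix s :: "point \<times> point list"
    obtain p past where s: "s = (p, past)" by (cases s)
    define H where "H = insert p (set past)"
    define E where "E = exp (- (\<Sum>q\<leftarrow>past. v (snd q)))"
    define n where "n = card (S - U H)"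
    have "(\<Sum>m\<in>moves d. V (st s m)) \<le> (\<Sum>m\<in>moves d. \<phi> (U H) (apply_move N p m) * (\<Lambda> ^ n * (E * exp (- v (snd p)))))"
    proof (rule sum_mono)
      fix m
      have "V (st s m) = \<phi> (U (insert (apply_move N p m) H)) (apply_move N p m)
         * \<Lambda> ^ card (S - U (insert (apply_move N p m) H)) * (E * exp (- v (snd p)))"
        by (simp add: V_def st_def s H_def E_def exp_add[symmetric])
      also have "\<dots> \<le> \<phi> (U H) (apply_move N p m) * \<Lambda> ^ n * (E * exp (- v (snd p)))"
        unfolding n_def by (intro mult_right_mono enter) (simp add: E_def)
      finally show "V (st s m) \<le> \<phi> (U H) (apply_move N p m) * (\<Lambda> ^ n * (E * exp (- v (snd p))))"
        by (simp add: mult.assoc)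
    qed
    also have "\<dots> = (\<Sum>m\<in>moves d. \<phi> (U H) (apply_move N p m)) * (\<Lambda> ^ n * (E * exp (- v (snd p))))"
      by (simp add: sum_distrib_right)
    also have "\<dots> \<le> ((2 * real d + 2) * (\<phi> (U H) p * exp (v (snd p)))) * (\<Lambda> ^ n * (E * exp (- v (snd p))))"
    proof (rule mult_right_mono)
      have "(\<Sum>m\<in>moves d. \<phi> (U H) (apply_move N p m))
         = (2 * real d + 2) + a * (\<Sum>s\<in>U H. \<Sum>m\<in>moves d. h s (apply_move N p m))"
        by (subst sum.swap) (simp add: \<phi>_def sum.distrib card_moves sum_distrib_left algebra_simps)
      also have "\<dots> \<le> (2 * real d + 2) + a * (\<Sum>s\<in>U H. (2 * real d + 2) * (h s p + w s (snd p)))"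
        using a U by (intro add_left_mono mult_left_mono sum_mono super) auto
      also have "\<dots> = (2 * real d + 2) * (\<phi> (U H) p + (\<Sum>s\<in>U H. a * w s (snd p)))"
        by (simp add: \<phi>_def sum.distrib sum_distrib_left[symmetric] algebra_simps)
      also have "\<dots> \<le> (2 * real d + 2) * (\<phi> (U H) p + v (snd p))"
        unfolding v_def using U[of H] S w0 a by (intro mult_left_mono add_left_mono sum_mono2) auto
      also have "\<dots> \<le> (2 * real d + 2) * (\<phi> (U H) p * exp (v (snd p)))"
      proof (rule mult_left_mono)
        \<comment> \<open>Because \<open>\<phi> \<ge> 1\<close>, an additive defect \<open>v\<close>
          is at most a factor \<open>1 + v\<close>, which the discount \<open>exp (- v)\<close>
          cancels.\<close>
        have "\<phi> (U H) p + v (snd p) \<le> \<phi> (U H) p * (1 + v (snd p))"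
          using mult_right_mono[OF phi1[OF U(1)[of H], of p] v0[of "snd p"]] by (simp add: algebra_simps)
        also have "\<dots> \<le> \<phi> (U H) p * exp (v (snd p))"
          using phi1[OF U(1)[of H], of p] by (intro mult_left_mono exp_ge_add_one_self) auto
        finally show "\<phi> (U H) p + v (snd p) \<le> \<phi> (U H) p * exp (v (snd p))" .
      qed simp
      finally show "(\<Sum>m\<in>moves d. \<phi> (U H) (apply_move N p m)) \<le> (2 * real d + 2) * (\<phi> (U H) p * exp (v (snd p)))" .
    qed (use Lam in \<open>simp add: E_def\<close>)
    also have "\<dots> = (2 * real d + 2) * (\<phi> (U H) p * \<Lambda> ^ n * E)"
      by (simp add: exp_minus field_simps)
    also have "\<phi> (U H) p * \<Lambda> ^ n * E = V s" by (simp add: V_def s H_def E_def n_def)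
    finally show "(\<Sum>m\<in>moves d. V (st s m)) \<le> real (card (moves d)) * V s"
      by (simp add: card_moves algebra_simps)
  next
    fix s :: "point \<times> point list"
    obtain p past where s: "s = (p, past)" by (cases s)
    have "\<phi> (U (insert p (set past))) p \<ge> 0" using phi1[OF U(1)] by (meson order_trans zero_le_one)
    then show "V s \<ge> 0" using Lam by (simp add: V_def s)
  qed (use Lam finite_moves moves_nonempty in auto)
  also have "V (p, []) \<le> 1 + 4 * \<Lambda> * (\<Sum>s\<in>S. h s p)"
  proof -
    have "U {} = S" by (auto simp: U_def)
    then show ?thesis using enter[of p "{}"] by (simp add: V_def \<phi>_def a_def)
  qed
  finally have "measure_pmf.prob (rw d T) {ms. V (foldl st (p, []) ms) \<ge> \<Lambda> ^ card S * exp (- B)}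
      \<le> (1 + 4 * \<Lambda> * (\<Sum>s\<in>S. h s p)) / (\<Lambda> ^ card S * exp (- B))"
    using Lam by (simp add: divide_right_mono)
  also have "\<dots> = (1 + 4 * \<Lambda> * (\<Sum>s\<in>S. h s p)) * exp B / \<Lambda> ^ card S"
    by (simp add: exp_minus field_simps)
  finally show ?thesis
  proof (rule order_trans[rotated], intro measure_pmf.finite_measure_mono, safe)
    fix ms assume hit: "\<forall>s\<in>S. \<exists>k\<le>length ms. pos N p (take k ms) \<in> F s"
      and B: "(\<Sum>k<length ms. \<Sum>s\<in>S. 4 * \<Lambda> * w s (snd (pos N p (take k ms)))) \<le> B"
    define H where "H = insert (pos N p ms) ((\<lambda>k. pos N p (take k ms)) ` {0..<length ms})"
    have "U H = {}"
    proof -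
      have "F s \<inter> H \<noteq> {}" if "s \<in> S" for s
      proof -
        obtain k where k: "k \<le> length ms" "pos N p (take k ms) \<in> F s" using hit \<open>s \<in> S\<close> by blast
        moreover have "pos N p (take k ms) \<in> H"
          using k by (cases "k = length ms") (auto simp: H_def)
        ultimately show ?thesis by blast
      qed
      then show ?thesis by (auto simp: U_def)
    qed
    moreover have "(\<Sum>q\<leftarrow>rev (map (\<lambda>k. pos N p (take k ms)) [0..<length ms]). v (snd q)) \<le> B"
      using B by (simp add: rev_map[symmetric] sum_list_rev interv_sum_list_conv_sum_set_nat comp_def v_def a_def atLeast0LessThan)
    ultimately show "V (foldl st (p, []) ms) \<ge> \<Lambda> ^ card S * exp (- B)"
      using Lam by (simp add: fold V_def H_def[symmetric] \<phi>_def)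
  qed simp
qed

section \<open>The cut-off Green function on the cylinder\<close>

definition cent :: "nat \<Rightarrow> int \<Rightarrow> int" where
  "cent N t = (t + int N div 2) mod int N - int N div 2"

lemma cent_id: "2 * \<bar>t\<bar> < int N - 1 \<Longrightarrow> cent N t = t"
  unfolding cent_def by (subst mod_pos_pos_trivial) linarith+

lemma cent_mod: "cent N (x mod int N - y) = cent N (x - y)"
  by (simp add: cent_def mod_simps algebra_simps) (metis add.commute add_diff_eq mod_add_left_eq mod_diff_left_eq)

text \<open>The representative jumps only near \<open>N / 2\<close>, beyond \<open>2 * R\<close>.
  There the cut-off function vanishes at both candidate values, so the jump is invisible to
  it.\<close>

lemma cent_step:
  assumes N: "int N \<ge> 4 * R + 2" "R \<ge> 0" and e: "e = 1 \<or> e = -1"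
  shows "cent N (t + e) = cent N t + e \<or> (\<bar>cent N (t + e)\<bar> \<ge> 2 * R \<and> \<bar>cent N t + e\<bar> \<ge> 2 * R)"
proof -
  define h where "h = int N div 2"
  define r where "r = (t + h) mod int N"
  have r: "0 \<le> r" "r < int N" using N by (auto simp: r_def)
  have h: "2 * h \<le> int N" "int N \<le> 2 * h + 1" by (auto simp: h_def)
  have c: "cent N t = r - h" "cent N (t + e) = (r + e) mod int N - h"
    by (simp_all add: cent_def r_def h_def mod_simps algebra_simps)
  consider "0 \<le> r + e \<and> r + e < int N" | "r + e = int N" | "r + e = -1" using r e by linarith
  then show ?thesis
  proof cases
    case 1
    then show ?thesis by (simp add: c mod_pos_pos_trivial)
  next
    case 2
    then show ?thesis using N h by (simp add: c)
  next
    case 3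
    have "(-1) mod int N = int N - 1" using N by (simp add: zmod_minus1)
    then have "cent N (t + e) = int N - 1 - h" "cent N t + e = - 1 - h" using 3 by (simp_all add: c)
    then show ?thesis using N h by simp
  qed
qed

definition disp :: "nat \<Rightarrow> nat \<Rightarrow> point \<Rightarrow> point \<Rightarrow> nat \<Rightarrow> int" where
  "disp N d y p = (\<lambda>i. if i < d then cent N (fst p i - fst y i) else snd p - snd y)"

text \<open>Radius \<open>N div 8\<close>: the support, of half-width about \<open>N / 4\<close>,
  fits into the torus without overlap, while points whose horizontal and vertical distances are both
  at most \<open>N / 8\<close> see the kernel without cut-off.\<close>

definition green :: "nat \<Rightarrow> nat \<Rightarrow> real \<Rightarrow> point \<Rightarrow> point \<Rightarrow> real" where
  "green N d \<kappa> y p = cut_green d \<kappa> (real (N div 8)) (disp N d y p)"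

lemma sum_moves_green_le:
  fixes d :: nat
  assumes S: "\<And>(R::nat) c. R \<ge> 2 \<Longrightarrow>
       (\<Sum>i\<le>d. cut_green d \<kappa> R (c(i := c i + 1)) + cut_green d \<kappa> R (c(i := c i - 1)))
       \<le> 2 * real (d+1) * cut_green d \<kappa> R c + (if \<bar>c d\<bar> \<le> 2 * int R then C / real R ^ (d+1) else 0)"
    and N: "N \<ge> 16"
  shows "(\<Sum>m\<in>moves d. green N d \<kappa> y (apply_move N p m)) \<le>
     (2 * real d + 2) * green N d \<kappa> y p + (if \<bar>snd p - snd y\<bar> \<le> 2 * int (N div 8) then C / real (N div 8) ^ (d+1) else 0)"
proof -
  define R where "R = N div 8"
  have R: "R \<ge> 2" "int N \<ge> 4 * int R + 2" using N by (auto simp: R_def)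
  define c where "c = disp N d y p"
  obtain x z where p: "p = (x, z)" by (cases p)
  let ?G = "cut_green d \<kappa> (real R)"
  have step: "green N d \<kappa> y (apply_move N p (Inl (i, b))) = ?G (c(i := c i + sgn_step b))" if i: "i < d" for i b
  proof -
    define e where "e = sgn_step b"
    have e: "e = 1 \<or> e = -1" by (simp add: e_def sgn_step_def)
    have "disp N d y (apply_move N p (Inl (i, b))) = c(i := cent N ((x i - fst y i) + e))"
      using i by (auto simp: fun_eq_iff disp_def c_def p e_def cent_mod algebra_simps)
    moreover have "?G (c(i := cent N ((x i - fst y i) + e))) = ?G (c(i := c i + e))"
    proof -
      have ci: "c i = cent N (x i - fst y i)" using i by (simp add: c_def disp_def p)
      show ?thesis
      proof (cases "cent N ((x i - fst y i) + e) = c i + e")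
        case False
        then have "\<bar>cent N ((x i - fst y i) + e)\<bar> \<ge> 2 * int R \<and> \<bar>c i + e\<bar> \<ge> 2 * int R"
          using cent_step[OF R(2) _ e, of "x i - fst y i"] ci by simp
        then have "\<bar>real_of_int (cent N ((x i - fst y i) + e))\<bar> \<ge> 2 * real R" "\<bar>real_of_int (c i + e)\<bar> \<ge> 2 * real R"
          by linarith+
        then have "?G (c(i := cent N ((x i - fst y i) + e))) = 0" "?G (c(i := c i + e)) = 0"
          using i R by (auto intro!: cut_green_eq_0[of _ i])
        then show ?thesis by simp
      qed simp
    qed
    ultimately show ?thesis by (simp add: green_def R_def e_def)
  qed
  have stepd: "green N d \<kappa> y (apply_move N p (Inr b)) = ?G (c(d := c d + sgn_step b))" for b
  proof -
    have "(\<Sum>i\<le>d. (of_int (disp N d y (apply_move N p (Inr b)) i))^2 :: real) = (\<Sum>i\<le>d. (of_int ((c(d := c d + sgn_step b)) i))^2)"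
      by (intro sum.cong) (auto simp: disp_def c_def p add_diff_eq diff_add_eq)
    moreover have "(\<Prod>i\<le>d. cutoff (real R) (disp N d y (apply_move N p (Inr b)) i)) = (\<Prod>i\<le>d. cutoff (real R) ((c(d := c d + sgn_step b)) i))"
      by (intro prod.cong) (auto simp: disp_def c_def p algebra_simps)
    ultimately show ?thesis unfolding green_def cut_green_def R_def[symmetric] by (simp only:)
  qed
  have "(\<Sum>m\<in>moves d. green N d \<kappa> y (apply_move N p m))
     = (\<Sum>i\<le>d. ?G (c(i := c i + 1)) + ?G (c(i := c i - 1)))"
    by (subst sum_moves) (simp add: step stepd sgn_step_def lessThan_Suc_atMost[symmetric])
  also have "\<dots> \<le> 2 * real (d+1) * ?G c + (if \<bar>c d\<bar> \<le> 2 * int R then C / real R ^ (d+1) else 0)"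
    by (rule S[OF R(1)])
  also have "\<dots> = (2 * real d + 2) * green N d \<kappa> y p + (if \<bar>snd p - snd y\<bar> \<le> 2 * int R then C / real R ^ (d+1) else 0)"
    by (simp add: green_def c_def R_def disp_def algebra_simps)
  finally show ?thesis unfolding R_def .
qed

text \<open>Points of the plane spanned by torus direction 0 and the vertical direction, in which
  the coarse lattice lives.\<close>

definition pt :: "int \<Rightarrow> int \<Rightarrow> point" where
  "pt a z = ((\<lambda>_. 0)(0 := a), z)"

lemma green_pt:
  assumes N: "N \<ge> 16" and d: "d \<ge> 1" and a: "\<bar>a - a'\<bar> \<le> int (N div 8)"
  shows "green N d \<kappa> (pt a' z') (pt a z) \<le> (\<kappa> + (real_of_int (a - a'))^2 + (real_of_int (z - z'))^2) powr (- (real d - 1) / 2)"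
    and "\<bar>z - z'\<bar> \<le> int (N div 8) \<Longrightarrow>
      green N d \<kappa> (pt a' z') (pt a z) = (\<kappa> + (real_of_int (a - a'))^2 + (real_of_int (z - z'))^2) powr (- (real d - 1) / 2)"
proof -
  let ?c = "disp N d (pt a' z') (pt a z)"
  obtain R where R: "R = int (N div 8)" by simp
  have "8 * (N div 8) \<le> N" by simp
  then have "int (8 * (N div 8)) \<le> int N" by (simp only: of_nat_le_iff)
  then have "8 * R \<le> int N" by (simp add: R)
  moreover have "\<bar>a - a'\<bar> \<le> R" "int N \<ge> 16" using a N by (simp_all add: R)
  moreover have "2 * y < n - 1" if "8 * R' \<le> n" "y \<le> R'" "16 \<le> n" for y n R' :: int
    using that by linarith
  ultimately have "2 * \<bar>a - a'\<bar> < int N - 1" by blast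
  then have c0: "cent N 0 = 0" and ca: "cent N (a - a') = a - a'"
    using N by (auto intro!: cent_id)
  have c: "?c i = (if i = 0 then a - a' else if i < d then 0 else z - z')" for i
    using d c0 ca by (simp add: disp_def pt_def)
  have "(\<Sum>i\<le>d. (of_int (?c i))^2 :: real) = (\<Sum>i\<in>{0, d}. (of_int (?c i))^2)"
    using c by (intro sum.mono_neutral_right) auto
  also have "\<dots> = (real_of_int (a - a'))^2 + (real_of_int (z - z'))^2"
    using d c by simp
  finally have s: "(\<Sum>i\<le>d. (of_int (?c i))^2 :: real) = (real_of_int (a - a'))^2 + (real_of_int (z - z'))^2" .
  have R: "real (N div 8) > 0" using N by simp
  show "green N d \<kappa> (pt a' z') (pt a z) \<le> (\<kappa> + (real_of_int (a - a'))^2 + (real_of_int (z - z'))^2) powr (- (real d - 1) / 2)"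
    using cut_green_le[OF R, of d \<kappa> ?c] unfolding green_def s by (simp add: add.assoc)
  assume "\<bar>z - z'\<bar> \<le> int (N div 8)"
  then have "\<bar>?c i\<bar> \<le> int (N div 8)" for i using a c by simp
  then have "\<bar>real_of_int (?c i)\<bar> \<le> real (N div 8)" for i
    by (metis of_int_abs of_int_le_iff of_int_of_nat_eq)
  then show "green N d \<kappa> (pt a' z') (pt a z) = (\<kappa> + (real_of_int (a - a'))^2 + (real_of_int (z - z'))^2) powr (- (real d - 1) / 2)"
    using cut_green_eq[OF R, of d ?c \<kappa>] unfolding green_def s by (simp add: add.assoc)
qed

lemma green_nonneg: "N \<ge> 16 \<Longrightarrow> green N d \<kappa> y p \<ge> 0"
  by (simp add: green_def cut_green_nonneg)

lemma green_le_1: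
  assumes "N \<ge> 16" "d \<ge> 1" "\<kappa> \<ge> 1"
  shows "green N d \<kappa> y p \<le> 1"
proof -
  have R: "real (N div 8) > 0" using assms by simp
  have "green N d \<kappa> y p \<le> (\<kappa> + (\<Sum>i\<le>d. (of_int (disp N d y p i))^2)) powr (- (real d - 1) / 2)"
    unfolding green_def by (rule cut_green_le[OF R])
  also have "\<dots> \<le> 1 powr (- (real d - 1) / 2)"
  proof (rule powr_mono2')
    have "0 \<le> (\<Sum>i\<le>d. (real_of_int (disp N d y p i))^2)" by (intro sum_nonneg) simp
    then show "1 \<le> \<kappa> + (\<Sum>i\<le>d. (real_of_int (disp N d y p i))^2)" using assms by linarith
  qed (use assms in auto)
  finally show ?thesis by simp
qed

text \<open>A vertex of the coarse lattice is blocked if the walk meets the two segments leading from it to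
  its right and upper neighbours. Being one-dimensional, these segments are harder to hit than a box
  of the same diameter, by a factor that tends to zero with \<open>L\<close> (\<open>exists_frame_length\<close>; only
  logarithmically for \<open>d = 2\<close>).\<close>

definition frame :: "nat \<Rightarrow> int \<times> int \<Rightarrow> point set" where
  "frame L s = (\<lambda>t. pt (fst s * int L + int t) (snd s * int L)) ` {..L} \<union>
               (\<lambda>t. pt (fst s * int L) (snd s * int L + int t)) ` {..L}"

lemma finite_frame [simp]: "finite (frame L s)"
  by (simp add: frame_def)

lemma card_frame_le: "card (frame L s) \<le> 2 * L + 2"
proof -
  have "card (frame L s) \<le> card ((\<lambda>t. pt (fst s * int L + int t) (snd s * int L)) ` {..L}) +
      card ((\<lambda>t. pt (fst s * int L) (snd s * int L + int t)) ` {..L})"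
    unfolding frame_def by (rule card_Un_le)
  also have "\<dots> \<le> card {..L} + card {..L}" by (intro add_mono card_image_le) auto
  finally show ?thesis by simp
qed

lemma frame_box:
  assumes "p \<in> frame L s"
  obtains a z where "p = pt a z" "fst s * int L \<le> a" "a \<le> fst s * int L + int L"
    "snd s * int L \<le> z" "z \<le> snd s * int L + int L"
  using assms by (fastforce simp: frame_def)

definition frame_norm :: "nat \<Rightarrow> real \<Rightarrow> nat \<Rightarrow> real" where
  "frame_norm d \<kappa> L = (\<Sum>k\<le>L div 2. (\<kappa> + (real k)^2) powr (- (real d - 1) / 2))"

lemma pt_inject [simp]: "pt a z = pt a' z' \<longleftrightarrow> a = a' \<and> z = z'"
  by (auto simp: pt_def fun_eq_iff)

text \<open>From a point of an arm, at least half of that arm lies on one side. This gives points at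
  the distances \<open>0, ..., L div 2\<close>, all within the plateau of the cut-off. Dividing by
  \<open>frame_norm\<close> therefore makes the potential of a frame at least 1 on the
  frame.\<close>

lemma frame_norm_le_sum_green:
  assumes N: "N \<ge> 16" and d: "d \<ge> 1" and L: "L \<le> N div 8" and p: "p \<in> frame L s"
  shows "frame_norm d \<kappa> L \<le> (\<Sum>y\<in>frame L s. green N d \<kappa> y p)"
proof -
  have main: ?thesis
    if y: "\<And>k. k \<le> L div 2 \<Longrightarrow> y k \<in> frame L s" and inj: "inj_on y {..L div 2}"
      and g: "\<And>k. k \<le> L div 2 \<Longrightarrow> green N d \<kappa> (y k) p = (\<kappa> + (real k)^2) powr (- (real d - 1) / 2)" for y
  proof -
    have "frame_norm d \<kappa> L = (\<Sum>k\<le>L div 2. green N d \<kappa> (y k) p)"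
      unfolding frame_norm_def by (intro sum.cong) (auto simp: g)
    also have "\<dots> = (\<Sum>y\<in>y ` {..L div 2}. green N d \<kappa> y p)"
      using inj by (simp add: sum.reindex)
    also have "\<dots> \<le> (\<Sum>y\<in>frame L s. green N d \<kappa> y p)"
      using y N by (intro sum_mono2) (auto simp: green_nonneg)
    finally show ?thesis .
  qed
  have kR: "int k \<le> int (N div 8)" if "k \<le> L div 2" for k using that L by linarith
  define i j where "i = fst s * int L" and "j = snd s * int L"
  have mem: "pt (i + int t) j \<in> frame L s" "pt i (j + int t) \<in> frame L s" if "t \<le> L" for t
    using that by (auto simp: frame_def i_def j_def)
  from p consider t where "t \<le> L" "p = pt (i + int t) j" | t where "t \<le> L" "p = pt i (j + int t)"
    by (auto simp: frame_def i_def j_def)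
  then show ?thesis
  proof cases
    case (1 t)
    show ?thesis
    proof (cases "2 * t \<le> L")
      case True
      show ?thesis
      proof (rule main[of "\<lambda>k. pt (i + int (t + k)) j"])
        fix k assume k: "k \<le> L div 2"
        show "pt (i + int (t + k)) j \<in> frame L s" using True k by (intro mem) simp
        show "green N d \<kappa> (pt (i + int (t + k)) j) p = (\<kappa> + (real k)^2) powr (- (real d - 1) / 2)"
          unfolding 1 using kR[OF k] by (subst green_pt(2)[OF N d]) auto
      qed (auto intro!: inj_onI)
    next
      case False
      show ?thesis
      proof (rule main[of "\<lambda>k. pt (i + int (t - k)) j"])
        fix k assume k: "k \<le> L div 2"
        show "pt (i + int (t - k)) j \<in> frame L s" using 1 by (intro mem) simp
        have "k \<le> t" using False k by simp
        then show "green N d \<kappa> (pt (i + int (t - k)) j) p = (\<kappa> + (real k)^2) powr (- (real d - 1) / 2)"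
          unfolding 1 using kR[OF k] by (subst green_pt(2)[OF N d]) (auto simp: of_nat_diff)
      qed (use False in \<open>auto intro!: inj_onI\<close>)
    qed
  next
    case (2 t)
    show ?thesis
    proof (cases "2 * t \<le> L")
      case True
      show ?thesis
      proof (rule main[of "\<lambda>k. pt i (j + int (t + k))"])
        fix k assume k: "k \<le> L div 2"
        show "pt i (j + int (t + k)) \<in> frame L s" using True k by (intro mem) simp
        show "green N d \<kappa> (pt i (j + int (t + k))) p = (\<kappa> + (real k)^2) powr (- (real d - 1) / 2)"
          unfolding 2 using kR[OF k] by (subst green_pt(2)[OF N d]) auto
      qed (auto intro!: inj_onI)
    next
      case False
      show ?thesis
      proof (rule main[of "\<lambda>k. pt i (j + int (t - k))"])
        fix k assume k: "k \<le> L div 2"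
        show "pt i (j + int (t - k)) \<in> frame L s" using 2 by (intro mem) simp
        have "k \<le> t" using False k by simp
        then show "green N d \<kappa> (pt i (j + int (t - k))) p = (\<kappa> + (real k)^2) powr (- (real d - 1) / 2)"
          unfolding 2 using kR[OF k] by (subst green_pt(2)[OF N d]) (auto simp: of_nat_diff)
      qed (use False in \<open>auto intro!: inj_onI\<close>)
    qed
  qed
qed

lemma frame_norm_pos:
  assumes "\<kappa> > 0"
  shows "frame_norm d \<kappa> L > 0"
proof -
  have "\<kappa> + (real k)^2 \<noteq> 0" for k using assms zero_le_power2[of "real k"] by linarith
  then show ?thesis unfolding frame_norm_def by (intro sum_pos) auto
qed

text \<open>Arms extend by \<open>L\<close> to the right and upwards, so a coarse distance
  \<open>k\<close> guarantees only \<open>L * (k - 1)\<close> in one of the two coordinates. The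
  bounds on \<open>a\<close> and \<open>a'\<close> are exported to keep clear of the wrap-around of
  the torus.\<close>

lemma frames_far_apart:
  assumes L: "L \<ge> 1" and p: "p \<in> frame L s" and y: "y \<in> frame L t" and st: "sdist s t \<ge> 2"
  obtains a z a' z' where "p = pt a z" "y = pt a' z'" "\<bar>a - a'\<bar> \<ge> int L * (sdist s t - 1) \<or> \<bar>z - z'\<bar> \<ge> int L * (sdist s t - 1)"
    "fst s * int L \<le> a" "a \<le> fst s * int L + int L" "fst t * int L \<le> a'" "a' \<le> fst t * int L + int L"
proof -
  obtain a z where p: "p = pt a z" "fst s * int L \<le> a" "a \<le> fst s * int L + int L"
    "snd s * int L \<le> z" "z \<le> snd s * int L + int L" by (rule frame_box[OF p])
  obtain a' z' where y: "y = pt a' z'" "fst t * int L \<le> a'" "a' \<le> fst t * int L + int L"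
    "snd t * int L \<le> z'" "z' \<le> snd t * int L + int L" by (rule frame_box[OF y])
  have far: "\<bar>b - b'\<bar> \<ge> int L * (\<bar>u - u'\<bar> - 1)"
    if "u * int L \<le> b" "b \<le> u * int L + int L" "u' * int L \<le> b'" "b' \<le> u' * int L + int L" for b b' u u'
  proof (cases "u \<ge> u'")
    case True
    then have "int L * (\<bar>u - u'\<bar> - 1) = u * int L - u' * int L - int L" by (simp add: algebra_simps)
    then show ?thesis using that by linarith
  next
    case False
    then have "int L * (\<bar>u - u'\<bar> - 1) = u' * int L - u * int L - int L" by (simp add: algebra_simps)
    then show ?thesis using that by linarith
  qed
  have "sdist s t = \<bar>fst s - fst t\<bar> \<or> sdist s t = \<bar>snd s - snd t\<bar>" by (auto simp: sdist_def)
  then have "\<bar>a - a'\<bar> \<ge> int L * (sdist s t - 1) \<or> \<bar>z - z'\<bar> \<ge> int L * (sdist s t - 1)"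
    using far[OF p(2,3) y(2,3)] far[OF p(4,5) y(4,5)] by auto
  then show ?thesis using that p y by blast
qed

lemma frames_disjoint:
  assumes "L \<ge> 1" "p \<in> frame L s" "p \<in> frame L t" "sdist s t \<ge> 2"
  shows False
proof -
  obtain a z a' z' where "p = pt a z" "p = pt a' z'" and
    "\<bar>a - a'\<bar> \<ge> int L * (sdist s t - 1) \<or> \<bar>z - z'\<bar> \<ge> int L * (sdist s t - 1)"
    by (rule frames_far_apart[OF assms])
  moreover have "int L * (sdist s t - 1) > 0" using assms by simp
  ultimately show False by auto
qed

text \<open>Of the decay \<open>D^(-(d-1))\<close> only \<open>1/D\<close> is retained, as the sums
  over trees are bounded for inverse distances; for \<open>d = 2\<close> nothing is lost.\<close>

lemma green_far_le:
  assumes N: "N \<ge> 16" and d: "d \<ge> 2" and k: "\<kappa> \<ge> 0" and L: "L \<ge> 1" and p: "p \<in> frame L s" and y: "y \<in> frame L t"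
    and st: "sdist s t \<ge> 2"
    and box: "0 \<le> fst s" "0 \<le> fst t" "(fst s + 1) * int L \<le> int (N div 8)" "(fst t + 1) * int L \<le> int (N div 8)"
  shows "green N d \<kappa> y p \<le> 1 / (real L ^ (d - 1) * (real_of_int (sdist s t) - 1))"
proof -
  obtain a z a' z' where pt: "p = pt a z" "y = pt a' z'" and
    far: "\<bar>a - a'\<bar> \<ge> int L * (sdist s t - 1) \<or> \<bar>z - z'\<bar> \<ge> int L * (sdist s t - 1)" and
    b: "fst s * int L \<le> a" "a \<le> fst s * int L + int L" "fst t * int L \<le> a'" "a' \<le> fst t * int L + int L"
    by (rule frames_far_apart[OF L p y st])
  define D where "D = real_of_int (sdist s t) - 1"
  have D: "D \<ge> 1" using st by (simp add: D_def)
  have "0 \<le> fst s * int L" "0 \<le> fst t * int L" using box by simp_all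
  moreover have "fst s * int L + int L \<le> int (N div 8)" "fst t * int L + int L \<le> int (N div 8)"
    using box by (simp_all add: distrib_right)
  moreover have "\<bar>a - a'\<bar> \<le> r" if "0 \<le> u" "0 \<le> u'" "u + l \<le> r" "u' + l \<le> r" "u \<le> a" "a \<le> u + l" "u' \<le> a'" "a' \<le> u' + l"
    for u u' l r :: int using that by linarith
  ultimately have "\<bar>a - a'\<bar> \<le> int (N div 8)" using b by blast
  then have "green N d \<kappa> y p \<le> (\<kappa> + (real_of_int (a - a'))^2 + (real_of_int (z - z'))^2) powr (- (real d - 1) / 2)"
    unfolding pt using N d by (intro green_pt) auto
  also have "\<dots> \<le> ((real L * D)^2) powr (- (real d - 1) / 2)"
  proof (rule powr_mono2')
    have r: "real_of_int (int L * (sdist s t - 1)) = real L * D" by (simp add: D_def)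
    have "real L * D \<le> \<bar>real_of_int (a - a')\<bar> \<or> real L * D \<le> \<bar>real_of_int (z - z')\<bar>"
      using far unfolding r[symmetric] by (metis of_int_abs of_int_le_iff)
    moreover have "0 \<le> real L * D" using D by simp
    ultimately have "(real L * D)^2 \<le> (real_of_int (a - a'))^2 \<or> (real L * D)^2 \<le> (real_of_int (z - z'))^2"
      by (metis abs_of_nonneg abs_le_square_iff)
    moreover have "0 \<le> (real_of_int (a - a'))^2" "0 \<le> (real_of_int (z - z'))^2" by simp_all
    ultimately show "(real L * D)^2 \<le> \<kappa> + (real_of_int (a - a'))^2 + (real_of_int (z - z'))^2"
      using k by linarith
  qed (use d D L in auto)
  also have "((real L * D)^2) powr (- (real d - 1) / 2) = 1 / (real L * D) ^ (d - 1)"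
  proof -
    have pos: "real L * D > 0" using L D by simp
    have "(real L * D)^2 = (real L * D) powr 2" using pos by simp
    then have "((real L * D)^2) powr (- (real d - 1) / 2) = (real L * D) powr (- real (d - 1))"
    proof -
      have "2 * (- (real d - 1) / 2) = - real (d - 1)" using d by (simp add: of_nat_diff field_simps)
      then show ?thesis unfolding \<open>(real L * D)^2 = _\<close> powr_powr by (simp only:)
    qed
    also have "\<dots> = 1 / (real L * D) ^ (d - 1)"
      using pos by (simp add: powr_minus_divide powr_realpow)
    finally show ?thesis .
  qed
  also have "\<dots> \<le> 1 / (real L ^ (d - 1) * D)"
  proof -
    have "D ^ 1 \<le> D ^ (d - 1)" using D d by (intro power_increasing) auto
    then have "real L ^ (d - 1) * D \<le> (real L * D) ^ (d - 1)"
      by (simp add: power_mult_distrib mult_left_mono)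
    moreover have "0 < real L ^ (d - 1) * D" using L D by simp
    ultimately show ?thesis by (intro divide_left_mono) (auto intro: mult_pos_pos less_le_trans)
  qed
  finally show ?thesis by (simp add: D_def)
qed

text \<open>Split each summand into the powers \<open>-1/2\<close> and \<open>-(d-2)/2\<close> of
  \<open>\<kappa> + k^2\<close>. The second is at least \<open>L^(-(d-2))\<close>, the first at
  least \<open>1 / (K + k)\<close>, and harmonic sums diverge.\<close>

lemma frame_norm_power_ge:
  fixes K L d :: nat
  assumes d: "d \<ge> 2" and k: "\<kappa> \<ge> 1" "\<kappa> \<le> real K" and L: "L \<ge> 2 * K"
  shows "frame_norm d \<kappa> L * real L ^ (d - 2) \<ge> harm (L div 2 + 1) / real K"
proof -
  have K: "K \<ge> 1" using k by linarith
  have term_ge: "(\<kappa> + (real i)^2) powr (- (real d - 1) / 2) * real L ^ (d - 2) \<ge> (1 / real K) * inverse (real (i + 1))"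
    if i: "i \<le> L div 2" for i
  proof -
    define q where "q = \<kappa> + (real i)^2"
    have q: "q > 0" using k by (auto simp: q_def intro: add_pos_nonneg)
    have "real i \<le> real L / 2" using i by linarith
    then have "(real i)^2 \<le> (real L / 2)^2" by (intro power_mono) auto
    moreover have "real K \<le> (real L / 2)^2"
    proof -
      have "real K \<le> (real K)^2" using K by (simp add: power2_eq_square)
      also have "\<dots> \<le> (real L / 2)^2" using L by (intro power_mono) auto
      finally show ?thesis .
    qed
    ultimately have qL: "q \<le> (real L)^2" using k by (simp add: q_def power_divide)
    have qK: "q \<le> (real (K + i))^2"
    proof -
      have "real K \<le> (real K)^2" using K by (simp add: power2_eq_square)
      moreover have "(real (K + i))^2 = (real K)^2 + 2 * real K * real i + (real i)^2" by (simp add: power2_eq_square algebra_simps)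
      moreover have "0 \<le> 2 * real K * real i" by simp
      ultimately show ?thesis using k unfolding q_def by linarith
    qed
    have Lpos: "real L > 0" using L K by simp
    have "q powr (- (real d - 1) / 2) = q powr (- 1 / 2) * q powr (- (real (d - 2)) / 2)"
    proof -
      have "- (real d - 1) / 2 = - 1 / 2 + - (real (d - 2)) / 2" using d by (simp add: of_nat_diff)
      then show ?thesis by (simp only: powr_add)
    qed
    moreover have "q powr (- 1 / 2) \<ge> ((real (K + i))^2) powr (- 1 / 2)"
      using q qK by (intro powr_mono2') auto
    moreover have "((real (K + i))^2) powr (- 1 / 2) = inverse (real (K + i))"
    proof -
      have pos: "real (K + i) > 0" using K by simp
      have "(real (K + i))^2 = real (K + i) powr 2" using pos by simp
      then have "((real (K + i))^2) powr (- 1 / 2) = real (K + i) powr (2 * (- 1 / 2))" by (simp only: powr_powr)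
      then show ?thesis using pos by (simp add: powr_minus)
    qed
    moreover have "q powr (- (real (d - 2)) / 2) \<ge> ((real L)^2) powr (- (real (d - 2)) / 2)"
      using q qL by (intro powr_mono2') auto
    moreover have "((real L)^2) powr (- (real (d - 2)) / 2) = inverse (real L ^ (d - 2))"
    proof -
      have "(real L)^2 = real L powr 2" using Lpos by simp
      then have "((real L)^2) powr (- (real (d - 2)) / 2) = real L powr (2 * (- (real (d - 2)) / 2))" by (simp only: powr_powr)
      then show ?thesis using Lpos by (simp add: powr_minus powr_realpow)
    qed
    ultimately have "q powr (- (real d - 1) / 2) \<ge> inverse (real (K + i)) * inverse (real L ^ (d - 2))"
      by (metis inverse_nonnegative_iff_nonnegative mult_mono of_nat_0_le_iff powr_ge_zero zero_le_power)
    then have "q powr (- (real d - 1) / 2) * real L ^ (d - 2) \<ge> inverse (real (K + i)) * inverse (real L ^ (d - 2)) * real L ^ (d - 2)"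
      by (rule mult_right_mono) simp
    moreover have "inverse (real (K + i)) * inverse (real L ^ (d - 2)) * real L ^ (d - 2) = inverse (real (K + i))"
      using Lpos by simp
    moreover have "(1 / real K) * inverse (real (i + 1)) \<le> inverse (real (K + i))"
    proof -
      have "1 * real i \<le> real K * real i" using K by (intro mult_right_mono) auto
      then have "real (K + i) \<le> real K * real (i + 1)" by (simp add: algebra_simps)
      then have "inverse (real K * real (i + 1)) \<le> inverse (real (K + i))" using K by (intro le_imp_inverse_le) auto
      then show ?thesis by (simp add: field_simps)
    qed
    ultimately show ?thesis unfolding q_def[symmetric] by linarith
  qed
  have "harm (L div 2 + 1) / real K = (\<Sum>i\<le>L div 2. (1 / real K) * inverse (real (i + 1)))"
    unfolding harm_def sum_distrib_left[symmetric]
    by (simp add: sum.atLeast1_atMost_eq lessThan_Suc_atMost[symmetric])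
  also have "\<dots> \<le> (\<Sum>i\<le>L div 2. (\<kappa> + (real i)^2) powr (- (real d - 1) / 2) * real L ^ (d - 2))"
    by (intro sum_mono term_ge) auto
  finally show ?thesis by (simp add: frame_norm_def sum_distrib_right)
qed

text \<open>The quotient bounds the normalised potential of a frame at coarse distance 2: at most
  \<open>2 * L + 2\<close> points, each contributing at most \<open>L^(-(d-1))\<close>. By the
  previous lemma it is at most 4 divided by a diverging harmonic sum.\<close>

lemma exists_frame_length:
  fixes d :: nat
  assumes d: "d \<ge> 2" and k: "\<kappa> \<ge> 1" and eps: "\<epsilon> > 0"
  obtains L :: nat where "L \<ge> 1" "(2 * real L + 2) / (frame_norm d \<kappa> L * real L ^ (d - 1)) \<le> \<epsilon>"
proof -
  obtain K :: nat where K: "\<kappa> \<le> real K" using real_arch_simple by blast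
  have K1: "K \<ge> 1" using K k by linarith
  have "eventually (\<lambda>n. harm n \<ge> 4 * real K / \<epsilon>) sequentially"
    using harm_at_top by (simp add: filterlim_at_top)
  then obtain n0 where n0: "\<And>n. n \<ge> n0 \<Longrightarrow> harm n \<ge> 4 * real K / \<epsilon>" by (auto simp: eventually_sequentially)
  define L where "L = 2 * (K + n0)"
  have L: "L \<ge> 2 * K" "L div 2 + 1 \<ge> n0" "L \<ge> 1" using K1 by (auto simp: L_def)
  define A where "A = frame_norm d \<kappa> L * real L ^ (d - 2)"
  have "A \<ge> harm (L div 2 + 1) / real K" unfolding A_def by (rule frame_norm_power_ge[OF d k K L(1)])
  moreover have "harm (L div 2 + 1) / real K \<ge> (4 * real K / \<epsilon>) / real K" using n0[OF L(2)] by (rule divide_right_mono) simp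
  ultimately have A: "A \<ge> 4 / \<epsilon>" using K1 by simp
  then have A0: "A > 0" using eps by (meson divide_pos_pos less_le_trans zero_less_numeral)
  have "d - 1 = Suc (d - 2)" using d by simp
  then have "frame_norm d \<kappa> L * real L ^ (d - 1) = A * real L" by (simp add: A_def mult_ac)
  then have "(2 * real L + 2) / (frame_norm d \<kappa> L * real L ^ (d - 1)) = (2 * real L + 2) / (A * real L)" by simp
  also have "\<dots> \<le> (4 * real L) / (A * real L)" using L A0 by (intro divide_right_mono) auto
  also have "\<dots> = 4 / A" using L by simp
  also have "\<dots> \<le> \<epsilon>" using A A0 eps by (simp add: field_simps)
  finally show ?thesis using L that by blast
qed

lemma occ_le_card_mult:
  fixes M :: real
  assumes "finite S" "\<And>z. z \<in> S \<Longrightarrow> real (occ {z} ms) \<le> M"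
  shows "real (occ S ms) \<le> real (card S) * M"
proof -
  have "real (occ S ms) = (\<Sum>k<length ms. indicator S (altitude (take k ms)))" by (simp add: sum_occ)
  also have "\<dots> = (\<Sum>k<length ms. \<Sum>z\<in>S. indicator {z} (altitude (take k ms)))"
    using assms(1) by (intro sum.cong refl) (auto simp: indicator_def)
  also have "\<dots> = (\<Sum>z\<in>S. real (occ {z} ms))" by (subst sum.swap) (simp add: sum_occ)
  also have "\<dots> \<le> real (card S) * M" using assms(2) by (rule sum_bounded_above)
  finally show ?thesis .
qed

text \<open>The potentials are Green sums over frames, normalised by \<open>frame_norm\<close>. The
  defects, paid on visits to levels within \<open>2 * R\<close>, are controlled by the low density
  of all levels. Both \<open>L\<close> and \<open>v1\<close> are independent of \<open>N\<close> and
  \<open>n\<close>.\<close>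

lemma prob_all_frames_hit_le:
  fixes d :: nat
  assumes d: "d \<ge> 2"
  obtains L :: nat and v1 C :: real where "L \<ge> 1" "v1 > 0" "C > 0"
    "\<And>N n j S p0 T. N \<ge> 16 \<Longrightarrow> (4^n + 1) * L \<le> N div 8 \<Longrightarrow> S \<in> trees n (0, j) \<Longrightarrow> (\<forall>s\<in>S. 0 \<le> fst s) \<Longrightarrow> snd p0 = 0 \<Longrightarrow>
      measure_pmf.prob (rw d T) {ms. (\<forall>s\<in>S. \<exists>k\<le>length ms. pos N p0 (take k ms) \<in> frame L s) \<and>
         (\<forall>z. real (occ {z} ms) \<le> v1 * real N ^ d)} \<le> C * 2^n * (1/448)^(2^n)"
proof -
  obtain \<kappa> C0 where k: "\<kappa> \<ge> 64" and C0: "C0 > 0" and S: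
    "\<And>(R::nat) c. R \<ge> 2 \<Longrightarrow>
       (\<Sum>i\<le>d. cut_green d \<kappa> R (c(i := c i + 1)) + cut_green d \<kappa> R (c(i := c i - 1)))
       \<le> 2 * real (d+1) * cut_green d \<kappa> R c + (if \<bar>c d\<bar> \<le> 2 * int R then C0 / real R ^ (d+1) else 0)"
    by (rule cut_green_almost_superharmonic[OF d]) (rule that)
  \<comment> \<open>Each frame gains the factor 1000 and pays at most
    \<open>exp (1/2) \<le> 2\<close> for defects; \<open>2 / 1000\<close> is below
    \<open>1 / 448\<close>.\<close>
  define Lam :: real where "Lam = 1000"
  obtain L :: nat where L: "L \<ge> 1" and epsL: "(2 * real L + 2) / (frame_norm d \<kappa> L * real L ^ (d - 1)) \<le> 1 / (8 * Lam)"
    by (rule exists_frame_length[OF d, of \<kappa> "1 / (8 * Lam)"]) (use k in \<open>auto simp: Lam_def\<close>)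
  define A where "A = frame_norm d \<kappa> L"
  have A: "A > 0" unfolding A_def using k by (intro frame_norm_pos) auto
  \<comment> \<open>The weighted defect per frame for \<open>v1 = 1\<close>: at most
    \<open>2 * L + 2\<close> points, \<open>5 * R\<close> levels near each of them and
    \<open>(16 * R)^d\<close> visits per level, as \<open>N \<le> 16 * R\<close>; the powers of
    \<open>R\<close> cancel. The choice of \<open>v1\<close> then makes the total cost of the
    \<open>2^n\<close> frames \<open>2^n / 2\<close>.\<close>
  define Kc where "Kc = 4 * Lam / A * (C0 / (2 * real d + 2)) * (2 * real L + 2) * 5 * 16^d"
  have Kc: "Kc > 0" using A C0 unfolding Kc_def Lam_def by (intro mult_pos_pos divide_pos_pos) auto
  define v1 where "v1 = 1 / (2 * Kc)"
  have v1: "v1 > 0" using Kc by (simp add: v1_def)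
  define C where "C = 1 + 4 * Lam * ((2 * real L + 2) / A)"
  have C: "C > 0" using A by (auto simp: C_def Lam_def intro!: add_pos_nonneg)
  show ?thesis
  proof (rule that[OF L v1 C])
    fix N n :: nat and j :: int and S :: "(int \<times> int) set" and p0 :: point and T :: nat
    assume N: "N \<ge> 16" and nL: "(4^n + 1) * L \<le> N div 8" and tr: "S \<in> trees n (0, j)" and pos: "\<forall>s\<in>S. 0 \<le> fst s"
      and p0: "snd p0 = 0"
    define R where "R = N div 8"
    have R: "R \<ge> 2" using N by (simp add: R_def)
    note tp = trees_properties[OF tr]
    define c0 where "c0 = C0 / real R ^ (d+1) / (2 * real d + 2)"
    have c0: "c0 > 0" using C0 R by (simp add: c0_def)
    define h where "h s p = (1 / A) * (\<Sum>y\<in>frame L s. green N d \<kappa> y p)" for s p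
    define w where "w s z = (1 / A) * (\<Sum>y\<in>frame L s. if \<bar>z - snd y\<bar> \<le> 2 * int R then c0 else 0)" for s z
    have "1 * L \<le> (4^n + 1) * L" by (rule mult_le_mono1) simp
    with nL have LR: "L \<le> N div 8" by linarith
    have box: "0 \<le> fst s" "(fst s + 1) * int L \<le> int (N div 8)" if "s \<in> S" for s
    proof -
      show "0 \<le> fst s" using pos that by blast
      have "fst s \<le> 4^n - 1" using tp(3)[OF that] by (auto simp: sdist_def)
      then have "(fst s + 1) * int L \<le> (4^n + 1) * int L" by (intro mult_right_mono) auto
      also have "\<dots> = int ((4^n + 1) * L)" by (simp add: algebra_simps)
      also have "\<dots> \<le> int (N div 8)" using nL by (simp only: of_nat_le_iff)
      finally show "(fst s + 1) * int L \<le> int (N div 8)" .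
    qed
    have h_far: "h t p \<le> (2 * real L + 2) / (A * real L ^ (d - 1)) * (1 / (real_of_int (sdist s t) - 1))"
      if s: "s \<in> S" and t: "t \<in> S" and ne: "s \<noteq> t" and p: "p \<in> frame L s" for s t p
    proof -
      have st: "sdist s t \<ge> 2" using tp(4)[OF s t ne] .
      have D: "real_of_int (sdist s t) - 1 \<ge> 1" using st by simp
      have "(\<Sum>y\<in>frame L t. green N d \<kappa> y p) \<le> real (card (frame L t)) * (1 / (real L ^ (d - 1) * (real_of_int (sdist s t) - 1)))"
        using k by (intro sum_bounded_above green_far_le[OF N d _ L p _ st]) (auto intro: box s t)
      also have "\<dots> \<le> (2 * real L + 2) * (1 / (real L ^ (d - 1) * (real_of_int (sdist s t) - 1)))"
        using card_frame_le[of L t] D by (intro mult_right_mono) auto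
      finally have "h t p \<le> (1 / A) * ((2 * real L + 2) * (1 / (real L ^ (d - 1) * (real_of_int (sdist s t) - 1))))"
        unfolding h_def using A by (intro mult_left_mono) auto
      then show ?thesis by simp
    qed
    have "measure_pmf.prob (rw d T)
      {ms. (\<forall>s\<in>S. \<exists>k\<le>length ms. pos N p0 (take k ms) \<in> frame L s) \<and>
           (\<Sum>k<length ms. \<Sum>s\<in>S. 4 * Lam * w s (snd (pos N p0 (take k ms)))) \<le> 2^n / 2}
      \<le> (1 + 4 * Lam * (\<Sum>s\<in>S. h s p0)) * exp (2^n / 2) / Lam ^ card S"
    proof (rule prob_all_hit_le[where \<epsilon>="1 / (4 * Lam)"])
      show "finite S" by (rule tp(1))
      show "h s p \<ge> 0" for s p using A N unfolding h_def by (intro mult_nonneg_nonneg sum_nonneg green_nonneg) auto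
      show "w s z \<ge> 0" for s z using A c0 unfolding w_def by (intro mult_nonneg_nonneg sum_nonneg) auto
      show "h s p \<ge> 1" if "p \<in> frame L s" for s p
        using frame_norm_le_sum_green[OF N _ LR that, of d \<kappa>] d A unfolding h_def A_def[symmetric] by (simp add: field_simps)
      show "s = t" if "s \<in> S" "t \<in> S" "p \<in> frame L s" "p \<in> frame L t" for s t p
        using frames_disjoint[OF L that(3,4)] tp(4)[OF that(1,2)] by blast
      show "(\<Sum>t\<in>S - {s}. h t p) \<le> 1 / (4 * Lam)" if s: "s \<in> S" and p: "p \<in> frame L s" for s p
      proof -
        \<comment> \<open>The sum of inverse distances over a tree is at most 2, so the bound
          \<open>1 / (8 * Lam)\<close> gives \<open>1 / (4 * Lam)\<close> for the sum of all other
          potentials.\<close>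
        define e where "e = (2 * real L + 2) / (A * real L ^ (d - 1))"
        have e: "0 \<le> e" "e \<le> 1 / (8 * Lam)" using epsL A by (auto simp: e_def A_def)
        have "(\<Sum>t\<in>S - {s}. h t p) \<le> (\<Sum>t\<in>S - {s}. e * (1 / (real_of_int (sdist s t) - 1)))"
          unfolding e_def using s p by (intro sum_mono h_far) auto
        also have "\<dots> = e * (\<Sum>t\<in>S - {s}. 1 / (real_of_int (sdist s t) - 1))" by (simp only: sum_distrib_left)
        also have "\<dots> \<le> e * 2"
        proof (rule mult_left_mono)
          have "(2::real) - 2 / 2^n \<le> 2" by simp
          then show "(\<Sum>t\<in>S - {s}. 1 / (real_of_int (sdist s t) - 1)) \<le> 2" using tp(5)[OF s] by linarith
        qed (rule e)
        also have "\<dots> \<le> 1 / (8 * Lam) * 2" using e by (intro mult_right_mono) auto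
        finally show ?thesis by (simp add: Lam_def)
      qed
      show "(\<Sum>m\<in>moves d. h s (apply_move N p m)) \<le> (2 * real d + 2) * (h s p + w s (snd p))" for s p
      proof -
        have "(\<Sum>m\<in>moves d. h s (apply_move N p m)) = (1 / A) * (\<Sum>y\<in>frame L s. \<Sum>m\<in>moves d. green N d \<kappa> y (apply_move N p m))"
          unfolding h_def by (subst sum.swap) (simp add: sum_distrib_left)
        also have "\<dots> \<le> (1 / A) * (\<Sum>y\<in>frame L s. (2 * real d + 2) * green N d \<kappa> y p + (2 * real d + 2) * (if \<bar>snd p - snd y\<bar> \<le> 2 * int R then c0 else 0))"
        proof (intro mult_left_mono sum_mono)
          fix y :: point
          have "(2 * real d + 2) * (if \<bar>snd p - snd y\<bar> \<le> 2 * int R then c0 else 0)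
             = (if \<bar>snd p - snd y\<bar> \<le> 2 * int R then C0 / real R ^ (d+1) else 0)"
          proof -
            have "2 * real d + 2 > 0" by simp
            then show ?thesis by (simp add: c0_def)
          qed
          then show "(\<Sum>m\<in>moves d. green N d \<kappa> y (apply_move N p m)) \<le> (2 * real d + 2) * green N d \<kappa> y p + (2 * real d + 2) * (if \<bar>snd p - snd y\<bar> \<le> 2 * int R then c0 else 0)"
            using sum_moves_green_le[OF S N, of y p] by (simp only: R_def)
        qed (use A in auto)
        also have "\<dots> = (2 * real d + 2) * (h s p + w s (snd p))"
          unfolding h_def w_def by (simp only: sum.distrib sum_distrib_left[symmetric] distrib_left mult.left_commute)
        finally show ?thesis .
      qed
    qed (auto simp: Lam_def)
    also have "\<dots> \<le> C * 2^n * (1/448)^(2^n)"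
    proof -
      have "h s p0 \<le> (2 * real L + 2) / A" for s
      proof -
        have "(\<Sum>y\<in>frame L s. green N d \<kappa> y p0) \<le> real (card (frame L s)) * 1"
          using N d k by (intro sum_bounded_above green_le_1) auto
        also have "\<dots> \<le> 2 * real L + 2" using card_frame_le[of L s] by simp
        finally show ?thesis unfolding h_def using A by (simp add: divide_right_mono)
      qed
      then have "(\<Sum>s\<in>S. h s p0) \<le> real (card S) * ((2 * real L + 2) / A)" by (intro sum_bounded_above)
      also have "real (card S) = 2^n" by (simp add: tp(2))
      finally have "4 * Lam * (\<Sum>s\<in>S. h s p0) \<le> 4 * Lam * (2^n * ((2 * real L + 2) / A))" by (simp add: Lam_def)
      moreover have "(1::real) \<le> 2^n" by simp
      moreover have "C * 2^n = 2^n + 4 * Lam * (2^n * ((2 * real L + 2) / A))"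
        unfolding C_def by (simp only: distrib_right mult_1_left) (simp only: mult_ac)
      ultimately have "1 + 4 * Lam * (\<Sum>s\<in>S. h s p0) \<le> C * 2^n" by linarith
      moreover have "exp (2^n / 2) / Lam ^ card S \<le> (1/448)^(2^n)"
      proof -
        have "exp (1/2 :: real) ^ 2 \<le> 2 ^ 2" using exp_le by (simp add: exp_of_nat_mult[symmetric])
        then have e2: "exp (1/2 :: real) \<le> 2" by (rule power2_le_imp_le) simp
        have "exp (2^n / 2 :: real) = exp (1/2) ^ (2^n)" by (simp add: exp_of_nat_mult[symmetric])
        also have "\<dots> \<le> 2 ^ (2^n)" using e2 by (intro power_mono) auto
        finally have "exp (2^n / 2) / Lam ^ card S \<le> 2 ^ (2^n) / Lam ^ card S" by (simp add: Lam_def divide_right_mono)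
        also have "\<dots> = (2 / Lam) ^ (2^n)" by (simp add: tp(2) power_divide)
        also have "\<dots> \<le> (1/448)^(2^n)" by (intro power_mono) (auto simp: Lam_def)
        finally show ?thesis .
      qed
      ultimately have "(1 + 4 * Lam * (\<Sum>s\<in>S. h s p0)) * (exp (2^n / 2) / Lam ^ card S) \<le> (C * 2^n) * (1/448)^(2^n)"
        using C by (intro mult_mono) (auto simp: Lam_def)
      then show ?thesis by simp
    qed
    finally show "measure_pmf.prob (rw d T) {ms. (\<forall>s\<in>S. \<exists>k\<le>length ms. pos N p0 (take k ms) \<in> frame L s) \<and>
         (\<forall>z. real (occ {z} ms) \<le> v1 * real N ^ d)} \<le> C * 2^n * (1/448)^(2^n)"
    proof (rule order_trans[rotated], intro measure_pmf.finite_measure_mono, safe)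
      fix ms :: "move list"
      assume occ: "\<forall>z. real (occ {z} ms) \<le> v1 * real N ^ d"
      have inner: "(\<Sum>k<length ms. if \<bar>snd (pos N p0 (take k ms)) - b\<bar> \<le> 2 * int R then c0 else 0) \<le> c0 * (5 * real R * (v1 * (16 * real R)^d))" for b
      proof -
        have "(\<Sum>k<length ms. if \<bar>snd (pos N p0 (take k ms)) - b\<bar> \<le> 2 * int R then c0 else 0)
           = c0 * (\<Sum>k<length ms. indicator {b - 2 * int R..b + 2 * int R} (altitude (take k ms)))"
          unfolding sum_distrib_left by (intro sum.cong) (auto simp: snd_pos p0 indicator_def)
        also have "\<dots> = c0 * occ {b - 2 * int R..b + 2 * int R} ms" by (simp add: sum_occ)
        also have "\<dots> \<le> c0 * (real (card {b - 2 * int R..b + 2 * int R}) * (v1 * real N ^ d))"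
          using c0 occ by (intro mult_left_mono occ_le_card_mult) auto
        also have "\<dots> \<le> c0 * (5 * real R * (v1 * (16 * real R)^d))"
        proof (intro mult_left_mono mult_mono)
          show "real (card {b - 2 * int R..b + 2 * int R}) \<le> 5 * real R" using R by simp
          have "N \<le> 16 * R" using R unfolding R_def by linarith
          then have "real N \<le> 16 * real R" by linarith
          then show "real N ^ d \<le> (16 * real R) ^ d" by (intro power_mono) auto
        qed (use c0 v1 in auto)
        finally show ?thesis .
      qed
      have "(\<Sum>k<length ms. \<Sum>s\<in>S. 4 * Lam * w s (snd (pos N p0 (take k ms))))
         = (\<Sum>s\<in>S. 4 * Lam / A * (\<Sum>y\<in>frame L s. \<Sum>k<length ms. if \<bar>snd (pos N p0 (take k ms)) - snd y\<bar> \<le> 2 * int R then c0 else 0))"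
        unfolding w_def by (subst sum.swap, rule sum.cong[OF refl], subst sum.swap) (simp add: sum_distrib_left mult.assoc)
      also have "\<dots> \<le> (\<Sum>s\<in>S. 4 * Lam / A * ((2 * real L + 2) * (c0 * (5 * real R * (v1 * (16 * real R)^d)))))"
      proof (intro sum_mono mult_left_mono)
        fix s
        have "(\<Sum>y\<in>frame L s. \<Sum>k<length ms. if \<bar>snd (pos N p0 (take k ms)) - snd y\<bar> \<le> 2 * int R then c0 else 0)
           \<le> real (card (frame L s)) * (c0 * (5 * real R * (v1 * (16 * real R)^d)))"
          by (intro sum_bounded_above inner)
        also have "\<dots> \<le> (2 * real L + 2) * (c0 * (5 * real R * (v1 * (16 * real R)^d)))"
          using card_frame_le[of L s] c0 v1 by (intro mult_right_mono) auto
        finally show "(\<Sum>y\<in>frame L s. \<Sum>k<length ms. if \<bar>snd (pos N p0 (take k ms)) - snd y\<bar> \<le> 2 * int R then c0 else 0)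
           \<le> (2 * real L + 2) * (c0 * (5 * real R * (v1 * (16 * real R)^d)))" .
      qed (use A in \<open>auto simp: Lam_def\<close>)
      also have "\<dots> = 2^n * (v1 * Kc)"
      proof -
        have "c0 * (5 * real R * (v1 * (16 * real R)^d)) = (C0 / (2 * real d + 2)) * 5 * 16^d * v1"
          using R by (simp add: c0_def power_mult_distrib)
        then show ?thesis by (simp add: tp(2) Kc_def)
      qed
      also have "\<dots> = 2^n / 2" using Kc by (simp add: v1_def)
      finally show "(\<Sum>k<length ms. \<Sum>s\<in>S. 4 * Lam * w s (snd (pos N p0 (take k ms)))) \<le> 2^n / 2" .
    qed simp
  qed
qed

section \<open>Disconnection at low density\<close>

lemma torus_finite_nonempty:
  assumes "N \<ge> 1"
  shows "finite (torus N d)" "torus N d \<noteq> {}"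
proof -
  have "torus N d \<subseteq> (\<lambda>f i. if i < d then f i else 0) ` (PiE {..<d} (\<lambda>_. {0..<int N}))"
  proof
    fix x assume x: "x \<in> torus N d"
    have "x = (\<lambda>i. if i < d then restrict x {..<d} i else 0)"
      using x by (auto simp: torus_def fun_eq_iff)
    moreover have "restrict x {..<d} \<in> PiE {..<d} (\<lambda>_. {0..<int N})"
      using x by (auto simp: torus_def)
    ultimately show "x \<in> (\<lambda>f i. if i < d then f i else 0) ` (PiE {..<d} (\<lambda>_. {0..<int N}))" by blast
  qed
  then show "finite (torus N d)" by (rule finite_subset) (intro finite_imageI finite_PiE; simp)
  have "(\<lambda>_. 0) \<in> torus N d" using assms by (simp add: torus_def)
  then show "torus N d \<noteq> {}" by blast
qed

lemma pt_in_cyl: "0 \<le> a \<Longrightarrow> a < int N \<Longrightarrow> d \<ge> 1 \<Longrightarrow> pt a z \<in> cyl N d"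
  by (auto simp: pt_def cyl_def torus_def)

lemma adj_pt:
  assumes "N \<ge> 2" "d \<ge> 1" "0 \<le> a" "a < int N"
  shows "adj N d (pt a z) (pt a (z + 1))" "adj N d (pt a (z + 1)) (pt a z)"
    and "a + 1 < int N \<Longrightarrow> adj N d (pt a z) (pt (a + 1) z)"
    and "a + 1 < int N \<Longrightarrow> adj N d (pt (a + 1) z) (pt a z)"
proof -
  have m: "Inr b \<in> moves d" "Inl (0, b) \<in> moves d" for b using assms by (auto simp: moves_def)
  show "adj N d (pt a z) (pt a (z + 1))"
    unfolding adj_def using assms m(1)[of True]
    by (auto intro!: bexI[of _ "Inr True"] simp: pt_in_cyl) (simp add: pt_def sgn_step_def)
  show "adj N d (pt a (z + 1)) (pt a z)"
    unfolding adj_def using assms m(1)[of False]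
    by (auto intro!: bexI[of _ "Inr False"] simp: pt_in_cyl) (simp add: pt_def sgn_step_def)
  assume a: "a + 1 < int N"
  show "adj N d (pt a z) (pt (a + 1) z)"
    unfolding adj_def using assms a m(2)[of True]
    by (auto intro!: bexI[of _ "Inl (0, True)"] simp: pt_in_cyl) (simp add: pt_def sgn_step_def)
  show "adj N d (pt (a + 1) z) (pt a z)"
    unfolding adj_def using assms a m(2)[of False]
    by (auto intro!: bexI[of _ "Inl (0, False)"] simp: pt_in_cyl) (simp add: pt_def sgn_step_def)
qed

definition free_step :: "nat \<Rightarrow> nat \<Rightarrow> point set \<Rightarrow> point \<Rightarrow> point \<Rightarrow> bool" where
  "free_step N d S a b \<longleftrightarrow> adj N d a b \<and> a \<notin> S \<and> b \<notin> S"

lemma conn_in_free_step: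
  "conn_in N d S p q \<longleftrightarrow> p \<in> cyl N d - S \<and> q \<in> cyl N d - S \<and> (free_step N d S)\<^sup>*\<^sup>* p q"
  unfolding conn_in_def free_step_def ..

lemma free_vertical:
  assumes "N \<ge> 2" "d \<ge> 1" "0 \<le> a" "a < int N" and free: "\<And>t. t \<le> n \<Longrightarrow> pt a (z + int t) \<notin> S"
  shows "(free_step N d S)\<^sup>*\<^sup>* (pt a z) (pt a (z + int n))" "(free_step N d S)\<^sup>*\<^sup>* (pt a (z + int n)) (pt a z)"
proof -
  have "(free_step N d S)\<^sup>*\<^sup>* (pt a z) (pt a (z + int n)) \<and> (free_step N d S)\<^sup>*\<^sup>* (pt a (z + int n)) (pt a z)"
    using free
  proof (induction n)
    case (Suc n)
    have e: "z + int (Suc n) = z + int n + 1" by simp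
    have "pt a (z + int n) \<notin> S" "pt a (z + int n + 1) \<notin> S"
      using Suc.prems[of n] Suc.prems[of "Suc n", unfolded e] by auto
    then have st: "free_step N d S (pt a (z + int n)) (pt a (z + int n + 1))" "free_step N d S (pt a (z + int n + 1)) (pt a (z + int n))"
      using adj_pt(1,2)[OF assms(1-4), of "z + int n"] by (auto simp: free_step_def)
    have "(free_step N d S)\<^sup>*\<^sup>* (pt a z) (pt a (z + int n))" "(free_step N d S)\<^sup>*\<^sup>* (pt a (z + int n)) (pt a z)"
      using Suc by auto
    with st show ?case unfolding e
      by (meson rtranclp.rtrancl_into_rtrancl converse_rtranclp_into_rtranclp)
  qed simp
  then show "(free_step N d S)\<^sup>*\<^sup>* (pt a z) (pt a (z + int n))" "(free_step N d S)\<^sup>*\<^sup>* (pt a (z + int n)) (pt a z)" by auto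
qed

lemma free_horizontal:
  assumes "N \<ge> 2" "d \<ge> 1" "0 \<le> a" "a + int n < int N" and free: "\<And>t. t \<le> n \<Longrightarrow> pt (a + int t) z \<notin> S"
  shows "(free_step N d S)\<^sup>*\<^sup>* (pt a z) (pt (a + int n) z)" "(free_step N d S)\<^sup>*\<^sup>* (pt (a + int n) z) (pt a z)"
proof -
  have "(free_step N d S)\<^sup>*\<^sup>* (pt a z) (pt (a + int n) z) \<and> (free_step N d S)\<^sup>*\<^sup>* (pt (a + int n) z) (pt a z)"
    using free assms(4)
  proof (induction n)
    case (Suc n)
    have e: "a + int (Suc n) = a + int n + 1" by simp
    have "pt (a + int n) z \<notin> S" "pt (a + int n + 1) z \<notin> S"
      using Suc.prems(1)[of n] Suc.prems(1)[of "Suc n", unfolded e] by auto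
    then have st: "free_step N d S (pt (a + int n) z) (pt (a + int n + 1) z)" "free_step N d S (pt (a + int n + 1) z) (pt (a + int n) z)"
      using adj_pt(3,4)[OF assms(1,2), of "a + int n"] assms(3) Suc.prems(2) by (auto simp: free_step_def)
    have "(free_step N d S)\<^sup>*\<^sup>* (pt a z) (pt (a + int n) z)" "(free_step N d S)\<^sup>*\<^sup>* (pt (a + int n) z) (pt a z)"
      using Suc by auto
    with st show ?case unfolding e
      by (meson rtranclp.rtrancl_into_rtrancl converse_rtranclp_into_rtranclp)
  qed simp
  then show "(free_step N d S)\<^sup>*\<^sup>* (pt a z) (pt (a + int n) z)" "(free_step N d S)\<^sup>*\<^sup>* (pt (a + int n) z) (pt a z)" by auto
qed

lemma not_disconnects_if_free_path:
  assumes "\<And>M0::int. \<exists>M\<ge>M0. \<exists>p\<in>torus N d \<times> {..-M}. \<exists>q\<in>torus N d \<times> {M..}. conn_in N d S p q"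
  shows "\<not> disconnects N d S"
  using assms unfolding disconnects_def distinct_components_def by meson

text \<open>A coarse edge is an arm of its left or lower endpoint, so a crossing by unblocked coarse
  vertices is a free path in the cylinder. If \<open>S\<close> disconnects, duality in the strip
  yields instead a blocked star-path across its width \<open>4^n\<close>, exactly the diameter
  required for a tree of order \<open>n\<close>.\<close>

lemma disconnects_imp_bad_tree:
  fixes L n N d :: nat
  assumes N: "N \<ge> 16" and d: "d \<ge> 1" and L: "L \<ge> 1" and nL: "(4^n + 1) * L \<le> N div 8"
    and disc: "disconnects N d S"
  shows "\<exists>j. \<exists>Tr\<in>trees n (0, j). \<forall>s\<in>Tr. 0 \<le> fst s \<and> frame L s \<inter> S \<noteq> {}"
proof -
  have fin: "finite S" using disc by (simp add: disconnects_def)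
  define bad where "bad s \<longleftrightarrow> 0 \<le> fst s \<and> fst s \<le> 4^n \<and> frame L s \<inter> S \<noteq> {}" for s
  define H where "H = Max (insert 0 ((\<lambda>p. \<bar>snd p\<bar>) ` S))"
  have H: "\<bar>snd p\<bar> \<le> H" if "p \<in> S" for p unfolding H_def using fin that by (intro Max_ge) auto
  have H0: "H \<ge> 0" unfolding H_def using fin by (intro Max_ge) auto
  have bad_bound: "\<bar>snd s\<bar> \<le> H + 1" if "bad s" for s
  proof -
    obtain p where p: "p \<in> frame L s" "p \<in> S" using \<open>bad s\<close> by (auto simp: bad_def)
    obtain a z where az: "p = pt a z" "snd s * int L \<le> z" "z \<le> snd s * int L + int L" by (rule frame_box[OF p(1)])
    have "\<bar>z\<bar> \<le> H" using H[OF p(2)] by (simp add: az(1) pt_def)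
    then have "\<bar>snd s * int L\<bar> \<le> H + int L" using az by linarith
    then have "\<bar>snd s\<bar> * int L \<le> H + int L" by (simp add: abs_mult)
    moreover have "H \<le> H * int L" using H0 L by (simp add: mult_le_cancel_left1)
    ultimately have "\<bar>snd s\<bar> * int L \<le> (H + 1) * int L" by (simp add: distrib_right)
    then show ?thesis using L by (simp add: mult_le_cancel_right)
  qed
  have cols: "fst s * int L + int L < int N" if "fst s \<le> 4^n" for s :: "int \<times> int"
  proof -
    have "(fst s + 1) * int L \<le> (4^n + 1) * int L" using that by (intro mult_right_mono) auto
    also have "\<dots> = int ((4^n + 1) * L)" by (simp add: algebra_simps)
    also have "\<dots> \<le> int (N div 8)" using nL by (simp only: of_nat_le_iff)
    also have "\<dots> < int N" using N by simp
    finally show ?thesis by (simp add: distrib_right)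
  qed
  have N2: "N \<ge> 2" using N by simp
  have "\<exists>j j'. bad (0, j) \<and> (star_step bad)\<^sup>*\<^sup>* (0, j) (int (4^n), j')"
  proof (rule ccontr)
    assume neg: "\<not> ?thesis"
    have "\<not> disconnects N d S"
    proof (rule not_disconnects_if_free_path)
      fix M0 :: int
      \<comment> \<open>Blocked vertices have height at most \<open>H + 1\<close>, so the heights
        \<open>J\<close> and \<open>-J\<close> are free of them and their levels lie beyond all of
        \<open>S\<close>. Exceeding \<open>M0\<close> gives connections between arbitrarily distant
        ends.\<close>
      define J where "J = max (H + 2) M0"
      have J: "J > 0" "J \<ge> M0" "J \<ge> H + 2" using H0 by (auto simp: J_def)
      define cp where "cp s = pt (fst s * int L) (snd s * int L)" for s
      have "(strip_step (4^n) bad)\<^sup>*\<^sup>* (0, - J) (0, J)"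
        using strip_crossing_or_blocked[of J bad "4^n"] bad_bound J neg by fastforce
      moreover have "(free_step N d S)\<^sup>*\<^sup>* (cp u) (cp v)" if st: "strip_step (4^n) bad u v" for u v
      proof -
        have uv: "0 \<le> fst u" "fst u \<le> 4^n" "0 \<le> fst v" "fst v \<le> 4^n"
          using st by (auto simp: strip_step_def)
        have nb: "frame L u \<inter> S = {}" "frame L v \<inter> S = {}" using st by (auto simp: strip_step_def bad_def)
        have f: "pt (fst s * int L + int t) (snd s * int L) \<in> frame L s" "pt (fst s * int L) (snd s * int L + int t) \<in> frame L s"
          if "t \<le> L" for s t using that by (auto simp: frame_def)
        have hor: "(free_step N d S)\<^sup>*\<^sup>* (cp s) (cp (fst s + 1, snd s)) \<and> (free_step N d S)\<^sup>*\<^sup>* (cp (fst s + 1, snd s)) (cp s)"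
          if s: "frame L s \<inter> S = {}" "0 \<le> fst s" "fst s \<le> 4^n" for s
        proof -
          have 1: "0 \<le> fst s * int L" "fst s * int L + int L < int N" using s cols by auto
          have 2: "pt (fst s * int L + int t) (snd s * int L) \<notin> S" if "t \<le> L" for t using f(1)[OF that, of s] s by blast
          show ?thesis using free_horizontal[OF N2 d 1 2] by (simp add: cp_def distrib_right)
        qed
        have ver: "(free_step N d S)\<^sup>*\<^sup>* (cp s) (cp (fst s, snd s + 1)) \<and> (free_step N d S)\<^sup>*\<^sup>* (cp (fst s, snd s + 1)) (cp s)"
          if s: "frame L s \<inter> S = {}" "0 \<le> fst s" "fst s \<le> 4^n" for s
        proof -
          have 1: "0 \<le> fst s * int L" "fst s * int L < int N" using s cols[of s] L by auto
          have 2: "pt (fst s * int L) (snd s * int L + int t) \<notin> S" if "t \<le> L" for t using f(2)[OF that, of s] s by blast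
          show ?thesis using free_vertical[OF N2 d 1 2] by (simp add: cp_def distrib_right)
        qed
        have "\<bar>fst u - fst v\<bar> + \<bar>snd u - snd v\<bar> = 1" using st by (simp add: strip_step_def)
        then consider "v = (fst u + 1, snd u)" | "u = (fst v + 1, snd v)" | "v = (fst u, snd u + 1)" | "u = (fst v, snd v + 1)"
          by (cases u; cases v; simp) linarith
        then show ?thesis
        proof cases
          case 1 then show ?thesis using hor[OF nb(1) uv(1,2)] by simp
        next
          case 2 then show ?thesis using hor[OF nb(2) uv(3,4)] by simp
        next
          case 3 then show ?thesis using ver[OF nb(1) uv(1,2)] by simp
        next
          case 4 then show ?thesis using ver[OF nb(2) uv(3,4)] by simp
        qed
      qed
      ultimately have path: "(free_step N d S)\<^sup>*\<^sup>* (cp (0, - J)) (cp (0, J))"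
      proof (induction rule: rtranclp_induct)
        case (step u v)
        then show ?case by (meson rtranclp_trans)
      qed simp
      define M where "M = J * int L"
      have "J \<le> M" using J L by (simp add: M_def mult_le_cancel_left1)
      have out: "pt 0 z \<notin> S" if "\<bar>z\<bar> = M" for z
        using H[of "pt 0 z"] that J \<open>J \<le> M\<close> by (auto simp: pt_def)
      have cyl: "pt 0 z \<in> cyl N d" for z using N d by (intro pt_in_cyl) auto
      have "conn_in N d S (pt 0 (- M)) (pt 0 M)"
        using path cyl out[of M] out[of "- M"] J \<open>J \<le> M\<close> by (simp add: conn_in_free_step cp_def M_def)
      moreover have "pt 0 (- M) \<in> torus N d \<times> {..-M}" "pt 0 M \<in> torus N d \<times> {M..}"
        using cyl[of M] by (auto simp: cyl_def pt_def)
      ultimately show "\<exists>M\<ge>M0. \<exists>p\<in>torus N d \<times> {..-M}. \<exists>q\<in>torus N d \<times> {M..}. conn_in N d S p q"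
        using J(2) \<open>J \<le> M\<close> by (meson order_trans)
    qed
    then show False using disc by blast
  qed
  then obtain j j' where jj: "bad (0, j)" "(star_step bad)\<^sup>*\<^sup>* (0, j) (int (4^n), j')" by blast
  have "sdist (0, j) (int (4^n), j') \<ge> 4^n" by (simp add: sdist_def)
  then obtain Tr where "Tr \<in> trees n (0, j)" "\<forall>s\<in>Tr. bad s"
    using bad_tree_of_star_path[OF jj] by blast
  then show ?thesis by (auto simp: bad_def)
qed

lemma root_in_tree: "S \<in> trees n x \<Longrightarrow> x \<in> S"
  by (induction n arbitrary: x S) auto

lemma altitude_abs_le: "\<bar>altitude ms\<bar> \<le> int (length ms)"
proof (induction ms)
  case (Cons m ms)
  have "\<bar>zmove m\<bar> \<le> 1" by (auto simp: zmove_def sgn_step_def split: sum.split)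
  then show ?case using Cons by simp
qed simp

text \<open>Union bound over the height of the root and at most \<open>112^k\<close> trees with
  \<open>k = 2^n\<close> leaves, each costing \<open>448^(-k)\<close> up to a factor
  \<open>C * k\<close>. What is left is a power of \<open>k\<close> times \<open>4^(-k)\<close>,
  with \<open>k\<close> of order at least \<open>sqrt N\<close>.\<close>

lemma prob_disconnect_thin_le:
  fixes d :: nat
  assumes d: "d \<ge> 2"
  obtains v1 :: real and N0 :: nat where "v1 > 0" "N0 \<ge> 1"
    "\<And>\<gamma>. \<gamma> > 0 \<Longrightarrow> \<exists>K. \<forall>N\<ge>N0. \<forall>T. real T \<le> \<gamma> * real N ^ (2*d) \<longrightarrow> (\<forall>x.
      measure_pmf.prob (rw d T) {ms. (\<exists>n\<le>T. disconnects N d ((\<lambda>k. pos N (x, 0) (take k ms)) ` {0..n})) \<and>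
         (\<forall>z. real (occ {z} ms) \<le> v1 * real N ^ d)} \<le> K / sqrt (real N))"
proof -
  obtain L :: nat and v1 C :: real where L: "L \<ge> 1" and v1: "v1 > 0" and C: "C > 0" and hit:
    "\<And>N n j S p0 T. N \<ge> 16 \<Longrightarrow> (4^n + 1) * L \<le> N div 8 \<Longrightarrow> S \<in> trees n (0, j) \<Longrightarrow> (\<forall>s\<in>S. 0 \<le> fst s) \<Longrightarrow> snd p0 = 0 \<Longrightarrow>
      measure_pmf.prob (rw d T) {ms. (\<forall>s\<in>S. \<exists>k\<le>length ms. pos N p0 (take k ms) \<in> frame L s) \<and>
         (\<forall>z. real (occ {z} ms) \<le> v1 * real N ^ d)} \<le> C * 2^n * (1/448)^(2^n)"
    by (rule prob_all_frames_hit_le[OF d]) (rule that)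
  show ?thesis
  proof (rule that[OF v1, of "32 * L"])
    show "1 \<le> 32 * L" using L by simp
    fix \<gamma> :: real assume g: "\<gamma> > 0"
    define K where "K = (2 * \<gamma> * (64 * real L)^(2*d) + 3) * C * fact (4*d+2) * sqrt (64 * real L)"
    show "\<exists>K. \<forall>N\<ge>32 * L. \<forall>T. real T \<le> \<gamma> * real N ^ (2*d) \<longrightarrow> (\<forall>x.
      measure_pmf.prob (rw d T) {ms. (\<exists>n\<le>T. disconnects N d ((\<lambda>k. pos N (x, 0) (take k ms)) ` {0..n})) \<and>
         (\<forall>z. real (occ {z} ms) \<le> v1 * real N ^ d)} \<le> K / sqrt (real N))"
    proof (intro exI[of _ K] allI impI)
      fix N T x
      assume NL: "32 * L \<le> N" and T: "real T \<le> \<gamma> * real N ^ (2*d)"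
      have N: "N \<ge> 16" using NL L by simp
      have "N div (16 * L) \<ge> 1"
        using NL L by (simp add: div_greater_zero_iff Suc_le_eq)
      \<comment> \<open>The largest strip that fits:
        \<open>(4^n + 1) * L \<le> 2 * 4^n * L \<le> N / 8\<close>. Maximality gives
        \<open>N \<le> 64 * L * k^2\<close> for \<open>k = 2^n\<close>.\<close>
      then obtain n where n: "4^n \<le> N div (16 * L)" "N div (16 * L) < 4^(n+1)"
        using ex_power_ivl1[of 4 "N div (16 * L)"] by auto
      define k where "k = (2::nat)^n"
      have kk: "4^n = k * k" unfolding k_def by (simp add: power_mult_distrib[symmetric])
      have k1: "k \<ge> 1" by (simp add: k_def)
      have "4^n * (16 * L) \<le> N"
        using n(1) L by (simp add: less_eq_div_iff_mult_less_eq)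
      moreover have "(4^n + 1) * L * 8 \<le> 4^n * (16 * L)"
      proof -
        have "1 * L \<le> 4^n * L" by (rule mult_le_mono1) simp
        then show ?thesis by (simp add: algebra_simps)
      qed
      ultimately have "(4^n + 1) * L * 8 \<le> N" by (rule order_trans[rotated])
      then have nL: "(4^n + 1) * L \<le> N div 8"
        by (simp only: less_eq_div_iff_mult_less_eq zero_less_numeral)
      have "N < 4^(n+1) * (16 * L)" using n(2) L by (subst (asm) div_less_iff_less_mult) auto
      then have Nk: "real N \<le> 64 * real L * (real k)^2"
      proof -
        assume "N < 4^(n+1) * (16 * L)"
        then have "N \<le> 64 * L * (k * k)" by (simp add: kk mult_ac)
        then have "real N \<le> real (64 * L * (k * k))" by (simp only: of_nat_le_iff)
        then show ?thesis by (simp add: power2_eq_square mult_ac)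
      qed
      let ?P = "measure_pmf.prob (rw d T)"
      define G where "G ms \<longleftrightarrow> (\<forall>z. real (occ {z} ms) \<le> v1 * real N ^ d)" for ms
      define Ev where "Ev S = {ms. (\<forall>s\<in>S. \<exists>k\<le>length ms. pos N (x, 0) (take k ms) \<in> frame L s) \<and> G ms}" for S
      define I where "I = {- int T - 1 .. int T + 1}"
      define Q where "Q j = {S \<in> trees n (0, j). \<forall>s\<in>S. 0 \<le> fst s}" for j :: int
      have fQ: "finite (Q j)" for j using finite_trees[of n "(0, j)"] by (simp add: Q_def)
      have "?P {ms. (\<exists>n\<le>T. disconnects N d ((\<lambda>k. pos N (x, 0) (take k ms)) ` {0..n})) \<and> G ms}
         \<le> ?P (\<Union>j\<in>I. \<Union>S\<in>Q j. Ev S)"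
      proof (rule measure_pmf.finite_measure_mono_AE, rule AE_pmfI, safe)
        fix ms l
        assume ms: "ms \<in> set_pmf (rw d T)" and l: "l \<le> T"
          and disc: "disconnects N d ((\<lambda>k. pos N (x, 0) (take k ms)) ` {0..l})" and G: "G ms"
        have len: "length ms = T" using ms by (simp add: set_rw)
        obtain j Tr where Tr: "Tr \<in> trees n (0, j)"
          and bad: "\<And>s. s \<in> Tr \<Longrightarrow> 0 \<le> fst s \<and> frame L s \<inter> ((\<lambda>k. pos N (x, 0) (take k ms)) ` {0..l}) \<noteq> {}"
          using disconnects_imp_bad_tree[OF N order_trans[OF _ d] L nL disc] by (meson one_le_numeral)
        have hits: "\<exists>k\<le>length ms. pos N (x, 0) (take k ms) \<in> frame L s" if "s \<in> Tr" for s
          using bad[OF that] l len by fastforce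
        \<comment> \<open>The root is itself a leaf, so the walk meets its frame; in time
          \<open>T\<close> this is possible only at heights in \<open>I\<close>.\<close>
        obtain i where i: "i \<le> length ms" "pos N (x, 0) (take i ms) \<in> frame L (0, j)"
          using hits[OF root_in_tree[OF Tr]] by blast
        obtain a z where az: "pos N (x, 0) (take i ms) = pt a z" "j * int L \<le> z" "z \<le> j * int L + int L"
          by (rule frame_box[OF i(2)]) auto
        have "z = altitude (take i ms)" using arg_cong[OF az(1), of snd] by (simp add: snd_pos pt_def)
        then have "\<bar>z\<bar> \<le> int T" using altitude_abs_le[of "take i ms"] len by simp
        then have "\<bar>j * int L\<bar> \<le> int T + int L" using az by linarith
        then have "\<bar>j\<bar> * int L \<le> int T + int L" by (simp add: abs_mult)
        moreover have "int T * 1 \<le> int T * int L" using L by (intro mult_left_mono) auto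
        ultimately have "\<bar>j\<bar> * int L \<le> (int T + 1) * int L" by (simp add: distrib_right)
        then have "\<bar>j\<bar> \<le> int T + 1" using L by (simp add: mult_le_cancel_right)
        then have "j \<in> I" by (auto simp: I_def)
        moreover have "Tr \<in> Q j" using Tr bad by (simp add: Q_def)
        moreover have "ms \<in> Ev Tr" using hits G by (simp add: Ev_def)
        ultimately show "ms \<in> (\<Union>j\<in>I. \<Union>S\<in>Q j. Ev S)" by blast
      qed simp
      also have "\<dots> \<le> (\<Sum>j\<in>I. ?P (\<Union>S\<in>Q j. Ev S))"
        by (intro measure_pmf.finite_measure_subadditive_finite) (auto simp: I_def)
      also have "\<dots> \<le> (\<Sum>j\<in>I. \<Sum>S\<in>Q j. ?P (Ev S))"
        by (intro sum_mono measure_pmf.finite_measure_subadditive_finite fQ) auto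
      also have "\<dots> \<le> (\<Sum>j\<in>I. \<Sum>S\<in>Q j. C * 2^n * (1/448)^(2^n))"
        unfolding Ev_def G_def by (intro sum_mono hit[OF N nL]) (auto simp: Q_def)
      also have "\<dots> \<le> (\<Sum>j\<in>I. real (112 ^ k) * (C * 2^n * (1/448)^(2^n)))"
      proof (rule sum_mono)
        fix j
        have "card (Q j) \<le> card (trees n (0, j))" by (intro card_mono finite_trees) (auto simp: Q_def)
        also have "\<dots> \<le> card (trees n (0, j)) * (112 * 4^n)" by simp
        also have "\<dots> \<le> 112 ^ k" unfolding k_def by (rule card_trees_le)
        finally have "real (card (Q j)) \<le> real (112 ^ k)" by (simp only: of_nat_le_iff)
        then show "(\<Sum>S\<in>Q j. C * 2^n * (1/448)^(2^n)) \<le> real (112 ^ k) * (C * 2^n * (1/448)^(2^n))"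
          unfolding sum_constant using C by (intro mult_right_mono) auto
      qed
      also have "\<dots> = (2 * real T + 3) * C * real k * (1/4)^k"
      proof -
        have "real (card I) = 2 * real T + 3" by (simp add: I_def)
        moreover have "real (112 ^ k) * (1/448)^k = (1/4)^k"
        proof -
          have "real (112 ^ k) * (1/448)^k = (112 * (1/448))^k" by (simp only: of_nat_power power_mult_distrib of_nat_numeral)
          then show ?thesis by simp
        qed
        moreover have "(2::real)^n = real k" by (simp add: k_def)
        ultimately show ?thesis unfolding sum_constant k_def[symmetric]
          by (metis (no_types, lifting) mult.assoc mult.left_commute)
      qed
      \<comment> \<open>The exponent \<open>4*d + 2\<close> is one more than the powers of
        \<open>k\<close> in front: \<open>4*d\<close> from \<open>T\<close>, which is of order
        \<open>N^(2*d)\<close>, and one from the hitting bound. A decay \<open>1/k\<close> remains,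
        hence \<open>1 / sqrt N\<close>.\<close>
      also have "\<dots> \<le> ((2 * \<gamma> * (64 * real L)^(2*d) + 3) * real k ^ (4*d)) * C * real k * (fact (4*d+2) / real k ^ (4*d+2))"
      proof (intro mult_mono)
        have "real N ^ (2*d) \<le> (64 * real L * (real k)^2) ^ (2*d)" using Nk by (intro power_mono) auto
        also have "\<dots> = (64 * real L)^(2*d) * real k ^ (4*d)" by (simp add: power_mult_distrib power_mult[symmetric])
        finally have "\<gamma> * real N ^ (2*d) \<le> \<gamma> * ((64 * real L)^(2*d) * real k ^ (4*d))"
          using g by (intro mult_left_mono) auto
        moreover have "1 \<le> real k ^ (4*d)" using k1 by (intro one_le_power) auto
        ultimately show "2 * real T + 3 \<le> (2 * \<gamma> * (64 * real L)^(2*d) + 3) * real k ^ (4*d)"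
          using T by (simp add: distrib_right)
        have "(1/4::real) \<le> exp (- 1)" using exp_le by (simp add: exp_minus field_simps)
        then have "(1/4::real)^k \<le> exp (- 1) ^ k" by (intro power_mono) auto
        also have "\<dots> = exp (- real k)" by (simp add: exp_of_nat_mult[symmetric])
        also have "\<dots> \<le> fact (4*d+2) / real k ^ (4*d+2)" using k1 by (intro exp_minus_le_fact) auto
        finally show "(1/4::real)^k \<le> fact (4*d+2) / real k ^ (4*d+2)" .
      qed (use C g in auto)
      also have "\<dots> = (2 * \<gamma> * (64 * real L)^(2*d) + 3) * C * fact (4*d+2) / real k"
        using k1 by (simp add: power_add power2_eq_square field_simps)
      also have "\<dots> \<le> K / sqrt (real N)"
      proof -
        have "sqrt (real N) \<le> sqrt (64 * real L * (real k)^2)" using Nk by simp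
        also have "\<dots> = sqrt (64 * real L) * real k" by (simp add: real_sqrt_mult)
        finally have "1 / real k \<le> sqrt (64 * real L) / sqrt (real N)"
          using k1 N by (simp add: field_simps)
        then have "(2 * \<gamma> * (64 * real L)^(2*d) + 3) * C * fact (4*d+2) * (1 / real k) \<le>
          (2 * \<gamma> * (64 * real L)^(2*d) + 3) * C * fact (4*d+2) * (sqrt (64 * real L) / sqrt (real N))"
          using g C by (intro mult_left_mono) auto
        then show ?thesis by (simp add: K_def)
      qed
      finally show "?P {ms. (\<exists>n\<le>T. disconnects N d ((\<lambda>k. pos N (x, 0) (take k ms)) ` {0..n})) \<and>
         (\<forall>z. real (occ {z} ms) \<le> v1 * real N ^ d)} \<le> K / sqrt (real N)" unfolding G_def .
    qed
  qed
qed

section \<open>Comparison with Brownian motion\<close>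

lemma replicate_pmf_add:
  "replicate_pmf (a + b) p = map_pmf (\<lambda>(xs, ys). xs @ ys) (pair_pmf (replicate_pmf a p) (replicate_pmf b p))"
  by (simp add: replicate_pmf_distrib pair_pmf_def map_bind_pmf)

lemma prob_rw_append:
  "measure_pmf.prob (rw d (a + b)) {ms. Q (take a ms) \<and> R (drop a ms)} =
   measure_pmf.prob (rw d a) {ms. Q ms} * measure_pmf.prob (rw d b) {ms. R ms}"
proof -
  have "measure_pmf.prob (rw d (a + b)) {ms. Q (take a ms) \<and> R (drop a ms)} =
    measure_pmf.prob (pair_pmf (rw d a) (rw d b)) ((\<lambda>(xs, ys). xs @ ys) -` {ms. Q (take a ms) \<and> R (drop a ms)})"
    by (simp add: replicate_pmf_add)
  also have "\<dots> = measure_pmf.prob (pair_pmf (rw d a) (rw d b)) ({ms. Q ms} \<times> {ms. R ms})"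
    by (intro measure_pmf.finite_measure_eq_AE AE_pmfI) (auto simp: set_rw)
  finally show ?thesis by (simp add: measure_pmf_prob_product)
qed

lemma prob_rw_drop:
  "measure_pmf.prob (rw d (a + b)) {ms. R (drop a ms)} = measure_pmf.prob (rw d b) {ms. R ms}"
  using prob_rw_append[of a b d "\<lambda>_. True" R] by simp

definition incr :: "nat \<Rightarrow> nat \<Rightarrow> move list \<Rightarrow> int" where
  "incr n k ms = altitude (take n (drop (k * n) ms))"

lemma incr_eq: "incr n k ms = altitude (take ((k + 1) * n) ms) - altitude (take (k * n) ms)"
proof -
  have "take ((k + 1) * n) ms = take (k * n) ms @ take n (drop (k * n) ms)"
    by (metis add.commute distrib_right mult_1 take_add)
  then show ?thesis by (simp add: incr_def)
qed

lemma altitude_take_mult: "altitude (take (k * n) ms) = (\<Sum>i<k. incr n i ms)"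
proof (induction k)
  case (Suc k)
  then show ?case using incr_eq[of n k ms] by simp
qed simp

lemma prob_incr_eq_prod:
  "measure_pmf.prob (rw d (m * n)) {ms. \<forall>k<m. incr n k ms \<in> A k} =
     (\<Prod>k<m. measure_pmf.prob (rw d n) {ms. altitude ms \<in> A k})"
proof (induction m arbitrary: A)
  case (Suc m)
  have "{ms. \<forall>k<Suc m. incr n k ms \<in> A k} = {ms. altitude (take n ms) \<in> A 0 \<and> (\<forall>k<m. incr n k (drop n ms) \<in> A (Suc k))}"
    by (auto simp: incr_def less_Suc_eq_0_disj add.commute)
  then have "measure_pmf.prob (rw d (Suc m * n)) {ms. \<forall>k<Suc m. incr n k ms \<in> A k} =
     measure_pmf.prob (rw d (n + m * n)) {ms. altitude (take n ms) \<in> A 0 \<and> (\<forall>k<m. incr n k (drop n ms) \<in> A (Suc k))}"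
    by (simp del: replicate_pmf.simps)
  also have "\<dots> = measure_pmf.prob (rw d n) {ms. altitude ms \<in> A 0} * (\<Prod>k<m. measure_pmf.prob (rw d n) {ms. altitude ms \<in> A (Suc k)})"
    by (subst prob_rw_append) (simp add: Suc)
  also have "\<dots> = (\<Prod>k<Suc m. measure_pmf.prob (rw d n) {ms. altitude ms \<in> A k})"
    by (subst prod.lessThan_Suc_shift) simp
  finally show ?case .
qed simp

text \<open>Chebyshev at each fixed time, then Markov for the number of bad times. Since occupation
  is additive in time, displaced times may simply be counted instead of being excluded, and an
  expectation suffices. For fixed total length and fixed \<open>c\<close> and \<open>y\<close> the
  bound decays like \<open>1/m\<close>.\<close>

lemma prob_displaced_le:
  assumes c: "c > 0" and y: "y > 0" and n: "n > 0"
  shows "measure_pmf.prob (rw d (m * n))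
      {ms. real (card {t. t < m * n \<and> \<bar>real_of_int (altitude (take t ms) - altitude (take (t div n * n) ms))\<bar> \<ge> c}) \<ge> y}
    \<le> real (m * n) * real n / (c^2 * y)"
proof -
  let ?P = "measure_pmf.prob (rw d (m * n))"
  define E where "E t = {ms. \<bar>real_of_int (altitude (take t ms) - altitude (take (t div n * n) ms))\<bar> \<ge> c}" for t
  have PE: "?P (E t) \<le> real n / c^2" if t: "t < m * n" for t
  proof -
    define a where "a = t div n * n"
    define r where "r = t mod n"
    have ta: "t = a + r" by (simp add: a_def r_def)
    have r: "r < n" using n by (simp add: r_def)
    define b where "b = m * n - a"
    have mn: "m * n = a + b" using t ta by (simp add: b_def)
    have "E t = {ms. \<bar>real_of_int (altitude (take r (drop a ms)))\<bar> \<ge> c}"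
    proof -
      have "take t ms = take a ms @ take r (drop a ms)" for ms :: "move list"
        unfolding ta by (rule take_add)
      then show ?thesis unfolding E_def a_def[symmetric] by simp
    qed
    then have "?P (E t) = measure_pmf.prob (rw d b) {ms. \<bar>real_of_int (altitude (take r ms))\<bar> \<ge> c}"
      unfolding mn by (simp only: prob_rw_drop[where R="\<lambda>ms. \<bar>real_of_int (altitude (take r ms))\<bar> \<ge> c"])
    also have "b = r + (b - r)" using t ta mn by simp
    also have "measure_pmf.prob (rw d (r + (b - r))) {ms. \<bar>real_of_int (altitude (take r ms))\<bar> \<ge> c}
      = measure_pmf.prob (rw d r) {ms. \<bar>real_of_int (altitude ms)\<bar> \<ge> c}"
      using prob_rw_append[of r "b - r" d "\<lambda>ms. \<bar>real_of_int (altitude ms)\<bar> \<ge> c" "\<lambda>_. True"] by simp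
    also have "\<dots> \<le> measure_pmf.prob (rw d r) {ms. \<exists>k\<le>r. \<bar>real_of_int (altitude (take k ms))\<bar> \<ge> c}"
      by (intro measure_pmf.finite_measure_mono_AE AE_pmfI) (auto simp: set_rw)
    also have "\<dots> \<le> real r / c^2" by (rule prob_altitude_range_le[OF c])
    also have "\<dots> \<le> real n / c^2" using r by (intro divide_right_mono) auto
    finally show ?thesis .
  qed
  define X where "X ms = (\<Sum>t<m * n. indicator (E t) ms :: real)" for ms
  have Xn: "X ms \<ge> 0" for ms by (simp add: X_def sum_nonneg)
  have "{ms. real (card {t. t < m * n \<and> \<bar>real_of_int (altitude (take t ms) - altitude (take (t div n * n) ms))\<bar> \<ge> c}) \<ge> y}
     = {ms. X ms \<ge> y}"
  proof -
    have "X ms = real (card {t. t < m * n \<and> ms \<in> E t})" for ms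
      unfolding X_def indicator_def by (simp add: sum.If_cases Int_def conj_commute)
    then show ?thesis by (simp add: E_def)
  qed
  also have "?P {ms. X ms \<ge> y} \<le> measure_pmf.expectation (rw d (m * n)) X / y"
  proof -
    have "integrable (measure_pmf (rw d (m * n))) X"
      unfolding X_def by (intro Bochner_Integration.integrable_sum measure_pmf.integrable_const_bound[where B=1]) auto
    then have "?P {ms \<in> space (measure_pmf (rw d (m * n))). y \<le> X ms} \<le> (1/y) * measure_pmf.expectation (rw d (m * n)) X"
      using y Xn by (intro integral_Markov_inequality_measure[where A="{}", THEN order_trans]) auto
    then show ?thesis by simp
  qed
  also have "measure_pmf.expectation (rw d (m * n)) X = (\<Sum>t<m * n. ?P (E t))"
    unfolding X_def by (subst Bochner_Integration.integral_sum) (auto intro!: measure_pmf.integrable_const_bound[where B=1])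
  also have "\<dots> / y \<le> (real (m * n) * (real n / c^2)) / y"
    using y sum_mono[of "{..<m * n}" "\<lambda>t. ?P (E t)" "\<lambda>_. real n / c^2"] PE by (intro divide_right_mono) auto
  finally show ?thesis by simp
qed

lemma altitude_stake: "altitude (stake n s) = (\<Sum>i<n. zmove (s !! i))"
  by (induction n arbitrary: s) (auto simp: sum.lessThan_Suc_shift simp del: sum.lessThan_Suc)

text \<open>The central limit theorem is applied to coordinates of an infinite product of the law of
  one move; streams and their prefixes carry the result to lists. A vertical step has variance
  \<open>1 / (d + 1)\<close>.\<close>

lemma clt_altitude:
  fixes d :: nat
  shows "(\<lambda>n. measure_pmf.prob (rw d n) {ms. real_of_int (altitude ms) / sqrt (real n * (1 / (real d + 1))) \<le> x})
    \<longlonglongrightarrow> cdf std_normal_distribution x"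
proof -
  let ?p = "pmf_of_set (moves d)"
  define M where "M = (\<Pi>\<^sub>M i\<in>(UNIV::nat set). measure_pmf ?p)"
  interpret P: product_prob_space "\<lambda>_::nat. measure_pmf ?p" UNIV ..
  have pM: "prob_space M" unfolding M_def by (rule P.P.prob_space_axioms)
  interpret M: prob_space M by (rule pM)
  define X :: "nat \<Rightarrow> (nat \<Rightarrow> move) \<Rightarrow> real" where "X i \<omega> = real_of_int (zmove (\<omega> i))" for i \<omega>
  define \<sigma> where "\<sigma> = sqrt (1 / (real d + 1))"
  have s: "\<sigma> > 0" "\<sigma>^2 = 1 / (real d + 1)" by (simp_all add: \<sigma>_def)
  have coord: "(\<lambda>\<omega>. \<omega> i) \<in> measurable M (measure_pmf ?p)" for i
    unfolding M_def by (rule measurable_component_singleton) simp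
  have dc: "distr M (measure_pmf ?p) (\<lambda>\<omega>. \<omega> i) = measure_pmf ?p" for i
    unfolding M_def by (rule P.PiM_component) simp
  have ind0: "M.indep_vars (\<lambda>_. measure_pmf ?p) (\<lambda>i \<omega>. \<omega> i) UNIV"
  proof (subst M.indep_vars_iff_distr_eq_PiM)
    have "distr M (\<Pi>\<^sub>M i\<in>(UNIV::nat set). measure_pmf ?p) (\<lambda>x. \<lambda>i\<in>UNIV. x i) = distr M M (\<lambda>x. x)"
      by (intro distr_cong) (auto simp: M_def)
    then show "distr M (\<Pi>\<^sub>M i\<in>(UNIV::nat set). measure_pmf ?p) (\<lambda>x. \<lambda>i\<in>UNIV. x i) =
       (\<Pi>\<^sub>M i\<in>(UNIV::nat set). distr M (measure_pmf ?p) (\<lambda>\<omega>. \<omega> i))"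
      unfolding dc by (simp add: M_def)
  qed (use coord in auto)
  have ind: "M.indep_vars (\<lambda>_. borel) X UNIV"
    unfolding X_def by (rule M.indep_vars_compose2[OF ind0]) simp
  have E: "(\<integral>\<omega>. f (zmove (\<omega> i)) \<partial>M) = (2 * real d * f 0 + (f 1 + f (-1))) / (2 * real d + 2)" for f :: "int \<Rightarrow> real" and i
  proof -
    have "(\<integral>\<omega>. f (zmove (\<omega> i)) \<partial>M) = (\<integral>m. f (zmove m) \<partial>distr M (measure_pmf ?p) (\<lambda>\<omega>. \<omega> i))"
      by (rule integral_distr[symmetric, OF coord]) simp
    also have "\<dots> = (\<integral>m. f (zmove m) \<partial>measure_pmf ?p)" by (simp only: dc)
    also have "\<dots> = (\<Sum>m\<in>moves d. f (zmove m)) / real (card (moves d))"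
      by (rule integral_pmf_of_set) (auto simp: finite_moves moves_nonempty)
    finally show ?thesis by (simp add: sum_moves_zmove card_moves add.commute)
  qed
  have X0: "M.expectation (X i) = 0" for i using E[of of_int i] by (simp add: X_def[abs_def])
  have X2: "M.expectation (\<lambda>\<omega>. (X i \<omega>)^2) = \<sigma>^2" for i
    using E[of "\<lambda>z. (of_int z)^2" i] by (simp add: X_def s field_simps)
  have bnd: "\<bar>X i \<omega>\<bar> \<le> 1" for i \<omega>
    by (auto simp: X_def zmove_def sgn_step_def split: sum.split)
  have Xm: "X i \<in> borel_measurable M" for i
    unfolding X_def by (rule measurable_compose[OF coord]) simp
  have int2: "integrable M (\<lambda>\<omega>. (X i \<omega>)^2)" for i
    using bnd[of i] Xm[of i] by (intro M.integrable_const_bound[where B=1]) (auto simp: abs_square_le_1)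
  have var: "M.variance (X i) = \<sigma>^2" for i by (simp add: X0 X2)
  have dist: "distr M borel (X i) = distr M borel (X 0)" for i
  proof -
    have "distr M borel (X j) = distr (distr M (measure_pmf ?p) (\<lambda>\<omega>. \<omega> j)) borel (\<lambda>m. real_of_int (zmove m))" for j
      by (subst distr_distr[OF _ coord]) (simp_all add: X_def[abs_def] comp_def)
    then show ?thesis by (simp only: dc)
  qed
  have "weak_conv_m (\<lambda>n. distr M borel (\<lambda>\<omega>. (\<Sum>i<n. X i \<omega>) / sqrt (n * \<sigma>\<^sup>2))) std_normal_distribution"
    by (rule M.central_limit_theorem_zero_mean[OF ind X0 s(1) int2 var dist])
  moreover have "isCont (cdf std_normal_distribution) x"
  proof -
    interpret N: real_distribution std_normal_distribution by (rule real_dist_normal_dist)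
    have "emeasure std_normal_distribution {x} = 0"
      by (subst emeasure_density) (auto simp: nn_integral_indicator_singleton)
    then show ?thesis by (subst N.isCont_cdf) (simp add: measure_def)
  qed
  ultimately have "(\<lambda>n. cdf (distr M borel (\<lambda>\<omega>. (\<Sum>i<n. X i \<omega>) / sqrt (n * \<sigma>\<^sup>2))) x) \<longlonglongrightarrow> cdf std_normal_distribution x"
    by (simp add: weak_conv_m_def weak_conv_def)
  moreover have "cdf (distr M borel (\<lambda>\<omega>. (\<Sum>i<n. X i \<omega>) / sqrt (n * \<sigma>\<^sup>2))) x
     = measure_pmf.prob (rw d n) {ms. real_of_int (altitude ms) / sqrt (real n * (1 / (real d + 1))) \<le> x}" for n
  proof -
    let ?S = "stream_space (measure_pmf ?p)"
    have ts: "to_stream \<in> measurable M ?S" unfolding M_def by (rule measurable_to_stream)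
    have eq: "?S = distr M ?S to_stream" unfolding M_def by (rule stream_space_eq_distr)
    have "measure_pmf (rw d n) = distr (distr M ?S to_stream) (count_space UNIV) (stake n)"
      using distr_stake_stream_space[of ?p n] eq by simp
    also have "\<dots> = distr M (count_space UNIV) (\<lambda>\<omega>. stake n (to_stream \<omega>))"
      using distr_distr[OF measurable_stake_pmf ts] by (simp add: comp_def)
    finally have *: "measure_pmf (rw d n) = distr M (count_space UNIV) (\<lambda>\<omega>. stake n (to_stream \<omega>))" .
    have "measure (measure_pmf (rw d n)) {ms. real_of_int (altitude ms) / sqrt (real n * (1 / (real d + 1))) \<le> x}
      = measure M ((\<lambda>\<omega>. stake n (to_stream \<omega>)) -` {ms. real_of_int (altitude ms) / sqrt (real n * (1 / (real d + 1))) \<le> x} \<inter> space M)"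
      unfolding * by (rule measure_distr[OF measurable_compose[OF ts measurable_stake_pmf]]) simp
    also have "\<dots> = measure M ((\<lambda>\<omega>. (\<Sum>i<n. X i \<omega>) / sqrt (n * \<sigma>\<^sup>2)) -` {..x} \<inter> space M)"
    proof -
      have h: "real_of_int (altitude (stake n (to_stream \<omega>))) = (\<Sum>i<n. X i \<omega>)" for \<omega>
        by (subst altitude_stake) (simp add: X_def to_stream_def)
      show ?thesis
        by (intro arg_cong[where f="measure M"]) (auto simp only: vimage_def mem_Collect_eq h s Int_iff atMost_iff)
    qed
    also have "\<dots> = cdf (distr M borel (\<lambda>\<omega>. (\<Sum>i<n. X i \<omega>) / sqrt (n * \<sigma>\<^sup>2))) x"
      unfolding cdf_def using Xm by (subst measure_distr) auto
    finally show ?thesis ..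
  qed
  ultimately show ?thesis by simp
qed

abbreviation Phi :: "real \<Rightarrow> real" where "Phi \<equiv> cdf std_normal_distribution"

lemma measure_std_normal_singleton: "measure std_normal_distribution {x} = 0"
proof -
  have "emeasure std_normal_distribution {x} = 0"
    by (subst emeasure_density) (auto simp: nn_integral_indicator_singleton)
  then show ?thesis by (simp add: measure_def)
qed

lemma isCont_Phi: "isCont Phi x"
proof -
  interpret N: real_distribution std_normal_distribution by (rule real_dist_normal_dist)
  show ?thesis by (subst N.isCont_cdf) (rule measure_std_normal_singleton)
qed

text \<open>Here the argument moves with \<open>N\<close>. It is squeezed between the fixed
  arguments \<open>y * r - h\<close> and \<open>y * r + h\<close>; continuity of \<open>Phi\<close>
  lets \<open>h\<close> tend to 0 and makes strict and weak inequality agree in the limit.\<close>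

lemma prob_altitude_less_tendsto:
  fixes d :: nat and n :: "nat \<Rightarrow> nat" and c :: "nat \<Rightarrow> real"
  assumes n: "filterlim n at_top sequentially"
    and c: "(\<lambda>N. c N / sqrt (real (n N) * (1 / (real d + 1)))) \<longlonglongrightarrow> r"
  shows "(\<lambda>N. measure_pmf.prob (rw d (n N)) {ms. real_of_int (altitude ms) < y * c N}) \<longlonglongrightarrow> Phi (y * r)"
proof (rule tendstoI)
  fix e :: real assume e: "e > 0"
  define s where "s N = sqrt (real (n N) * (1 / (real d + 1)))" for N
  define F where "F N x = measure_pmf.prob (rw d (n N)) {ms. real_of_int (altitude ms) / s N \<le> x}" for N x
  obtain h where h: "h > 0" and hPhi: "\<And>z. \<bar>z - y * r\<bar> \<le> h \<Longrightarrow> \<bar>Phi z - Phi (y * r)\<bar> < e / 2"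
  proof -
    obtain h0 where "h0 > 0" "\<And>z. \<bar>z - y * r\<bar> < h0 \<Longrightarrow> \<bar>Phi z - Phi (y * r)\<bar> < e / 2"
      using isCont_Phi[of "y * r"] e unfolding continuous_at_eps_delta dist_real_def
      by (metis half_gt_zero)
    then show ?thesis using that[of "h0 / 2"] by auto
  qed
  have F: "(\<lambda>N. F N x) \<longlonglongrightarrow> Phi x" for x
    using filterlim_compose[OF clt_altitude[of d x] n] by (simp add: F_def s_def)
  have "(\<lambda>N. y * c N / s N) \<longlonglongrightarrow> y * r" using tendsto_mult[OF tendsto_const[of y] c] by (simp add: s_def)
  then have ev1: "eventually (\<lambda>N. \<bar>y * c N / s N - y * r\<bar> < h) sequentially"
    using h by (auto simp: tendsto_iff dist_real_def)
  have ev2: "eventually (\<lambda>N. \<bar>F N (y * r + h) - Phi (y * r + h)\<bar> < e / 2) sequentially"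
    "eventually (\<lambda>N. \<bar>F N (y * r - h) - Phi (y * r - h)\<bar> < e / 2) sequentially"
    using tendstoD[OF F, of "e / 2"] e by (simp_all only: dist_real_def half_gt_zero)
  have ev3: "eventually (\<lambda>N. n N \<ge> 1) sequentially" using n by (simp add: filterlim_at_top)
  show "eventually (\<lambda>N. dist (measure_pmf.prob (rw d (n N)) {ms. real_of_int (altitude ms) < y * c N}) (Phi (y * r)) < e) sequentially"
    using ev1 ev2 ev3
  proof eventually_elim
    case (elim N)
    define p where "p = measure_pmf.prob (rw d (n N)) {ms. real_of_int (altitude ms) < y * c N}"
    have s: "s N > 0" using elim(4) by (simp add: s_def)
    have up: "p \<le> F N (y * r + h)"
      unfolding p_def F_def
    proof (rule measure_pmf.finite_measure_mono, safe)
      fix ms assume "real_of_int (altitude ms) < y * c N"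
      then have "real_of_int (altitude ms) / s N \<le> y * c N / s N" using s by (intro divide_right_mono) auto
      also have "\<dots> \<le> y * r + h" using elim(1) by (simp only: abs_diff_less_iff less_imp_le)
      finally show "real_of_int (altitude ms) / s N \<le> y * r + h" .
    qed simp
    have lo: "F N (y * r - h) \<le> p"
      unfolding p_def F_def
    proof (rule measure_pmf.finite_measure_mono, safe)
      fix ms assume "real_of_int (altitude ms) / s N \<le> y * r - h"
      also have "y * r - h < y * c N / s N" using elim(1) by (simp only: abs_diff_less_iff)
      finally show "real_of_int (altitude ms) < y * c N" using s by (simp add: divide_less_cancel)
    qed simp
    have "\<bar>Phi (y * r + h) - Phi (y * r)\<bar> < e / 2" "\<bar>Phi (y * r - h) - Phi (y * r)\<bar> < e / 2" using hPhi h by auto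
    then have "\<bar>p - Phi (y * r)\<bar> < e" using up lo elim(2,3) by linarith
    then show ?case by (simp add: p_def dist_real_def)
  qed
qed

lemma floor_divide_eq_iff: "k > 0 \<Longrightarrow> \<lfloor>x / k\<rfloor> = q \<longleftrightarrow> of_int q * k \<le> x \<and> x < of_int (q + 1) * (k::real)"
  by (simp add: floor_eq_iff field_simps)

text \<open>The mass that a centred normal law of variance \<open>\<tau>\<close> gives to the cell
  \<open>[q \<kappa>, (q + 1) \<kappa>)\<close>.\<close>

definition cell_prob :: "real \<Rightarrow> real \<Rightarrow> int \<Rightarrow> real" where
  "cell_prob \<kappa> \<tau> q = Phi (of_int (q + 1) * \<kappa> / sqrt \<tau>) - Phi (of_int q * \<kappa> / sqrt \<tau>)"

lemma prob_altitude_cell_tendsto: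
  fixes d :: nat and n :: "nat \<Rightarrow> nat" and c :: "nat \<Rightarrow> real"
  assumes n: "filterlim n at_top sequentially" and \<kappa>: "\<kappa> > 0" and c0: "eventually (\<lambda>N. c N > 0) sequentially"
    and c: "(\<lambda>N. c N / sqrt (real (n N) * (1 / (real d + 1)))) \<longlonglongrightarrow> 1 / sqrt \<tau>"
  shows "(\<lambda>N. measure_pmf.prob (rw d (n N)) {ms. \<lfloor>real_of_int (altitude ms) / (\<kappa> * c N)\<rfloor> = q}) \<longlonglongrightarrow> cell_prob \<kappa> \<tau> q"
proof -
  define L where "L y N = measure_pmf.prob (rw d (n N)) {ms. real_of_int (altitude ms) < y * c N}" for y N
  have "(\<lambda>N. L (of_int (q + 1) * \<kappa>) N - L (of_int q * \<kappa>) N) \<longlonglongrightarrow> cell_prob \<kappa> \<tau> q"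
    unfolding L_def cell_prob_def
    using prob_altitude_less_tendsto[OF n c, of "of_int (q + 1) * \<kappa>"] prob_altitude_less_tendsto[OF n c, of "of_int q * \<kappa>"]
    by (intro tendsto_diff) simp_all
  moreover have "eventually (\<lambda>N. L (of_int (q + 1) * \<kappa>) N - L (of_int q * \<kappa>) N
      = measure_pmf.prob (rw d (n N)) {ms. \<lfloor>real_of_int (altitude ms) / (\<kappa> * c N)\<rfloor> = q}) sequentially"
    using c0
  proof eventually_elim
    case (elim N)
    have kc: "\<kappa> * c N > 0" using \<kappa> elim by simp
    let ?A = "{ms. real_of_int (altitude ms) < (of_int (q + 1) * \<kappa>) * c N}" and ?B = "{ms. real_of_int (altitude ms) < (of_int q * \<kappa>) * c N}"
    have "(of_int q * \<kappa>) * c N \<le> (of_int (q + 1) * \<kappa>) * c N" using kc by (simp add: algebra_simps)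
    then have sub: "?B \<subseteq> ?A" by auto
    have "{ms. \<lfloor>real_of_int (altitude ms) / (\<kappa> * c N)\<rfloor> = q} = ?A - ?B"
      by (auto simp: floor_divide_eq_iff[OF kc] mult.assoc)
    then show ?case unfolding L_def
      by (simp only:) (rule measure_pmf.finite_measure_Diff[symmetric], use sub in auto)
  qed
  ultimately show ?thesis by (rule Lim_transform_eventually)
qed

lemma (in prob_space) prob_normal_cell:
  assumes X: "distributed M lborel X (normal_density 0 (sqrt \<tau>))" and \<tau>: "\<tau> > 0" and \<kappa>: "\<kappa> > 0"
  shows "prob (X -` {x. \<lfloor>x / \<kappa>\<rfloor> = q} \<inter> space M) = cell_prob \<kappa> \<tau> q"
proof -
  have s: "sqrt \<tau> > 0" using \<tau> by simp
  define Y where "Y \<omega> = (X \<omega> - 0) / sqrt \<tau>" for \<omega>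
  have Y: "distributed M lborel Y std_normal_density"
    unfolding Y_def using X normal_standard_normal_convert[OF s, of X 0] by simp
  have Ym: "Y \<in> measurable M lborel" using Y by (rule distributed_measurable)
  have dY: "distr M lborel Y = std_normal_distribution" using Y by (rule distributed_distr_eq_density)
  interpret N: real_distribution std_normal_distribution by (rule real_dist_normal_dist)
  let ?a = "of_int q * \<kappa> / sqrt \<tau>" and ?b = "of_int (q + 1) * \<kappa> / sqrt \<tau>"
  have ab: "?a \<le> ?b" using s \<kappa> by (intro divide_right_mono mult_right_mono) auto
  have less: "measure std_normal_distribution {..<x} = Phi x" for x
  proof -
    have "{..x} = {..<x} \<union> {x}" by auto
    then have "Phi x = measure std_normal_distribution {..<x} + measure std_normal_distribution {x}"
      unfolding cdf_def by (simp only:) (rule N.finite_measure_Union, auto)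
    then show ?thesis by (simp add: measure_std_normal_singleton)
  qed
  have "X -` {x. \<lfloor>x / \<kappa>\<rfloor> = q} \<inter> space M = Y -` ({..<?b} - {..<?a}) \<inter> space M"
  proof -
    have c: "z / sqrt \<tau> < y / sqrt \<tau> \<longleftrightarrow> z < y" for z y :: real using s by (simp add: divide_less_cancel)
    have "\<lfloor>x / \<kappa>\<rfloor> = q \<longleftrightarrow> (x - 0) / sqrt \<tau> < ?b \<and> \<not> (x - 0) / sqrt \<tau> < ?a" for x
      unfolding floor_divide_eq_iff[OF \<kappa>] by (simp only: diff_zero c not_less conj_commute)
    then show ?thesis
      by (intro set_eqI) (simp only: vimage_eq Int_iff mem_Collect_eq Diff_iff lessThan_iff Y_def)
  qed
  then have "prob (X -` {x. \<lfloor>x / \<kappa>\<rfloor> = q} \<inter> space M) = measure (distr M lborel Y) ({..<?b} - {..<?a})"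
    by (subst measure_distr[OF Ym]) (simp_all only: sets_lborel sets.Diff lessThan_borel)
  also have "\<dots> = measure std_normal_distribution {..<?b} - measure std_normal_distribution {..<?a}"
    unfolding dY using ab by (intro N.finite_measure_Diff) auto
  finally show ?thesis by (simp add: less cell_prob_def)
qed

text \<open>Rounding the increments to a grid gives a code with countably many values. Convergence
  in law then reduces to single codes, whose probabilities are products of cell probabilities by
  independence.\<close>

definition bm_code :: "(real \<Rightarrow> 'a \<Rightarrow> real) \<Rightarrow> real \<Rightarrow> real \<Rightarrow> nat \<Rightarrow> 'a \<Rightarrow> int list" where
  "bm_code B \<tau> \<kappa> m \<omega> = map (\<lambda>k. \<lfloor>(B (real (Suc k) * \<tau>) \<omega> - B (real k * \<tau>) \<omega>) / \<kappa>\<rfloor>) [0..<m]"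

definition rw_code :: "real \<Rightarrow> nat \<Rightarrow> nat \<Rightarrow> move list \<Rightarrow> int list" where
  "rw_code w n m ms = map (\<lambda>k. \<lfloor>real_of_int (incr n k ms) / w\<rfloor>) [0..<m]"

lemma prob_rw_code_eq:
  assumes "length q = m"
  shows "measure_pmf.prob (rw d (m * n)) {ms. rw_code w n m ms = q} =
    (\<Prod>k<m. measure_pmf.prob (rw d n) {ms. \<lfloor>real_of_int (altitude ms) / w\<rfloor> = q ! k})"
proof -
  have "{ms. rw_code w n m ms = q} = {ms. \<forall>k<m. incr n k ms \<in> {z. \<lfloor>real_of_int z / w\<rfloor> = q ! k}}"
    using assms by (auto simp: rw_code_def list_eq_iff_nth_eq)
  then show ?thesis
    using prob_incr_eq_prod[of m n d "\<lambda>k. {z. \<lfloor>real_of_int z / w\<rfloor> = q ! k}"] by simp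
qed

lemma prob_bm_code_eq:
  assumes BM: "std_BM M B" and \<tau>: "\<tau> > 0" and \<kappa>: "\<kappa> > 0" and q: "length q = m" and m: "m > 0"
  shows "measure M {\<omega> \<in> space M. bm_code B \<tau> \<kappa> m \<omega> = q} = (\<Prod>k<m. cell_prob \<kappa> \<tau> (q ! k))"
proof -
  interpret prob_space M using BM by (simp add: std_BM_def)
  define X where "X k \<omega> = B (real (Suc k) * \<tau>) \<omega> - B (real k * \<tau>) \<omega>" for k \<omega>
  define tt where "tt i = real i * \<tau>" for i :: nat
  have "strict_mono tt" using \<tau> by (auto simp: tt_def strict_mono_def)
  then have "indep_vars (\<lambda>_. borel) (\<lambda>i \<omega>. B (tt (Suc i)) \<omega> - B (tt i) \<omega>) {..<m}"
  proof -
    have "0 \<le> tt 0" by (simp add: tt_def)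
    with \<open>strict_mono tt\<close> BM show ?thesis unfolding std_BM_def by blast
  qed
  then have ind: "indep_vars (\<lambda>_. borel) X {..<m}" by (simp add: X_def[abs_def] tt_def)
  have dist: "distributed M lborel (X k) (normal_density 0 (sqrt \<tau>))" for k
  proof -
    have "0 \<le> real k * \<tau>" "real k * \<tau> < real (Suc k) * \<tau>" using \<tau> by auto
    then have "distributed M lborel (\<lambda>\<omega>. B (real (Suc k) * \<tau>) \<omega> - B (real k * \<tau>) \<omega>) (normal_density 0 (sqrt (real (Suc k) * \<tau> - real k * \<tau>)))"
      using BM unfolding std_BM_def by blast
    moreover have "real (Suc k) * \<tau> - real k * \<tau> = \<tau>" by (simp add: algebra_simps)
    ultimately show ?thesis by (simp add: X_def[abs_def])
  qed
  have "{\<omega> \<in> space M. bm_code B \<tau> \<kappa> m \<omega> = q} = (\<Inter>k\<in>{..<m}. X k -` {x. \<lfloor>x / \<kappa>\<rfloor> = q ! k} \<inter> space M)"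
    using q m by (auto simp: bm_code_def list_eq_iff_nth_eq X_def)
  also have "prob \<dots> = (\<Prod>k<m. prob (X k -` {x. \<lfloor>x / \<kappa>\<rfloor> = q ! k} \<inter> space M))"
    using m by (intro indep_varsD_finite[OF ind]) auto
  also have "\<dots> = (\<Prod>k<m. cell_prob \<kappa> \<tau> (q ! k))"
    by (intro prod.cong refl prob_normal_cell[OF dist \<tau> \<kappa>])
  finally show ?thesis .
qed

lemma bm_code_measurable:
  assumes BM: "std_BM M B"
  shows "bm_code B \<tau> \<kappa> m \<in> measurable M (count_space UNIV)"
proof -
  have [measurable]: "B t \<in> borel_measurable M" for t using BM by (simp add: std_BM_def)
  have s: "{\<omega> \<in> space M. bm_code B \<tau> \<kappa> m \<omega> = q} \<in> sets M" for q
  proof (cases "length q = m")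
    case True
    then have "{\<omega> \<in> space M. bm_code B \<tau> \<kappa> m \<omega> = q} =
       {\<omega> \<in> space M. \<forall>k<m. \<lfloor>(B (real (Suc k) * \<tau>) \<omega> - B (real k * \<tau>) \<omega>) / \<kappa>\<rfloor> = q ! k}"
      by (auto simp: bm_code_def list_eq_iff_nth_eq)
    also have "\<dots> \<in> sets M" by measurable
    finally show ?thesis .
  next
    case False
    then have "{\<omega> \<in> space M. bm_code B \<tau> \<kappa> m \<omega> = q} = {}" by (auto simp: bm_code_def)
    then show ?thesis by (simp only: sets.empty_sets)
  qed
  show ?thesis
    by (subst measurable_count_space_eq_countable) (use s in \<open>auto simp: vimage_def Int_def conj_commute\<close>)
qed

text \<open>Finite-dimensional convergence, in the one-sided form that survives passing from single codes
  to an infinite set of codes.\<close>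

lemma eventually_prob_rw_code_ge:
  fixes d :: nat and n :: "nat \<Rightarrow> nat" and c :: "nat \<Rightarrow> real"
  assumes BM: "std_BM M B" and \<tau>: "\<tau> > 0" and \<kappa>: "\<kappa> > 0" and m: "m > 0"
    and n: "filterlim n at_top sequentially" and c0: "eventually (\<lambda>N. c N > 0) sequentially"
    and c: "(\<lambda>N. c N / sqrt (real (n N) * (1 / (real d + 1)))) \<longlonglongrightarrow> 1 / sqrt \<tau>"
    and e: "e > 0"
  shows "eventually (\<lambda>N. measure_pmf.prob (rw d (m * n N)) {ms. rw_code (\<kappa> * c N) (n N) m ms \<in> G}
     \<ge> measure M {\<omega> \<in> space M. bm_code B \<tau> \<kappa> m \<omega> \<in> G} - e) sequentially"
proof -
  interpret prob_space M using BM by (simp add: std_BM_def)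
  note meas = bm_code_measurable[OF BM, of \<tau> \<kappa> m]
  have sets: "{\<omega> \<in> space M. bm_code B \<tau> \<kappa> m \<omega> \<in> H} \<in> sets M" for H
    using measurable_sets[OF meas, of H] by (simp add: vimage_def Int_def conj_commute)
  \<comment> \<open>Finitely many codes carry all but \<open>e / 2\<close> of the Brownian mass of
    \<open>G\<close>; for these the convergence of probabilities can be summed.\<close>
  define Gk where "Gk k = {q \<in> G. length q = m \<and> to_nat q < k}" for k :: nat
  have fin: "finite (Gk k)" for k
  proof -
    have "to_nat ` Gk k \<subseteq> {..<k}" by (auto simp: Gk_def)
    then have "finite (to_nat ` Gk k)" by (rule finite_subset) simp
    then show ?thesis by (rule finite_imageD) (auto intro: inj_on_subset[OF inj_to_nat])
  qed
  have "(\<lambda>k. prob {\<omega> \<in> space M. bm_code B \<tau> \<kappa> m \<omega> \<in> Gk k}) \<longlonglongrightarrow> prob (\<Union>k. {\<omega> \<in> space M. bm_code B \<tau> \<kappa> m \<omega> \<in> Gk k})"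
  proof (rule finite_Lim_measure_incseq)
    show "range (\<lambda>k. {\<omega> \<in> space M. bm_code B \<tau> \<kappa> m \<omega> \<in> Gk k}) \<subseteq> events" using sets by blast
    show "incseq (\<lambda>k. {\<omega> \<in> space M. bm_code B \<tau> \<kappa> m \<omega> \<in> Gk k})" by (auto simp: incseq_def Gk_def)
  qed
  moreover have "(\<Union>k. {\<omega> \<in> space M. bm_code B \<tau> \<kappa> m \<omega> \<in> Gk k}) = {\<omega> \<in> space M. bm_code B \<tau> \<kappa> m \<omega> \<in> G}"
    by (auto simp: Gk_def bm_code_def)
  ultimately have "eventually (\<lambda>k. prob {\<omega> \<in> space M. bm_code B \<tau> \<kappa> m \<omega> \<in> Gk k} > prob {\<omega> \<in> space M. bm_code B \<tau> \<kappa> m \<omega> \<in> G} - e / 2) sequentially"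
    using e by (intro order_tendstoD(1)) auto
  then obtain k where k: "prob {\<omega> \<in> space M. bm_code B \<tau> \<kappa> m \<omega> \<in> Gk k} > prob {\<omega> \<in> space M. bm_code B \<tau> \<kappa> m \<omega> \<in> G} - e / 2"
    by (meson eventually_happens trivial_limit_sequentially)
  have len: "length q = m" if "q \<in> Gk k" for q using that by (simp add: Gk_def)
  have bm: "prob {\<omega> \<in> space M. bm_code B \<tau> \<kappa> m \<omega> \<in> Gk k} = (\<Sum>q\<in>Gk k. \<Prod>i<m. cell_prob \<kappa> \<tau> (q ! i))"
  proof -
    have "{\<omega> \<in> space M. bm_code B \<tau> \<kappa> m \<omega> \<in> Gk k} = (\<Union>q\<in>Gk k. {\<omega> \<in> space M. bm_code B \<tau> \<kappa> m \<omega> = q})" by auto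
    also have "prob \<dots> = (\<Sum>q\<in>Gk k. prob {\<omega> \<in> space M. bm_code B \<tau> \<kappa> m \<omega> = q})"
      using sets[of "{_}"] by (intro finite_measure_finite_Union) (auto simp: fin disjoint_family_on_def)
    also have "\<dots> = (\<Sum>q\<in>Gk k. \<Prod>i<m. cell_prob \<kappa> \<tau> (q ! i))"
      by (intro sum.cong refl prob_bm_code_eq[OF BM \<tau> \<kappa> len m])
    finally show ?thesis .
  qed
  have "(\<lambda>N. \<Sum>q\<in>Gk k. \<Prod>i<m. measure_pmf.prob (rw d (n N)) {ms. \<lfloor>real_of_int (altitude ms) / (\<kappa> * c N)\<rfloor> = q ! i})
      \<longlonglongrightarrow> (\<Sum>q\<in>Gk k. \<Prod>i<m. cell_prob \<kappa> \<tau> (q ! i))"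
    by (intro tendsto_sum tendsto_prod prob_altitude_cell_tendsto[OF n \<kappa> c0 c])
  then have "eventually (\<lambda>N. (\<Sum>q\<in>Gk k. \<Prod>i<m. measure_pmf.prob (rw d (n N)) {ms. \<lfloor>real_of_int (altitude ms) / (\<kappa> * c N)\<rfloor> = q ! i})
     > (\<Sum>q\<in>Gk k. \<Prod>i<m. cell_prob \<kappa> \<tau> (q ! i)) - e / 2) sequentially"
    using e by (intro order_tendstoD(1)) auto
  then show ?thesis
  proof eventually_elim
    case (elim N)
    let ?P = "measure_pmf.prob (rw d (m * n N))"
    have "(\<Sum>q\<in>Gk k. \<Prod>i<m. measure_pmf.prob (rw d (n N)) {ms. \<lfloor>real_of_int (altitude ms) / (\<kappa> * c N)\<rfloor> = q ! i})
       = (\<Sum>q\<in>Gk k. ?P {ms. rw_code (\<kappa> * c N) (n N) m ms = q})"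
      by (intro sum.cong refl prob_rw_code_eq[symmetric] len)
    also have "\<dots> = ?P (\<Union>q\<in>Gk k. {ms. rw_code (\<kappa> * c N) (n N) m ms = q})"
      by (intro measure_pmf.finite_measure_finite_Union[symmetric]) (auto simp: fin disjoint_family_on_def)
    also have "\<dots> \<le> ?P {ms. rw_code (\<kappa> * c N) (n N) m ms \<in> G}"
      by (intro measure_pmf.finite_measure_mono) (auto simp: Gk_def)
    finally show ?case using elim bm k by linarith
  qed
qed

text \<open>A discrete stand-in for a bound on the local times at all levels at once: the partial
  sums of a code, scaled by \<open>\<kappa>\<close>, are the reconstructed positions at the block
  ends.\<close>

definition sparse_codes :: "real \<Rightarrow> real \<Rightarrow> nat \<Rightarrow> real \<Rightarrow> int list set" where
  "sparse_codes \<kappa> b m y =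
     {q. \<forall>c. real (card {k. k < m \<and> \<bar>\<kappa> * real_of_int (sum_list (take k q)) - c\<bar> \<le> b}) \<le> y}"

lemma local_time_less_of_zeta_greater:
  assumes "zeta L \<omega> u > ereal \<gamma>" "\<gamma> \<ge> 0"
  shows "L a \<gamma> \<omega> < u"
proof (rule ccontr)
  assume "\<not> L a \<gamma> \<omega> < u"
  then have "ereal u \<le> ereal (L a \<gamma> \<omega>)" by simp
  also have "\<dots> \<le> (SUP a. ereal (L a \<gamma> \<omega>))" by (rule SUP_upper) simp
  finally have "ereal \<gamma> \<in> {ereal t | t. 0 \<le> t \<and> (SUP a. ereal (L a t \<omega>)) \<ge> ereal u}" using assms(2) by blast
  then have "zeta L \<omega> u \<le> ereal \<gamma>" unfolding zeta_def by (rule Inf_lower)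
  then show False using assms(1) by simp
qed

text \<open>The occupation formula on an interval of length \<open>2 * h\<close>. By continuity the
  times spent there form a closed set, so its measure makes sense and dominates that of
  \<open>U\<close>.\<close>

lemma occupation_time_le:
  assumes BM: "std_BM M B" and LT: "local_time M B L" and \<omega>: "\<omega> \<in> space M" and \<gamma>: "\<gamma> > 0" and h: "h > 0"
    and u: "\<And>a. L a \<gamma> \<omega> \<le> u"
    and U: "U \<in> sets lborel" "U \<subseteq> {0<..<\<gamma>}" "\<And>s. s \<in> U \<Longrightarrow> \<bar>B s \<omega> - c\<bar> \<le> h"
  shows "measure lborel U \<le> u * (2 * h)"
proof -
  define A where "A = {c - h..c + h}"
  have A: "A \<in> sets borel" by (simp add: A_def)
  have int: "set_integrable lborel A (\<lambda>a. L a \<gamma> \<omega>)"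
    and eq: "(LBINT s=0..\<gamma>. indicator A (B s \<omega>)) = set_lebesgue_integral lborel A (\<lambda>a. L a \<gamma> \<omega>)"
    using LT \<omega> \<gamma> A unfolding local_time_def by (auto simp: less_imp_le)
  have cont: "continuous_on {0..} (\<lambda>t. B t \<omega>)" using BM \<omega> by (simp add: std_BM_def)
  define V where "V = {s \<in> {0..\<gamma>}. B s \<omega> \<in> A}"
  have "closed ({0..\<gamma>} \<inter> (\<lambda>t. B t \<omega>) -` A)"
    using cont by (intro continuous_closed_preimage) (auto simp: A_def intro: continuous_on_subset)
  moreover have "V = {0..\<gamma>} \<inter> (\<lambda>t. B t \<omega>) -` A" by (auto simp: V_def)
  ultimately have "closed V" by simp
  then have V: "V \<in> sets lborel" by (simp add: borel_closed)
  have fin: "emeasure lborel {0..\<gamma>} < \<infinity>" using \<gamma> by (simp add: emeasure_lborel_Icc less_imp_le)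
  have "measure lborel U \<le> measure lborel (V \<inter> {0<..<\<gamma>})"
  proof (rule measure_mono_fmeasurable)
    show "U \<subseteq> V \<inter> {0<..<\<gamma>}" using U(2,3) by (fastforce simp: V_def A_def abs_le_iff)
    have "emeasure lborel (V \<inter> {0<..<\<gamma>}) \<le> emeasure lborel {0..\<gamma>}"
      by (intro emeasure_mono) (auto simp: V_def)
    then show "V \<inter> {0<..<\<gamma>} \<in> fmeasurable lborel" using V fin by (intro fmeasurableI) (auto intro: le_less_trans)
  qed (use U in auto)
  also have "\<dots> = (LBINT s=0..\<gamma>. indicator A (B s \<omega>))"
  proof -
    have "(LBINT s=0..\<gamma>. indicator A (B s \<omega>) :: real) = (LINT s|lborel. indicator {0<..<\<gamma>} s *\<^sub>R indicator A (B s \<omega>))"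
      using \<gamma> by (simp add: interval_lebesgue_integral_def set_lebesgue_integral_def einterval_def zero_ereal_def)
        (intro Bochner_Integration.integral_cong; auto simp: indicator_def)
    also have "\<dots> = (LINT s|lborel. indicator (V \<inter> {0<..<\<gamma>}) s)"
      by (intro Bochner_Integration.integral_cong) (auto simp: indicator_def V_def)
    also have "\<dots> = measure lborel (V \<inter> {0<..<\<gamma>})" by simp
    finally show ?thesis by simp
  qed
  also have "\<dots> = set_lebesgue_integral lborel A (\<lambda>a. L a \<gamma> \<omega>)" by (rule eq)
  also have "\<dots> \<le> set_lebesgue_integral lborel A (\<lambda>a. u)"
  proof (rule set_integral_mono[OF int])
    have "integrable lborel (indicator {c - h..c + h} :: real \<Rightarrow> real)"
      using h by (intro integrable_real_indicator) (auto simp: emeasure_lborel_Icc)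
    then show "set_integrable lborel A (\<lambda>a. u)" by (simp add: set_integrable_def A_def)
  qed (rule u)
  also have "\<dots> = u * (2 * h)" using h by (simp add: A_def set_integral_const)
  finally show ?thesis .
qed

text \<open>Uniform continuity on \<open>[0, \<gamma>]\<close>: for a fine mesh the path moves by
  less than \<open>b / 4\<close> within a block, and all rounding errors together are at most
  \<open>m * \<kappa> = b / 4\<close>. A block whose reconstructed start is within \<open>b\<close>
  of \<open>c\<close> thus stays within \<open>3 * b / 2\<close>, and the occupation of that window
  is at most \<open>3 * u * b\<close>. The threshold \<open>m0\<close> depends on
  \<open>\<omega>\<close>.\<close>

lemma bm_code_eventually_sparse:
  assumes BM: "std_BM M B" and LT: "local_time M B L" and \<omega>: "\<omega> \<in> space M" and \<gamma>: "\<gamma> > 0" and b: "b > 0"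
    and z: "zeta L \<omega> u > ereal \<gamma>"
  shows "\<exists>m0. \<forall>m\<ge>m0. m > 0 \<longrightarrow>
     bm_code B (\<gamma> / real m) (b / (4 * real m)) m \<omega> \<in> sparse_codes (b / (4 * real m)) b m (3 * u * b * real m / \<gamma>)"
proof -
  have Lu: "L a \<gamma> \<omega> \<le> u" for a using local_time_less_of_zeta_greater[OF z] \<gamma> by (simp add: less_imp_le)
  have cont: "continuous_on {0..} (\<lambda>t. B t \<omega>)" and B0: "B 0 \<omega> = 0" using BM \<omega> by (auto simp: std_BM_def)
  have "uniformly_continuous_on {0..\<gamma>} (\<lambda>t. B t \<omega>)"
    using cont by (intro compact_uniformly_continuous) (auto intro: continuous_on_subset)
  then obtain \<delta> where \<delta>: "\<delta> > 0" and uc: "\<And>s t. s \<in> {0..\<gamma>} \<Longrightarrow> t \<in> {0..\<gamma>} \<Longrightarrow> \<bar>s - t\<bar> < \<delta> \<Longrightarrow> \<bar>B s \<omega> - B t \<omega>\<bar> < b / 4"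
    unfolding uniformly_continuous_on_def dist_real_def using b by (metis divide_pos_pos zero_less_numeral)
  obtain m0 :: nat where m0: "real m0 > \<gamma> / \<delta>" using reals_Archimedean2 by blast
  show ?thesis
  proof (intro exI[of _ m0] allI impI)
    fix m :: nat assume m: "m \<ge> m0" "m > 0"
    define \<tau> where "\<tau> = \<gamma> / real m"
    define \<kappa> where "\<kappa> = b / (4 * real m)"
    have \<tau>: "\<tau> > 0" "real m * \<tau> = \<gamma>" using \<gamma> m by (auto simp: \<tau>_def)
    have "\<gamma> / \<delta> < real m" using m0 m by linarith
    then have \<tau>\<delta>: "\<tau> < \<delta>" using \<delta> m by (simp add: \<tau>_def field_simps)
    have \<kappa>: "\<kappa> > 0" "real m * \<kappa> = b / 4" using b m by (auto simp: \<kappa>_def)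
    define q where "q = bm_code B \<tau> \<kappa> m \<omega>"
    have near: "\<bar>B (real k * \<tau>) \<omega> - \<kappa> * real_of_int (sum_list (take k q))\<bar> \<le> b / 4" if k: "k \<le> m" for k
    proof -
      have tk: "take k q = map (\<lambda>i. \<lfloor>(B (real (Suc i) * \<tau>) \<omega> - B (real i * \<tau>) \<omega>) / \<kappa>\<rfloor>) [0..<k]"
        using k by (simp add: q_def bm_code_def take_map)
      have "B (real k * \<tau>) \<omega> - \<kappa> * real_of_int (sum_list (take k q)) =
        (\<Sum>i<k. (B (real (Suc i) * \<tau>) \<omega> - B (real i * \<tau>) \<omega>) - \<kappa> * \<lfloor>(B (real (Suc i) * \<tau>) \<omega> - B (real i * \<tau>) \<omega>) / \<kappa>\<rfloor>)"
      proof -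
        have "(\<Sum>i<k. B (real (Suc i) * \<tau>) \<omega> - B (real i * \<tau>) \<omega>) = B (real k * \<tau>) \<omega>"
          using sum_lessThan_telescope[of "\<lambda>i. B (real i * \<tau>) \<omega>" k] B0 by simp
        then show ?thesis
          unfolding tk sum_subtractf by (simp add: interv_sum_list_conv_sum_set_nat atLeast0LessThan sum_distrib_left)
      qed
      also have "\<bar>\<dots>\<bar> \<le> (\<Sum>i<k. \<kappa>)"
      proof (rule order_trans[OF sum_abs], rule sum_mono)
        fix i
        define x where "x = B (real (Suc i) * \<tau>) \<omega> - B (real i * \<tau>) \<omega>"
        have "of_int \<lfloor>x / \<kappa>\<rfloor> * \<kappa> \<le> x" "x < of_int (\<lfloor>x / \<kappa>\<rfloor> + 1) * \<kappa>" using floor_divide_eq_iff[OF \<kappa>(1), of x "\<lfloor>x / \<kappa>\<rfloor>"] by auto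
        then show "\<bar>B (real (Suc i) * \<tau>) \<omega> - B (real i * \<tau>) \<omega> - \<kappa> * \<lfloor>(B (real (Suc i) * \<tau>) \<omega> - B (real i * \<tau>) \<omega>) / \<kappa>\<rfloor>\<bar> \<le> \<kappa>"
          unfolding x_def[symmetric] by (simp add: algebra_simps)
      qed
      also have "\<dots> = real k * \<kappa>" by simp
      also have "\<dots> \<le> real m * \<kappa>" using k \<kappa> by (intro mult_right_mono) auto
      finally show ?thesis using \<kappa> by simp
    qed
    have "real (card {k. k < m \<and> \<bar>\<kappa> * real_of_int (sum_list (take k q)) - c\<bar> \<le> b}) \<le> 3 * u * b * real m / \<gamma>" for c
    proof -
      define K where "K = {k. k < m \<and> \<bar>\<kappa> * real_of_int (sum_list (take k q)) - c\<bar> \<le> b}"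
      define I where "I k = {real k * \<tau><..<real (Suc k) * \<tau>}" for k :: nat
      have fK: "finite K" by (simp add: K_def)
      have Ik: "measure lborel (I k) = \<tau>" for k
        using \<tau> by (simp add: I_def algebra_simps)
      have bounds: "0 \<le> real k * \<tau>" "real (Suc k) * \<tau> \<le> \<gamma>" if "k < m" for k
      proof -
        have "real (Suc k) * \<tau> \<le> real m * \<tau>" using that \<tau> by (intro mult_right_mono) auto
        then show "real (Suc k) * \<tau> \<le> \<gamma>" using \<tau> by simp
      qed (use \<tau> in simp)
      have dj: "disjoint_family_on I K"
      proof -
        have "I k \<inter> I l = {}" if "k < l" for k l
        proof -
          have "real (Suc k) * \<tau> \<le> real l * \<tau>" using that \<tau> by (intro mult_right_mono) auto
          then show ?thesis by (auto simp: I_def)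
        qed
        then show ?thesis unfolding disjoint_family_on_def by (metis inf_commute nat_neq_iff)
      qed
      have "emeasure lborel (I k) \<noteq> \<infinity>" "I k \<in> sets lborel" for k using \<tau> by (simp_all add: I_def algebra_simps)
      then have "measure lborel (\<Union>k\<in>K. I k) = (\<Sum>k\<in>K. measure lborel (I k))"
        by (intro measure_finite_Union fK dj) auto
      then have "real (card K) * \<tau> = measure lborel (\<Union>k\<in>K. I k)" by (simp add: Ik)
      also have "\<dots> \<le> u * (2 * (3 * b / 2))"
      proof (rule occupation_time_le[OF BM LT \<omega> \<gamma> _ Lu])
        show "(\<Union>k\<in>K. I k) \<in> sets lborel" using fK by (auto simp: I_def)
        show "(\<Union>k\<in>K. I k) \<subseteq> {0<..<\<gamma>}"
        proof
          fix s assume "s \<in> (\<Union>k\<in>K. I k)"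
          then obtain k where "k < m" "s \<in> I k" by (auto simp: K_def)
          then show "s \<in> {0<..<\<gamma>}" using bounds[of k] by (auto simp: I_def)
        qed
        fix s assume "s \<in> (\<Union>k\<in>K. I k)"
        then obtain k where k: "k \<in> K" "k < m" "s \<in> I k" by (auto simp: K_def)
        have "\<bar>s - real k * \<tau>\<bar> < \<delta>" using k(3) \<tau>\<delta> by (auto simp: I_def algebra_simps)
        moreover have "s \<in> {0..\<gamma>}" "real k * \<tau> \<in> {0..\<gamma>}" using bounds[OF k(2)] k(3) by (auto simp: I_def)
        ultimately have "\<bar>B s \<omega> - B (real k * \<tau>) \<omega>\<bar> < b / 4" by (intro uc)
        moreover have "\<bar>B (real k * \<tau>) \<omega> - \<kappa> * real_of_int (sum_list (take k q))\<bar> \<le> b / 4" using k by (intro near) auto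
        moreover have "\<bar>\<kappa> * real_of_int (sum_list (take k q)) - c\<bar> \<le> b" using k by (simp add: K_def)
        ultimately show "\<bar>B s \<omega> - c\<bar> \<le> 3 * b / 2" by linarith
      qed (use b in auto)
      finally have "real (card K) * \<tau> \<le> 3 * u * b" by simp
      then have "real (card K) \<le> 3 * u * b / \<tau>" using \<tau> by (simp add: field_simps)
      then show ?thesis by (simp add: K_def \<tau>_def)
    qed
    then show "bm_code B (\<gamma> / real m) (b / (4 * real m)) m \<omega> \<in> sparse_codes (b / (4 * real m)) b m (3 * u * b * real m / \<gamma>)"
      unfolding sparse_codes_def q_def \<tau>_def[symmetric] \<kappa>_def[symmetric] by simp
  qed
qed

text \<open>A non-measurable event has \<open>measure\<close> zero, so no measurability assumption is needed.\<close>

lemma measure_zeta_le_bm_code: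
  assumes BM: "std_BM M B" and LT: "local_time M B L" and \<gamma>: "\<gamma> > 0" and b: "b > 0" and e: "e > 0"
  shows "\<exists>m1. \<forall>m\<ge>m1. m > 0 \<longrightarrow> measure M {\<omega> \<in> space M. zeta L \<omega> u > ereal \<gamma>} \<le>
    measure M {\<omega> \<in> space M. bm_code B (\<gamma> / real m) (b / (4 * real m)) m \<omega> \<in> sparse_codes (b / (4 * real m)) b m (3 * u * b * real m / \<gamma>)} + e"
proof -
  interpret prob_space M using BM by (simp add: std_BM_def)
  let ?Z = "{\<omega> \<in> space M. zeta L \<omega> u > ereal \<gamma>}"
  define G where "G m = {\<omega> \<in> space M. bm_code B (\<gamma> / real m) (b / (4 * real m)) m \<omega> \<in> sparse_codes (b / (4 * real m)) b m (3 * u * b * real m / \<gamma>)}" for m :: nat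
  have Gs: "G m \<in> events" for m
    using measurable_sets[OF bm_code_measurable[OF BM, of "\<gamma> / real m" "b / (4 * real m)" m], of "sparse_codes (b / (4 * real m)) b m (3 * u * b * real m / \<gamma>)"]
    by (simp add: G_def vimage_def Int_def conj_commute)
  \<comment> \<open>The events that the threshold of the path is at most \<open>m0\<close>, up to a
    shift by one; they increase and cover the event in question. Continuity from below makes the
    random threshold deterministic at the cost of \<open>e\<close>.\<close>
  define H where "H m0 = (\<Inter>m\<in>{Suc m0..}. G m)" for m0
  have Hs: "H m0 \<in> events" for m0 unfolding H_def using Gs by (intro sets.countable_INT) auto
  have "(\<lambda>m0. prob (H m0)) \<longlonglongrightarrow> prob (\<Union>m0. H m0)"
  proof (rule finite_Lim_measure_incseq)
    show "range H \<subseteq> events" using Hs by blast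
    show "incseq H" by (rule incseq_SucI) (auto simp: H_def)
  qed
  then have "eventually (\<lambda>m0. prob (H m0) > prob (\<Union>m0. H m0) - e) sequentially"
    using e by (intro order_tendstoD(1)) auto
  then obtain m0 where m0: "prob (H m0) > prob (\<Union>m0. H m0) - e"
    by (meson eventually_happens trivial_limit_sequentially)
  have "prob ?Z \<le> prob (\<Union>m0. H m0)"
  proof (rule finite_measure_mono)
    show "?Z \<subseteq> (\<Union>m0. H m0)"
    proof
      fix \<omega> assume "\<omega> \<in> ?Z"
      then have w: "\<omega> \<in> space M" "zeta L \<omega> u > ereal \<gamma>" by auto
      obtain m0 where "\<forall>m\<ge>m0. m > 0 \<longrightarrow>
         bm_code B (\<gamma> / real m) (b / (4 * real m)) m \<omega> \<in> sparse_codes (b / (4 * real m)) b m (3 * u * b * real m / \<gamma>)"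
        using bm_code_eventually_sparse[OF BM LT w(1) \<gamma> b w(2)] by blast
      then have "\<omega> \<in> H m0" using w(1) by (auto simp: H_def G_def)
      then show "\<omega> \<in> (\<Union>m0. H m0)" by blast
    qed
    show "(\<Union>m0. H m0) \<in> events" using Hs by blast
  qed
  then have le: "prob ?Z \<le> prob (H m0) + e" using m0 by linarith
  show ?thesis
  proof (intro exI[of _ "Suc m0"] allI impI)
    fix m assume "m \<ge> Suc m0"
    then have "H m0 \<subseteq> G m" by (auto simp: H_def)
    then have "prob (H m0) \<le> prob (G m)" using Gs by (intro finite_measure_mono) auto
    then show "measure M ?Z \<le> measure M {\<omega> \<in> space M. bm_code B (\<gamma> / real m) (b / (4 * real m)) m \<omega> \<in> sparse_codes (b / (4 * real m)) b m (3 * u * b * real m / \<gamma>)} + e"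
      using le by (simp add: G_def)
  qed
qed

section \<open>The disconnection time\<close>

text \<open>Disconnection by time \<open>T\<close> read off from the first \<open>T\<close> moves,
  which is the form of event that the estimates on lists can handle.\<close>

definition disc_by :: "nat \<Rightarrow> nat \<Rightarrow> nat \<Rightarrow> (nat \<Rightarrow> int) \<Rightarrow> move list \<Rightarrow> bool" where
  "disc_by N d T x ms \<longleftrightarrow> (\<exists>n\<le>T. disconnects N d ((\<lambda>k. pos N (x, 0) (take k ms)) ` {0..n}))"

lemma walk_pos_eq_pos: "walk_pos N \<omega> n = pos N (fst \<omega>, 0) (stake n (snd \<omega>))"
proof (induction n)
  case (Suc n)
  have "stake (Suc n) (snd \<omega>) = stake n (snd \<omega>) @ [snd \<omega> !! n]" by (rule stake_Suc)
  then show ?case using Suc by (simp add: pos_def)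
qed simp

lemma disc_by_stake:
  "disc_by N d T (fst \<omega>) (stake T (snd \<omega>)) \<longleftrightarrow> (\<exists>n\<le>T. disconnects N d (walk_pos N \<omega> ` {0..n}))"
proof -
  have "(\<lambda>k. pos N (fst \<omega>, 0) (take k (stake T (snd \<omega>)))) ` {0..n} = walk_pos N \<omega> ` {0..n}" if "n \<le> T" for n
    using that by (intro image_cong refl) (auto simp: walk_pos_eq_pos take_stake min_def)
  then show ?thesis unfolding disc_by_def by auto
qed

lemma disc_time_le_imp_disc_by:
  assumes "disc_time N d \<omega> \<le> enat T"
  shows "disc_by N d T (fst \<omega>) (stake T (snd \<omega>))"
proof -
  have ex: "\<exists>n. disconnects N d (walk_pos N \<omega> ` {0..n})"
    using assms by (auto simp: disc_time_def split: if_splits)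
  define n where "n = (LEAST n. disconnects N d (walk_pos N \<omega> ` {0..n}))"
  have "disconnects N d (walk_pos N \<omega> ` {0..n})" unfolding n_def using ex by (rule LeastI_ex)
  moreover have "n \<le> T" using assms ex by (simp add: disc_time_def n_def)
  ultimately show ?thesis unfolding disc_by_stake by blast
qed

lemma measure_disc_by_le:
  assumes "N \<ge> 1" "\<And>x. x \<in> torus N d \<Longrightarrow> measure_pmf.prob (rw d T) {ms. disc_by N d T x ms} \<le> c"
  shows "measure (walk_space N d) {\<omega>. disc_by N d T (fst \<omega>) (stake T (snd \<omega>))} \<le> c"
  by (rule measure_walk_space_stake_le[OF torus_finite_nonempty[OF assms(1)] assms(2)])

lemma exists_dyadic_scale:
  fixes y :: real
  assumes "y \<ge> 1"
  obtains t :: nat where "2^t \<le> y" "y < 2 * 2^t"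
proof -
  have "nat \<lfloor>y\<rfloor> \<ge> 1" using assms by (simp add: le_nat_floor)
  then obtain t where t: "2^t \<le> nat \<lfloor>y\<rfloor>" "nat \<lfloor>y\<rfloor> < 2^(t+1)" using ex_power_ivl1[of 2 "nat \<lfloor>y\<rfloor>"] by auto
  have fl: "real (nat \<lfloor>y\<rfloor>) \<le> y" "y < real (nat \<lfloor>y\<rfloor>) + 1" using assms by linarith+
  have "real (2^t) \<le> real (nat \<lfloor>y\<rfloor>)" "real (nat \<lfloor>y\<rfloor> + 1) \<le> real (2^(t+1))"
    using t by (simp_all only: of_nat_le_iff)
  then have "2^t \<le> real (nat \<lfloor>y\<rfloor>)" "real (nat \<lfloor>y\<rfloor>) + 1 \<le> 2 * 2^t" by (simp_all only: of_nat_power of_nat_numeral of_nat_add of_nat_1 of_nat_mult power_add power_one_right mult.commute)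
  then show ?thesis using fl by (intro that[of t]) linarith+
qed

text \<open>\<open>v2\<close> is fixed before \<open>\<Gamma>\<close> and \<open>e\<close>, and only
  \<open>\<delta>\<close> depends on these; this makes the final \<open>v0\<close> independent of
  \<open>\<gamma>\<close>. Three events of probability at most \<open>e / 3\<close> are discarded: a
  large vertical range, a failure of the cascade from scale \<open>2^t\<close> down to single
  levels, and disconnection although all levels are thin.\<close>

lemma prob_disc_by_le_dense:
  fixes d :: nat
  assumes d: "d \<ge> 2"
  obtains v2 :: real where "v2 > 0"
    "\<And>\<Gamma> e. \<Gamma> > 0 \<Longrightarrow> e > 0 \<Longrightarrow> \<exists>\<delta>>0. \<exists>N1. \<forall>N\<ge>N1. \<exists>t. 2^t \<le> \<delta> * real N ^ d \<and> \<delta> * real N ^ d < 2 * 2^t \<and>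
       (\<forall>T. real T \<le> \<Gamma> * real N ^ (2*d) \<longrightarrow> (\<forall>x. measure_pmf.prob (rw d T) {ms. disc_by N d T x ms} \<le>
          measure_pmf.prob (rw d T) {ms. \<exists>a. dens t a ms > v2 * real N ^ d} + e))"
proof -
  obtain v1 N0 where v1: "v1 > 0" and N0: "N0 \<ge> 1" and thin:
    "\<And>\<gamma>. \<gamma> > 0 \<Longrightarrow> \<exists>K. \<forall>N\<ge>N0. \<forall>T. real T \<le> \<gamma> * real N ^ (2*d) \<longrightarrow> (\<forall>x.
      measure_pmf.prob (rw d T) {ms. (\<exists>n\<le>T. disconnects N d ((\<lambda>k. pos N (x, 0) (take k ms)) ` {0..n})) \<and>
         (\<forall>z. real (occ {z} ms) \<le> v1 * real N ^ d)} \<le> K / sqrt (real N))"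
    by (rule prob_disconnect_thin_le[OF d]) (rule that)
  define v2 where "v2 = v1 / 108"
  have v2: "v2 > 0" using v1 by (simp add: v2_def)
  show ?thesis
  proof (rule that[OF v2])
    fix \<Gamma> e :: real assume G: "\<Gamma> > 0" and e: "e > 0"
    obtain K where K: "\<forall>N\<ge>N0. \<forall>T. real T \<le> \<Gamma> * real N ^ (2*d) \<longrightarrow> (\<forall>x.
      measure_pmf.prob (rw d T) {ms. (\<exists>n\<le>T. disconnects N d ((\<lambda>k. pos N (x, 0) (take k ms)) ` {0..n})) \<and>
         (\<forall>z. real (occ {z} ms) \<le> v1 * real N ^ d)} \<le> K / sqrt (real N))" using thin[OF G] by blast
    \<comment> \<open>The maximal inequality bounds the probability of leaving the range
      \<open>J * n\<close> by \<open>\<Gamma> / J^2 = e / 3\<close>.\<close>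
    define J where "J = sqrt (3 * \<Gamma> / e)"
    have J: "J > 0" "J^2 = 3 * \<Gamma> / e" using G e by (simp_all add: J_def)
    define Cc where "Cc = (4 * J + 3) * exp 2 * fact 12 * ((2 * real d + 2) / v2)^12"
    have Cc: "Cc > 0" using J v2 unfolding Cc_def by (intro mult_pos_pos zero_less_power divide_pos_pos) auto
    \<comment> \<open>The number of top windows in the range is of order
      \<open>1 / \<delta>\<close>, against a factor \<open>\<delta>^12\<close> in the cascade
      estimate. The remaining \<open>\<delta>^11\<close> is at most \<open>\<delta>\<close>, which
      this choice makes small enough.\<close>
    define \<delta> where "\<delta> = min 1 (e / (3 * Cc))"
    have del: "\<delta> > 0" "\<delta> \<le> 1" "Cc * \<delta> \<le> e / 3"
    proof -
      have "\<delta> \<le> e / (3 * Cc)" by (simp add: \<delta>_def)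
      then show "Cc * \<delta> \<le> e / 3" using Cc by (simp add: field_simps)
    qed (use e Cc in \<open>auto simp: \<delta>_def\<close>)
    obtain Na :: nat where Na: "real Na \<ge> 1 / \<delta>" using real_arch_simple by blast
    obtain Nb :: nat where Nb: "real Nb \<ge> (3 * K / e)^2" using real_arch_simple by blast
    show "\<exists>\<delta>>0. \<exists>N1. \<forall>N\<ge>N1. \<exists>t. 2^t \<le> \<delta> * real N ^ d \<and> \<delta> * real N ^ d < 2 * 2^t \<and>
       (\<forall>T. real T \<le> \<Gamma> * real N ^ (2*d) \<longrightarrow> (\<forall>x. measure_pmf.prob (rw d T) {ms. disc_by N d T x ms} \<le>
          measure_pmf.prob (rw d T) {ms. \<exists>a. dens t a ms > v2 * real N ^ d} + e))"
    proof (rule exI[of _ \<delta>], rule conjI[OF del(1)], rule exI[of _ "max N0 (max Na Nb)"], intro allI impI)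
      fix N assume "max N0 (max Na Nb) \<le> N"
      then have N: "N \<ge> N0" "N \<ge> Na" "N \<ge> Nb" "N \<ge> 1" using N0 by auto
      define n where "n = real N ^ d"
      have "real N ^ 1 \<le> n" unfolding n_def using N d by (intro power_increasing) auto
      then have nN: "n \<ge> real N" by simp
      then have n: "n > 0" using N by linarith
      have n2: "real N ^ (2*d) = n^2" by (simp add: n_def power_mult[symmetric] mult.commute)
      have "1 / \<delta> \<le> n" using Na N nN by linarith
      then have "\<delta> * n \<ge> 1" using del by (simp add: field_simps)
      then obtain t where t: "2^t \<le> \<delta> * n" "\<delta> * n < 2 * 2^t" by (rule exists_dyadic_scale)
      show "\<exists>t. 2^t \<le> \<delta> * real N ^ d \<and> \<delta> * real N ^ d < 2 * 2^t \<and>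
       (\<forall>T. real T \<le> \<Gamma> * real N ^ (2*d) \<longrightarrow> (\<forall>x. measure_pmf.prob (rw d T) {ms. disc_by N d T x ms} \<le>
          measure_pmf.prob (rw d T) {ms. \<exists>a. dens t a ms > v2 * real N ^ d} + e))"
        unfolding n2 n_def[symmetric]
      proof (intro exI[of _ t] conjI t allI impI)
        fix T x assume T: "real T \<le> \<Gamma> * n^2"
        let ?P = "measure_pmf.prob (rw d T)"
        define R where "R = {ms. \<exists>k\<le>T. \<bar>real_of_int (altitude (take k ms))\<bar> \<ge> J * n}"
        define D where "D = {ms. \<exists>a. dens t a ms > v2 * n}"
        define Q where "Q = {ms. (\<forall>k\<le>T. \<bar>real_of_int (altitude (take k ms))\<bar> \<le> J * n) \<and> (\<forall>a. dens t a ms \<le> v2 * n) \<and>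
           (\<exists>z. real (occ {z} ms) > 108 * (v2 * n))}"
        define Th where "Th = {ms. (\<exists>n\<le>T. disconnects N d ((\<lambda>k. pos N (x, 0) (take k ms)) ` {0..n})) \<and>
           (\<forall>z. real (occ {z} ms) \<le> v1 * n)}"
        have PR: "?P R \<le> e / 3"
        proof -
          have "?P R \<le> real T / (J * n)^2" unfolding R_def using J n by (intro prob_altitude_range_le) auto
          also have "\<dots> \<le> \<Gamma> * n^2 / (J * n)^2" using T by (intro divide_right_mono) auto
          also have "\<dots> = e / 3" using n G e by (simp add: power_mult_distrib J)
          finally show ?thesis .
        qed
        have PQ: "?P Q \<le> e / 3"
        proof -
          have "?P Q \<le> (2 * (J * n / 2^t) + 3) * exp 2 * fact 12 * ((2 * real d + 2) * 2^t / (v2 * n)) ^ 12"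
            unfolding Q_def using J n v2 by (intro prob_dens_cascade_le) auto
          also have "\<dots> \<le> ((4 * J + 3) / \<delta>) * exp 2 * fact 12 * ((2 * real d + 2) / v2 * \<delta>) ^ 12"
          proof (intro mult_mono power_mono)
            have "n / 2^t \<le> 2 / \<delta>" using t del by (simp add: field_simps)
            then have "J * (n / 2^t) \<le> J * (2 / \<delta>)" using J by (intro mult_left_mono) auto
            moreover have "3 \<le> 3 / \<delta>" using del by (simp add: field_simps)
            ultimately show "2 * (J * n / 2^t) + 3 \<le> (4 * J + 3) / \<delta>" by (simp add: add_divide_distrib)
            have "2^t / n \<le> \<delta>" using t n by (simp add: field_simps)
            then have "(2 * real d + 2) / v2 * (2^t / n) \<le> (2 * real d + 2) / v2 * \<delta>" using v2 by (intro mult_left_mono) auto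
            then show "(2 * real d + 2) * 2^t / (v2 * n) \<le> (2 * real d + 2) / v2 * \<delta>" by simp
          qed (use J n v2 del in auto)
          also have "\<dots> = Cc * \<delta>^11"
          proof -
            have d12: "\<delta>^12 = \<delta> * \<delta>^11" by (simp add: power_eq_if)
            have "(X / \<delta>) * E1 * E2 * (Y * (\<delta> * Z)) = X * E1 * E2 * Y * Z" for X E1 E2 Y Z :: real using del by simp
            then show ?thesis unfolding Cc_def power_mult_distrib d12 .
          qed
          also have "\<dots> \<le> Cc * \<delta>"
            using Cc del power_decreasing[of 1 11 \<delta>] by (intro mult_left_mono) auto
          finally show ?thesis using del by linarith
        qed
        have PT: "?P Th \<le> e / 3"
        proof -
          have "?P Th \<le> K / sqrt (real N)" using K N(1) T unfolding Th_def n_def n2 by (simp only: n2 n_def)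
          also have "\<dots> \<le> e / 3"
          proof (cases "K \<le> 0")
            case True
            then show ?thesis using e by (meson divide_nonneg_pos divide_nonpos_nonneg order_trans real_sqrt_ge_zero of_nat_0_le_iff zero_less_numeral less_imp_le)
          next
            case False
            have "(3 * K / e)^2 \<le> real N" using Nb N by linarith
            then have "3 * K / e \<le> sqrt (real N)" using False e by (intro real_le_rsqrt)
            then show ?thesis using False e N by (simp add: field_simps)
          qed
          finally show ?thesis .
        qed
        have "?P {ms. disc_by N d T x ms} \<le> ?P (D \<union> (R \<union> (Q \<union> Th)))"
        proof (rule measure_pmf.finite_measure_mono)
          show "{ms. disc_by N d T x ms} \<subseteq> D \<union> (R \<union> (Q \<union> Th))"
          proof
            fix ms assume "ms \<in> {ms. disc_by N d T x ms}"
            then have dd: "disc_by N d T x ms" by simp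
            show "ms \<in> D \<union> (R \<union> (Q \<union> Th))"
            proof (rule ccontr)
              assume neg: "ms \<notin> D \<union> (R \<union> (Q \<union> Th))"
              then have "\<forall>a. dens t a ms \<le> v2 * n" by (auto simp: D_def not_less)
              moreover have "\<forall>k\<le>T. \<bar>real_of_int (altitude (take k ms))\<bar> \<le> J * n"
                using neg unfolding R_def by (metis (mono_tags, lifting) UnI1 UnI2 mem_Collect_eq linear)
              ultimately have "\<forall>z. real (occ {z} ms) \<le> 108 * (v2 * n)" using neg by (auto simp: Q_def not_less)
              then have "ms \<in> Th" using dd by (simp add: Th_def disc_by_def v2_def)
              then show False using neg by simp
            qed
          qed
        qed simp
        also have "\<dots> \<le> ?P D + (?P R + (?P Q + ?P Th))"
          by (intro order_trans[OF measure_Un_le] add_mono order_refl) auto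
        finally show "?P {ms. disc_by N d T x ms} \<le> ?P {ms. \<exists>a. dens t a ms > v2 * n} + e"
          using PR PQ PT unfolding D_def by linarith
      qed
    qed
  qed
qed

text \<open>At a time in the window that is not displaced, three errors add up: half the window
  \<open>b * c / 2\<close>, the displacement since the start of the block \<open>b * c / 4\<close>,
  and the total rounding error \<open>b * c / 4\<close>. So the block start is reconstructed within
  \<open>b * c\<close> of the centre of the window, and sparseness limits the number of such
  blocks.\<close>

lemma occ_window_le_of_sparse:
  fixes c y b :: real
  assumes len: "length ms = m * n" and n: "n > 0" and m: "m > 0" and c: "c > 0" and b: "b > 0"
    and code: "rw_code (b / (4 * real m) * c) n m ms \<in> sparse_codes (b / (4 * real m)) b m y"
    and t: "2^t \<le> b * c"
  shows "real (occ {z. z div 2^t = a} ms) \<le> real n * y +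
    real (card {s. s < m * n \<and> \<bar>real_of_int (altitude (take s ms) - altitude (take (s div n * n) ms))\<bar> \<ge> b / 4 * c})"
proof -
  define \<kappa> where "\<kappa> = b / (4 * real m)"
  have \<kappa>: "\<kappa> > 0" "real m * \<kappa> = b / 4" using b m by (auto simp: \<kappa>_def)
  have kc: "\<kappa> * c > 0" using \<kappa> c by simp
  define q where "q = rw_code (\<kappa> * c) n m ms"
  define z0 where "z0 = real_of_int a * 2^t + 2^t / 2"
  define K where "K = {k. k < m \<and> \<bar>\<kappa> * real_of_int (sum_list (take k q)) - z0 / c\<bar> \<le> b}"
  have K: "finite K" "real (card K) \<le> y"
    using code by (auto simp: K_def sparse_codes_def q_def \<kappa>_def)
  define E where "E = {s. s < m * n \<and> \<bar>real_of_int (altitude (take s ms) - altitude (take (s div n * n) ms))\<bar> \<ge> b / 4 * c}"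
  have fE: "finite E" by (simp add: E_def)
  have near: "\<bar>real_of_int (altitude (take (k * n) ms)) - c * (\<kappa> * real_of_int (sum_list (take k q)))\<bar> \<le> b / 4 * c" if k: "k \<le> m" for k
  proof -
    have tk: "take k q = map (\<lambda>i. \<lfloor>real_of_int (incr n i ms) / (\<kappa> * c)\<rfloor>) [0..<k]"
      using k by (simp add: q_def rw_code_def take_map)
    have "real_of_int (altitude (take (k * n) ms)) - c * (\<kappa> * real_of_int (sum_list (take k q))) =
      (\<Sum>i<k. real_of_int (incr n i ms) - (\<kappa> * c) * real_of_int \<lfloor>real_of_int (incr n i ms) / (\<kappa> * c)\<rfloor>)"
      unfolding tk altitude_take_mult
      by (simp add: interv_sum_list_conv_sum_set_nat atLeast0LessThan sum_distrib_left sum_subtractf mult_ac)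
    also have "\<bar>\<dots>\<bar> \<le> (\<Sum>i<k. \<kappa> * c)"
    proof (rule order_trans[OF sum_abs], rule sum_mono)
      fix i
      define x where "x = real_of_int (incr n i ms)"
      have "of_int \<lfloor>x / (\<kappa> * c)\<rfloor> * (\<kappa> * c) \<le> x" "x < of_int (\<lfloor>x / (\<kappa> * c)\<rfloor> + 1) * (\<kappa> * c)"
        using floor_divide_eq_iff[OF kc, of x "\<lfloor>x / (\<kappa> * c)\<rfloor>"] by auto
      then show "\<bar>real_of_int (incr n i ms) - (\<kappa> * c) * real_of_int \<lfloor>real_of_int (incr n i ms) / (\<kappa> * c)\<rfloor>\<bar> \<le> \<kappa> * c"
        unfolding x_def[symmetric] by (simp add: algebra_simps)
    qed
    also have "\<dots> = real k * (\<kappa> * c)" by simp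
    also have "\<dots> \<le> real m * (\<kappa> * c)" using k kc by (intro mult_right_mono) auto
    also have "\<dots> = b / 4 * c" using \<kappa>(2) by (simp add: mult.assoc[symmetric])
    finally show ?thesis .
  qed
  have sub: "{s. s < length ms \<and> altitude (take s ms) \<in> {z. z div 2^t = a}} \<subseteq> (\<Union>k\<in>K. {k * n..<k * n + n}) \<union> E"
  proof
    fix s assume "s \<in> {s. s < length ms \<and> altitude (take s ms) \<in> {z. z div 2^t = a}}"
    then have s: "s < m * n" "altitude (take s ms) \<in> {a * 2^t..<a * 2^t + 2^t}"
      using len dyadic_window[of t a] by auto
    show "s \<in> (\<Union>k\<in>K. {k * n..<k * n + n}) \<union> E"
    proof (cases "s \<in> E")
      case False
      define k where "k = s div n"
      have km: "k < m" using s n by (simp add: k_def div_less_iff_less_mult)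
      have sk: "s \<in> {k * n..<k * n + n}" unfolding k_def using n dividend_less_div_times[of n s] by (simp add: add.commute)
      define h where "h = real_of_int (altitude (take s ms))"
      define h' where "h' = real_of_int (altitude (take (k * n) ms))"
      have "real_of_int (a * 2^t) \<le> h" "h < real_of_int (a * 2^t + 2^t)"
        unfolding h_def using s(2) by (simp_all only: of_int_le_iff of_int_less_iff atLeastLessThan_iff)
      then have "real_of_int a * 2^t \<le> h" "h < real_of_int a * 2^t + 2^t" by simp_all
      moreover have "\<bar>h - (w + f / 2)\<bar> \<le> f / 2" if "w \<le> h" "h < w + f" for w f :: real
        unfolding abs_le_iff using that by (auto simp: field_simps)
      ultimately have "\<bar>h - z0\<bar> \<le> 2^t / 2" unfolding z0_def by blast
      then have 1: "\<bar>h - z0\<bar> \<le> b / 2 * c" using t by simp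
      have 2: "\<bar>h - h'\<bar> < b / 4 * c" using False s(1) by (simp add: E_def h_def h'_def k_def not_le)
      have 3: "\<bar>h' - c * (\<kappa> * real_of_int (sum_list (take k q)))\<bar> \<le> b / 4 * c" unfolding h'_def using km by (intro near) simp
      have "\<bar>c * (\<kappa> * real_of_int (sum_list (take k q))) - z0\<bar> \<le> b * c" using 1 2 3 by linarith
      moreover have "c * (\<kappa> * real_of_int (sum_list (take k q))) - z0 = c * (\<kappa> * real_of_int (sum_list (take k q)) - z0 / c)"
        using c by (simp add: field_simps)
      ultimately have "c * \<bar>\<kappa> * real_of_int (sum_list (take k q)) - z0 / c\<bar> \<le> c * b" using c by (simp add: abs_mult mult.commute)
      then have "\<bar>\<kappa> * real_of_int (sum_list (take k q)) - z0 / c\<bar> \<le> b" using c by (simp add: mult_le_cancel_left_pos)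
      then have "k \<in> K" using km by (simp add: K_def)
      then show ?thesis using sk by blast
    qed simp
  qed
  have "occ {z. z div 2^t = a} ms \<le> card ((\<Union>k\<in>K. {k * n..<k * n + n}) \<union> E)"
    unfolding occ_def using K fE by (intro card_mono sub) auto
  also have "\<dots> \<le> card (\<Union>k\<in>K. {k * n..<k * n + n}) + card E" by (rule card_Un_le)
  also have "card (\<Union>k\<in>K. {k * n..<k * n + n}) \<le> (\<Sum>k\<in>K. card {k * n..<k * n + n})" by (rule card_UN_le[OF K(1)])
  finally have "occ {z. z div 2^t = a} ms \<le> n * card K + card E" by (simp add: mult.commute)
  then have "real (occ {z. z div 2^t = a} ms) \<le> real (n * card K + card E)" by (simp only: of_nat_le_iff)
  also have "\<dots> = real n * real (card K) + real (card E)" by simp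
  also have "\<dots> \<le> real n * y + real (card E)" using K by (intro add_right_mono mult_left_mono) auto
  finally show ?thesis by (simp add: E_def)
qed

text \<open>For tightness at small \<open>N\<close> the constant \<open>K\<close> is so large that
  only disconnection at time 0 could exceed it. One of two vertical lines avoids the single visited
  site.\<close>

lemma not_disconnects_singleton:
  assumes N: "N \<ge> 2" and d: "d \<ge> 1"
  shows "\<not> disconnects N d {(x, 0)}"
proof (rule not_disconnects_if_free_path)
  fix M0 :: int
  define M where "M = max M0 1"
  obtain a :: int where a: "0 \<le> a" "a < int N" "pt a 0 \<noteq> (x, 0)"
  proof (cases "pt 0 0 = (x, 0)")
    case True
    then have "pt 1 0 \<noteq> (x, 0)" using pt_inject[of 1 0 0 0] by auto
    then show ?thesis using that[of 1] N by simp
  qed (use that[of 0] N in simp)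
  have free: "pt a z \<notin> {(x, 0)}" for z using a(3) by (auto simp: pt_def)
  have "(free_step N d {(x, 0)})\<^sup>*\<^sup>* (pt a (- M)) (pt a (- M + int (nat (2 * M))))"
    by (rule free_vertical[OF N d a(1,2) free])
  moreover have "- M + int (nat (2 * M)) = M" by (simp add: M_def)
  ultimately have "conn_in N d {(x, 0)} (pt a (- M)) (pt a M)"
    using free pt_in_cyl[OF a(1,2) d] by (simp add: conn_in_free_step)
  moreover have "pt a (- M) \<in> torus N d \<times> {..-M}" "pt a M \<in> torus N d \<times> {M..}"
    using pt_in_cyl[OF a(1,2) d, of M] by (auto simp: cyl_def pt_def)
  moreover have "M \<ge> M0" by (simp add: M_def)
  ultimately show "\<exists>M\<ge>M0. \<exists>p\<in>torus N d \<times> {..-M}. \<exists>q\<in>torus N d \<times> {M..}. conn_in N d {(x, 0)} p q"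
    by (intro exI[of _ M] conjI bexI[of _ "pt a (- M)"] bexI[of _ "pt a M"])
qed

lemma disc_time_le_iff_disc_by:
  "disc_time N d \<omega> \<le> enat T \<longleftrightarrow> disc_by N d T (fst \<omega>) (stake T (snd \<omega>))"
proof
  assume "disc_by N d T (fst \<omega>) (stake T (snd \<omega>))"
  then obtain n where n: "n \<le> T" "disconnects N d (walk_pos N \<omega> ` {0..n})" unfolding disc_by_stake by blast
  then have "(LEAST n. disconnects N d (walk_pos N \<omega> ` {0..n})) \<le> n" by (intro Least_le)
  then show "disc_time N d \<omega> \<le> enat T" using n by (auto simp: disc_time_def)
qed (rule disc_time_le_imp_disc_by)

lemma ereal_of_enat_greater_iff:
  assumes "r \<ge> 0"
  shows "ereal_of_enat D > ereal r \<longleftrightarrow> \<not> D \<le> enat (nat \<lfloor>r\<rfloor>)"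
proof (cases D)
  case (enat k)
  have "k \<le> nat \<lfloor>r\<rfloor> \<longleftrightarrow> real k \<le> r" using assms by (simp add: le_nat_floor le_nat_iff le_floor_iff)
  then show ?thesis using enat by auto
qed simp

lemma measure_disc_time_greater:
  assumes "r \<ge> 0"
  shows "measure (walk_space N d) {\<omega> \<in> space (walk_space N d). ereal_of_enat (disc_time N d \<omega>) > ereal r}
     = 1 - measure (walk_space N d) {\<omega>. disc_by N d (nat \<lfloor>r\<rfloor>) (fst \<omega>) (stake (nat \<lfloor>r\<rfloor>) (snd \<omega>))}"
proof -
  interpret prob_space "walk_space N d" by (rule prob_space_walk_space)
  let ?C = "{\<omega>. disc_by N d (nat \<lfloor>r\<rfloor>) (fst \<omega>) (stake (nat \<lfloor>r\<rfloor>) (snd \<omega>))}"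
  have "{\<omega> \<in> space (walk_space N d). ereal_of_enat (disc_time N d \<omega>) > ereal r} = space (walk_space N d) - ?C"
    using assms by (auto simp: ereal_of_enat_greater_iff disc_time_le_iff_disc_by)
  then show ?thesis using prob_compl[OF sets_walk_space_stake[of "disc_by N d (nat \<lfloor>r\<rfloor>)" "nat \<lfloor>r\<rfloor>" N d]] by simp
qed

lemma disc_by_mono: "disc_by N d S (fst \<omega>) (stake S (snd \<omega>)) \<Longrightarrow> S \<le> T \<Longrightarrow> disc_by N d T (fst \<omega>) (stake T (snd \<omega>))"
  unfolding disc_by_stake by (meson order_trans)

lemma dens_le: "dens t a ms \<le> real (length ms) / 2^t"
proof -
  have "occ {z. z div 2^t = a} ms \<le> card {..<length ms}" unfolding occ_def by (intro card_mono) auto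
  then show ?thesis by (simp add: dens_def divide_right_mono)
qed

text \<open>A window of length \<open>2^t > \<delta> N^d / 2\<close> cannot have density above
  \<open>v2 N^d\<close> when the total time is at most \<open>\<gamma> N^(2*d)\<close> with
  \<open>\<gamma> \<le> v2 * \<delta> / 2\<close>: the dense event is empty, and only the error
  \<open>\<epsilon>\<close> is left.\<close>

lemma tight_inverse_disc_time:
  fixes d :: nat
  assumes d: "d \<ge> 2" and e: "\<epsilon> > 0"
  shows "\<exists>K::real. \<forall>N\<ge>2.
     measure (walk_space N d)
       {\<omega> \<in> space (walk_space N d). ereal (real N ^ (2 * d)) / ereal_of_enat (disc_time N d \<omega>) > ereal K} \<le> \<epsilon>"
proof -
  obtain v2 where v2: "v2 > 0" and dense:
    "\<And>\<Gamma> e. \<Gamma> > 0 \<Longrightarrow> e > 0 \<Longrightarrow> \<exists>\<delta>>0. \<exists>N1. \<forall>N\<ge>N1. \<exists>t. 2^t \<le> \<delta> * real N ^ d \<and> \<delta> * real N ^ d < 2 * 2^t \<and>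
       (\<forall>T. real T \<le> \<Gamma> * real N ^ (2*d) \<longrightarrow> (\<forall>x. measure_pmf.prob (rw d T) {ms. disc_by N d T x ms} \<le>
          measure_pmf.prob (rw d T) {ms. \<exists>a. dens t a ms > v2 * real N ^ d} + e))"
    by (rule prob_disc_by_le_dense[OF d]) (rule that)
  obtain \<delta> N1 where del: "\<delta> > 0" and N1: "\<And>N. N \<ge> N1 \<Longrightarrow> \<exists>t. 2^t \<le> \<delta> * real N ^ d \<and> \<delta> * real N ^ d < 2 * 2^t \<and>
       (\<forall>T. real T \<le> 1 * real N ^ (2*d) \<longrightarrow> (\<forall>x. measure_pmf.prob (rw d T) {ms. disc_by N d T x ms} \<le>
          measure_pmf.prob (rw d T) {ms. \<exists>a. dens t a ms > v2 * real N ^ d} + \<epsilon>))"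
    using dense[of 1 \<epsilon>] e by auto
  define \<gamma> where "\<gamma> = min 1 (v2 * \<delta> / 2)"
  have g: "\<gamma> > 0" "\<gamma> \<le> 1" "\<gamma> \<le> v2 * \<delta> / 2" using v2 del by (auto simp: \<gamma>_def)
  \<comment> \<open>The first entry serves \<open>N < N1\<close>: exceeding \<open>K\<close> then
    forces disconnection time 0. The second translates the time bound
    \<open>\<gamma> N^(2*d)\<close> for larger \<open>N\<close>.\<close>
  define K where "K = max (real N1 ^ (2 * d)) (1 / \<gamma>)"
  have K: "K > 0" "real N1 ^ (2 * d) \<le> K" "1 / \<gamma> \<le> K" using g by (auto simp: K_def less_max_iff_disj)
  show ?thesis
  proof (intro exI[of _ K] allI impI)
    fix N :: nat assume N: "2 \<le> N"
    interpret prob_space "walk_space N d" by (rule prob_space_walk_space)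
    define nn where "nn = real N ^ d"
    have nn: "nn > 0" "real N ^ (2 * d) = nn^2" using N by (auto simp: nn_def power_mult[symmetric] mult.commute)
    let ?A = "{\<omega> \<in> space (walk_space N d). ereal (real N ^ (2 * d)) / ereal_of_enat (disc_time N d \<omega>) > ereal K}"
    have fin: "\<exists>k. disc_time N d \<omega> = enat k \<and> real k * K < nn^2" if "\<omega> \<in> ?A" for \<omega>
    proof (cases "disc_time N d \<omega>")
      case (enat k)
      show ?thesis
      proof (cases "k = 0")
        case False
        then have "nn^2 / real k > K" using that enat nn by simp
        then show ?thesis using False enat by (simp add: field_simps)
      qed (use enat nn in simp)
    next
      case infinity
      then show ?thesis using that K by simp
    qed
    define T where "T = (if N < N1 then 0 else nat \<lfloor>\<gamma> * nn^2\<rfloor>)"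
    have "?A \<subseteq> {\<omega>. disc_by N d T (fst \<omega>) (stake T (snd \<omega>))}"
    proof
      fix \<omega> assume "\<omega> \<in> ?A"
      then obtain k where k: "disc_time N d \<omega> = enat k" "real k * K < nn^2" using fin by blast
      have "k \<le> T"
      proof (cases "N < N1")
        case True
        have "k = 0"
        proof (rule ccontr)
          assume "k \<noteq> 0"
          then have "1 * K \<le> real k * K" using K by (intro mult_right_mono) auto
          moreover have "nn^2 \<le> real N1 ^ (2 * d)" unfolding nn(2)[symmetric] using True by (intro power_mono) auto
          ultimately show False using k K by linarith
        qed
        then show ?thesis by simp
      next
        case False
        have "real k * (1 / \<gamma>) \<le> real k * K" using K by (intro mult_left_mono) auto
        then have "real k * (1 / \<gamma>) \<le> nn^2" using k by linarith
        then have "real k \<le> \<gamma> * nn^2" using g by (simp add: field_simps)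
        then show ?thesis using False by (simp add: T_def le_nat_floor)
      qed
      then have "disc_time N d \<omega> \<le> enat T" using k by simp
      then show "\<omega> \<in> {\<omega>. disc_by N d T (fst \<omega>) (stake T (snd \<omega>))}" by (simp add: disc_time_le_iff_disc_by)
    qed
    then have "measure (walk_space N d) ?A \<le> measure (walk_space N d) {\<omega>. disc_by N d T (fst \<omega>) (stake T (snd \<omega>))}"
      by (rule finite_measure_mono) (rule sets_walk_space_stake)
    also have "\<dots> \<le> \<epsilon>"
    proof (rule measure_disc_by_le)
      fix x assume x: "x \<in> torus N d"
      show "measure_pmf.prob (rw d T) {ms. disc_by N d T x ms} \<le> \<epsilon>"
      proof (cases "N < N1")
        case True
        have "\<not> disc_by N d T x ms" for ms
          using not_disconnects_singleton[of N d x] N d True by (simp add: disc_by_def T_def)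
        then show ?thesis using e by simp
      next
        case False
        then obtain t where t: "\<delta> * nn < 2 * 2^t"
          and P: "\<And>T x. real T \<le> nn^2 \<Longrightarrow> measure_pmf.prob (rw d T) {ms. disc_by N d T x ms} \<le>
          measure_pmf.prob (rw d T) {ms. \<exists>a. dens t a ms > v2 * nn} + \<epsilon>"
          using N1[of N] unfolding nn(2) nn_def[symmetric] by auto
        have T: "real T \<le> \<gamma> * nn^2" using False g nn by (simp add: T_def)
        also have "\<dots> \<le> 1 * nn^2" using g by (intro mult_right_mono) auto
        finally have "real T \<le> nn^2" by simp
        then have "measure_pmf.prob (rw d T) {ms. disc_by N d T x ms} \<le>
          measure_pmf.prob (rw d T) {ms. \<exists>a. dens t a ms > v2 * nn} + \<epsilon>" by (rule P)
        also have "measure_pmf.prob (rw d T) {ms. \<exists>a. dens t a ms > v2 * nn} = 0"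
        proof -
          have "dens t a ms \<le> v2 * nn" if ms: "ms \<in> set_pmf (rw d T)" for a ms
          proof -
            have "dens t a ms \<le> real T / 2^t" using dens_le[of t a ms] ms by (simp add: set_rw)
            also have "\<dots> \<le> \<gamma> * nn^2 / 2^t" using T by (intro divide_right_mono) auto
            also have "\<dots> \<le> (v2 * \<delta> / 2) * nn^2 / 2^t" using g by (intro divide_right_mono mult_right_mono) auto
            also have "\<dots> = v2 * nn * (\<delta> * nn / (2 * 2^t))" by (simp add: power2_eq_square)
            also have "\<dots> \<le> v2 * nn * 1" using t v2 nn by (intro mult_left_mono) auto
            finally show ?thesis by simp
          qed
          then have "set_pmf (rw d T) \<inter> {ms. \<exists>a. dens t a ms > v2 * nn} = {}" by (auto simp: not_less[symmetric])
          then show ?thesis by (simp add: measure_pmf_zero_iff)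
        qed
        finally show ?thesis by simp
      qed
    qed (use N in simp)
    finally show "measure (walk_space N d) ?A \<le> \<epsilon>" .
  qed
qed

text \<open>\<open>c N\<close> is the unit of length in which the altitude after one block of
  \<open>n N\<close> steps is asymptotically Brownian with variance \<open>\<gamma> / m\<close>.
  Rounding the block length up makes \<open>m\<close> blocks cover the time
  \<open>\<gamma> N^(2*d)\<close>; for large \<open>N\<close> they last at most twice as
  long.\<close>

lemma block_length_asymptotics:
  fixes d m :: nat and \<gamma> :: real
  assumes d: "d \<ge> 1" and m: "m > 0" and g: "\<gamma> > 0"
  defines "n \<equiv> \<lambda>N::nat. nat \<lceil>\<gamma> * real N ^ (2*d) / real m\<rceil>"
  defines "c \<equiv> \<lambda>N::nat. 1 / sqrt (real d + 1) * real N ^ d"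
  shows "filterlim n at_top sequentially"
    and "(\<lambda>N. c N / sqrt (real (n N) * (1 / (real d + 1)))) \<longlonglongrightarrow> 1 / sqrt (\<gamma> / real m)"
    and "\<And>N. real (m * n N) \<ge> \<gamma> * real N ^ (2*d)"
    and "eventually (\<lambda>N. real (m * n N) \<le> 2 * \<gamma> * real N ^ (2*d)) sequentially"
    and "\<And>N. N \<ge> 1 \<Longrightarrow> n N > 0"
proof -
  define \<tau> where "\<tau> = \<gamma> / real m"
  have tau: "\<tau> > 0" using g m by (simp add: \<tau>_def)
  have lo: "\<tau> * real N ^ (2*d) \<le> real (n N)" for N unfolding n_def \<tau>_def by (simp add: real_nat_ceiling_ge)
  have hi: "real (n N) \<le> \<tau> * real N ^ (2*d) + 1" for N
  proof -
    have "\<gamma> * real N ^ (2*d) / real m \<ge> 0" using g by simp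
    then show ?thesis unfolding n_def \<tau>_def by (simp add: of_nat_ceiling)
  qed
  have Nle: "real N \<le> real N ^ (2*d)" if "N \<ge> 1" for N
    using power_increasing[of 1 "2*d" "real N"] that d by simp
  show "n N > 0" if "N \<ge> 1" for N
  proof -
    have "\<tau> * real N ^ (2*d) > 0" using tau that by simp
    then show ?thesis using lo[of N] by linarith
  qed
  show "filterlim n at_top sequentially"
    unfolding filterlim_at_top
  proof
    fix Z :: nat
    obtain N2 :: nat where N2: "real N2 \<ge> real Z / \<tau>" using real_arch_simple by blast
    show "eventually (\<lambda>N. Z \<le> n N) sequentially"
      using eventually_ge_at_top[of "max 1 N2"]
    proof eventually_elim
      case (elim N)
      then have "real Z / \<tau> \<le> real N ^ (2*d)" using N2 Nle[of N] by linarith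
      then have "real Z \<le> \<tau> * real N ^ (2*d)" using tau by (simp add: field_simps)
      then show ?case using lo[of N] by linarith
    qed
  qed
  show "real (m * n N) \<ge> \<gamma> * real N ^ (2*d)" for N
  proof -
    have "real m * (\<tau> * real N ^ (2*d)) \<le> real m * real (n N)" by (intro mult_left_mono lo) simp
    then show ?thesis using m by (simp add: \<tau>_def)
  qed
  obtain N3 :: nat where N3: "real N3 \<ge> real m / \<gamma>" using real_arch_simple by blast
  show "eventually (\<lambda>N. real (m * n N) \<le> 2 * \<gamma> * real N ^ (2*d)) sequentially"
    using eventually_ge_at_top[of "max 1 N3"]
  proof eventually_elim
    case (elim N)
    have "real m / \<gamma> \<le> real N ^ (2*d)" using elim N3 Nle[of N] by linarith
    then have "real m \<le> \<gamma> * real N ^ (2*d)" using g by (simp add: field_simps)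
    moreover have "real m * real (n N) \<le> real m * (\<tau> * real N ^ (2*d) + 1)" by (intro mult_left_mono hi) simp
    moreover have "real m * (\<tau> * real N ^ (2*d) + 1) = \<gamma> * real N ^ (2*d) + real m" using m by (simp add: \<tau>_def field_simps)
    ultimately show ?case by simp
  qed
  have ratio: "(\<lambda>N. real (n N) / real N ^ (2*d)) \<longlonglongrightarrow> \<tau>"
  proof (rule real_tendsto_sandwich)
    show "eventually (\<lambda>N. \<tau> \<le> real (n N) / real N ^ (2*d)) sequentially"
      using eventually_ge_at_top[of 1] by eventually_elim (use lo in \<open>simp add: field_simps\<close>)
    show "eventually (\<lambda>N. real (n N) / real N ^ (2*d) \<le> \<tau> + 1 / real N) sequentially"
      using eventually_ge_at_top[of 1]
    proof eventually_elim
      case (elim N)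
      have "real (n N) / real N ^ (2*d) \<le> (\<tau> * real N ^ (2*d) + 1) / real N ^ (2*d)"
        by (intro divide_right_mono hi) simp
      also have "\<dots> = \<tau> + 1 / real N ^ (2*d)" using elim by (simp add: add_divide_distrib)
      also have "\<dots> \<le> \<tau> + 1 / real N" using elim Nle[of N] by (intro add_left_mono divide_left_mono) auto
      finally show ?case .
    qed
    show "(\<lambda>N. \<tau> + 1 / real N) \<longlonglongrightarrow> \<tau>" using tendsto_add[OF tendsto_const[of \<tau>] lim_1_over_n] by simp
  qed simp
  then have "(\<lambda>N. 1 / sqrt (real (n N) / real N ^ (2*d))) \<longlonglongrightarrow> 1 / sqrt \<tau>"
    using tau by (intro tendsto_intros) auto
  moreover have "eventually (\<lambda>N. 1 / sqrt (real (n N) / real N ^ (2*d)) = c N / sqrt (real (n N) * (1 / (real d + 1)))) sequentially"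
    using eventually_ge_at_top[of 1]
  proof eventually_elim
    case (elim N)
    have "sqrt (real N ^ (2*d)) = real N ^ d"
    proof -
      have "real N ^ (2*d) = (real N ^ d)^2" by (simp add: power_mult[symmetric] mult.commute)
      then show ?thesis by simp
    qed
    then show ?case by (simp add: c_def real_sqrt_divide real_sqrt_mult)
  qed
  ultimately show "(\<lambda>N. c N / sqrt (real (n N) * (1 / (real d + 1)))) \<longlonglongrightarrow> 1 / sqrt (\<gamma> / real m)"
    unfolding \<tau>_def by (rule Lim_transform_eventually)
qed

text \<open>The value \<open>v2 / 24\<close>: a sparse code allows occupation at most \<open>T * (3
  * v * \<delta> / \<gamma>) \<le> 6 * v * \<delta> * N^(2*d)\<close>, where 3 comes from the
  widened window and 2 from the rounding of \<open>T\<close>. This is at most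
  \<open>v2 * \<delta> * N^(2*d) / 4\<close>. The displaced times receive the same allowance, and
  together they stay below \<open>v2 * N^d * 2^t\<close>, so no window is dense.\<close>

lemma liminf_disc_time_ge:
  fixes d :: nat
  assumes d: "d \<ge> 2"
  obtains v0 :: real where "v0 > 0"
    "\<And>v \<gamma> M B L. 0 < v \<Longrightarrow> v < v0 \<Longrightarrow> \<gamma> > 0 \<Longrightarrow> std_BM M B \<Longrightarrow> local_time M B L \<Longrightarrow>
       liminf (\<lambda>N. ereal (measure (walk_space N d)
                 {\<omega> \<in> space (walk_space N d). ereal_of_enat (disc_time N d \<omega>) > ereal (\<gamma> * real N ^ (2 * d))}))
              \<ge> ereal (measure M {\<omega> \<in> space M. zeta L \<omega> (v / sqrt (real d + 1)) > ereal \<gamma>})"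
proof -
  obtain v2 where v2: "v2 > 0" and dense:
    "\<And>\<Gamma> e. \<Gamma> > 0 \<Longrightarrow> e > 0 \<Longrightarrow> \<exists>\<delta>>0. \<exists>N1. \<forall>N\<ge>N1. \<exists>t. 2^t \<le> \<delta> * real N ^ d \<and> \<delta> * real N ^ d < 2 * 2^t \<and>
       (\<forall>T. real T \<le> \<Gamma> * real N ^ (2*d) \<longrightarrow> (\<forall>x. measure_pmf.prob (rw d T) {ms. disc_by N d T x ms} \<le>
          measure_pmf.prob (rw d T) {ms. \<exists>a. dens t a ms > v2 * real N ^ d} + e))"
    by (rule prob_disc_by_le_dense[OF d]) (rule that)
  show ?thesis
  proof (rule that[of "v2 / 24"])
    show "v2 / 24 > 0" using v2 by simp
    fix v \<gamma> :: real and M :: "'a measure" and B L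
    assume v: "0 < v" "v < v2 / 24" and g: "\<gamma> > 0" and BM: "std_BM M B" and LT: "local_time M B L"
    define \<sigma> where "\<sigma> = 1 / sqrt (real d + 1)"
    have sg: "\<sigma> > 0" by (simp add: \<sigma>_def)
    define u where "u = v / sqrt (real d + 1)"
    have u: "u = v * \<sigma>" by (simp add: u_def \<sigma>_def)
    define W where "W = measure M {\<omega> \<in> space M. zeta L \<omega> u > ereal \<gamma>}"
    define pr where "pr N = measure (walk_space N d) {\<omega> \<in> space (walk_space N d). ereal_of_enat (disc_time N d \<omega>) > ereal (\<gamma> * real N ^ (2 * d))}" for N
    have main: "eventually (\<lambda>N. W - e \<le> pr N) sequentially" if e: "e > 0" for e
    proof -
      obtain \<delta> N1 where del: "\<delta> > 0" and N1: "\<And>N. N \<ge> N1 \<Longrightarrow> \<exists>t. 2^t \<le> \<delta> * real N ^ d \<and> \<delta> * real N ^ d < 2 * 2^t \<and>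
       (\<forall>T. real T \<le> (2 * \<gamma>) * real N ^ (2*d) \<longrightarrow> (\<forall>x. measure_pmf.prob (rw d T) {ms. disc_by N d T x ms} \<le>
          measure_pmf.prob (rw d T) {ms. \<exists>a. dens t a ms > v2 * real N ^ d} + e / 4))"
        using dense[of "2 * \<gamma>" "e / 4"] g e by auto
      \<comment> \<open>Matches the Brownian scale with the dyadic one:
        \<open>b * c N = \<delta> * N^d\<close>. With \<open>u = v * \<sigma>\<close> the product
        \<open>u * b = v * \<delta>\<close> is free of \<open>\<sigma>\<close>, which explains the
        argument \<open>v / sqrt (d + 1)\<close> of the stopping time.\<close>
      define b where "b = \<delta> / \<sigma>"
      have b: "b > 0" "b * \<sigma> = \<delta>" "u * b = v * \<delta>" using del sg by (simp_all add: b_def u)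
      obtain m1 where m1: "\<And>m. m \<ge> m1 \<Longrightarrow> m > 0 \<Longrightarrow> W \<le>
        measure M {\<omega> \<in> space M. bm_code B (\<gamma> / real m) (b / (4 * real m)) m \<omega> \<in> sparse_codes (b / (4 * real m)) b m (3 * u * b * real m / \<gamma>)} + e / 4"
        using measure_zeta_le_bm_code[OF BM LT g b(1), of "e / 4" u] e unfolding W_def by auto
      \<comment> \<open>The probability of too many displaced times will be at most
        \<open>256 * \<gamma>^2 / (m * v2 * \<delta>^3)\<close>; this threshold brings it below
        \<open>e / 4\<close>.\<close>
      obtain m2 :: nat where m2: "real m2 \<ge> 1024 * \<gamma>^2 / (v2 * \<delta>^3 * e)" using real_arch_simple by blast
      define m where "m = max 1 (max m1 m2)"
      have m: "m > 0" "m \<ge> m1" "real m \<ge> 1024 * \<gamma>^2 / (v2 * \<delta>^3 * e)" using m2 by (auto simp: m_def)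
      define \<kappa> where "\<kappa> = b / (4 * real m)"
      define y where "y = 3 * u * b * real m / \<gamma>"
      define G where "G = sparse_codes \<kappa> b m y"
      define n where "n N = nat \<lceil>\<gamma> * real N ^ (2*d) / real m\<rceil>" for N :: nat
      define c where "c N = 1 / sqrt (real d + 1) * real N ^ d" for N :: nat
      have d1: "d \<ge> 1" using d by simp
      note asy = block_length_asymptotics[OF d1 m(1) g, folded n_def c_def]
      have kap: "\<kappa> > 0" using b m by (simp add: \<kappa>_def)
      have tau: "\<gamma> / real m > 0" using g m by simp
      have c0: "eventually (\<lambda>N. c N > 0) sequentially"
        using eventually_ge_at_top[of 1] by eventually_elim (simp add: c_def)
      have evc: "eventually (\<lambda>N. measure_pmf.prob (rw d (m * n N)) {ms. rw_code (\<kappa> * c N) (n N) m ms \<in> G}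
         \<ge> measure M {\<omega> \<in> space M. bm_code B (\<gamma> / real m) \<kappa> m \<omega> \<in> G} - e / 4) sequentially"
        using e by (intro eventually_prob_rw_code_ge[OF BM tau kap m(1) asy(1) c0 asy(2)]) auto
      have WG: "W \<le> measure M {\<omega> \<in> space M. bm_code B (\<gamma> / real m) \<kappa> m \<omega> \<in> G} + e / 4"
        using m1[OF m(2,1)] by (simp add: G_def \<kappa>_def y_def)
      show ?thesis
        using evc asy(4) eventually_ge_at_top[of "max 1 N1"]
      proof eventually_elim
        case (elim N)
        define nn where "nn = real N ^ d"
        have N: "N \<ge> 1" "N \<ge> N1" using elim(3) by auto
        have nn: "nn > 0" "real N ^ (2*d) = nn^2" using N by (auto simp: nn_def power_mult[symmetric] mult.commute)
        define T where "T = m * n N"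
        have T: "\<gamma> * nn^2 \<le> real T" "real T \<le> 2 * \<gamma> * nn^2" using asy(3)[of N] elim(2) by (simp_all only: T_def nn(2))
        obtain t where t: "2^t \<le> \<delta> * nn" "\<delta> * nn < 2 * 2^t"
          and P: "\<And>x. measure_pmf.prob (rw d T) {ms. disc_by N d T x ms} \<le>
            measure_pmf.prob (rw d T) {ms. \<exists>a. dens t a ms > v2 * nn} + e / 4"
          using N1[OF N(2)] T(2) unfolding nn(2) nn_def[symmetric] by blast
        let ?P = "measure_pmf.prob (rw d T)"
        have cN: "c N = \<sigma> * nn" by (simp add: c_def \<sigma>_def nn_def)
        have bc: "b * c N = \<delta> * nn" using b(2) by (simp add: cN mult.assoc[symmetric])
        define y' where "y' = v2 * \<delta> * nn^2 / 4"
        define Cd where "Cd = {ms. rw_code (\<kappa> * c N) (n N) m ms \<in> G}"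
        define Ds where "Ds = {ms. real (card {s. s < m * n N \<and> \<bar>real_of_int (altitude (take s ms) - altitude (take (s div n N * n N) ms))\<bar> \<ge> b / 4 * c N}) \<ge> y'}"
        have PDs: "?P Ds \<le> e / 4"
        proof -
          have c4: "b / 4 * c N = \<delta> * nn / 4" using bc by simp
          have "?P Ds \<le> real (m * n N) * real (n N) / ((\<delta> * nn / 4)^2 * y')"
            unfolding Ds_def T_def c4 using del nn v2 asy(5)[OF N(1)] by (intro prob_displaced_le) (auto simp: y'_def)
          also have "real (n N) = real T / real m" using m by (simp add: T_def)
          also have "real (m * n N) * (real T / real m) = real T * real T / real m" by (simp add: T_def)
          also have "\<dots> / ((\<delta> * nn / 4)^2 * y') \<le> (2 * \<gamma> * nn^2) * (2 * \<gamma> * nn^2) / real m / ((\<delta> * nn / 4)^2 * y')"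
            using T nn del v2 g by (intro divide_right_mono mult_mono) (auto simp: y'_def)
          also have "\<dots> = 256 * \<gamma>^2 / (real m * v2 * \<delta>^3)"
            using nn del v2 m by (simp add: y'_def power2_eq_square power3_eq_cube field_simps)
          also have "\<dots> \<le> e / 4"
          proof -
            have "1024 * \<gamma>^2 \<le> real m * (v2 * \<delta>^3 * e)" using m(3) v2 del e by (simp add: divide_le_eq)
            then show ?thesis using m v2 del e by (simp add: divide_le_eq mult_ac)
          qed
          finally show ?thesis .
        qed
        have "?P {ms. \<exists>a. dens t a ms > v2 * nn} \<le> ?P (- Cd \<union> Ds)"
        proof (rule measure_pmf.finite_measure_mono_AE, rule AE_pmfI, rule impI)
          fix ms assume ms: "ms \<in> set_pmf (rw d T)" and "ms \<in> {ms. \<exists>a. dens t a ms > v2 * nn}"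
          then obtain a where a: "dens t a ms > v2 * nn" by auto
          show "ms \<in> - Cd \<union> Ds"
          proof (rule ccontr)
            assume neg: "ms \<notin> - Cd \<union> Ds"
            have "real (occ {z. z div 2^t = a} ms) \<le> real (n N) * y +
               real (card {s. s < m * n N \<and> \<bar>real_of_int (altitude (take s ms) - altitude (take (s div n N * n N) ms))\<bar> \<ge> b / 4 * c N})"
            proof (rule occ_window_le_of_sparse)
              show "length ms = m * n N" using ms by (simp add: set_rw T_def)
              show "n N > 0" by (rule asy(5)[OF N(1)])
              show "c N > 0" using sg nn by (simp add: cN)
              show "rw_code (b / (4 * real m) * c N) (n N) m ms \<in> sparse_codes (b / (4 * real m)) b m y"
                using neg by (simp add: Cd_def G_def \<kappa>_def)
              show "2^t \<le> b * c N" using t by (simp add: bc)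
            qed (use m b in auto)
            also have "\<dots> \<le> real (n N) * y + y'" using neg by (simp add: Ds_def not_le)
            also have "real (n N) * y = real T * (3 * v * \<delta> / \<gamma>)"
              using b(3) by (simp add: y_def T_def mult_ac)
            also have "\<dots> \<le> 2 * \<gamma> * nn^2 * (3 * v * \<delta> / \<gamma>)" using T v del g by (intro mult_right_mono) auto
            also have "\<dots> = 6 * v * \<delta> * nn^2" using g by simp
            also have "6 * v * \<delta> * nn^2 + y' \<le> v2 * \<delta> * nn^2 / 2"
            proof -
              have "6 * v * (\<delta> * nn^2) \<le> v2 / 4 * (\<delta> * nn^2)" using v del by (intro mult_right_mono) auto
              moreover have "6 * v * \<delta> * nn^2 = 6 * v * (\<delta> * nn^2)" "y' = v2 / 4 * (\<delta> * nn^2)"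
                "v2 * \<delta> * nn^2 / 2 = v2 / 4 * (\<delta> * nn^2) + v2 / 4 * (\<delta> * nn^2)"
                by (simp_all add: y'_def)
              ultimately show ?thesis by linarith
            qed
            also have "\<dots> \<le> v2 * nn * 2^t"
            proof -
              have "v2 * nn * (\<delta> * nn) \<le> v2 * nn * (2 * 2^t)" using t v2 nn by (intro mult_left_mono) auto
              then show ?thesis by (simp add: power2_eq_square mult_ac)
            qed
            finally have "dens t a ms \<le> v2 * nn" by (simp add: dens_def divide_le_eq)
            then show False using a by simp
          qed
        qed simp
        also have "\<dots> \<le> ?P (- Cd) + ?P Ds" by (intro measure_Un_le) auto
        also have "?P (- Cd) = 1 - ?P Cd"
          using measure_pmf.prob_compl[of Cd "rw d T"] by (simp add: Compl_eq_Diff_UNIV)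
        finally have "?P {ms. \<exists>a. dens t a ms > v2 * nn} \<le> 1 - ?P Cd + ?P Ds" .
        moreover have "?P Cd \<ge> W - e / 4 - e / 4"
          using elim(1) WG unfolding Cd_def T_def by linarith
        ultimately have bound: "?P {ms. disc_by N d T x ms} \<le> 1 - W + e" for x
          using P[of x] PDs by linarith
        have r0: "\<gamma> * real N ^ (2 * d) \<ge> 0" using g by simp
        define S where "S = nat \<lfloor>\<gamma> * real N ^ (2 * d)\<rfloor>"
        have ST: "S \<le> T"
        proof -
          have "real S \<le> real T" using T r0 unfolding S_def nn(2) by linarith
          then show ?thesis by simp
        qed
        interpret Ws: prob_space "walk_space N d" by (rule prob_space_walk_space)
        have "measure (walk_space N d) {\<omega>. disc_by N d S (fst \<omega>) (stake S (snd \<omega>))} \<le>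
          measure (walk_space N d) {\<omega>. disc_by N d T (fst \<omega>) (stake T (snd \<omega>))}"
          using ST by (intro Ws.finite_measure_mono sets_walk_space_stake) (auto intro: disc_by_mono)
        also have "\<dots> \<le> 1 - W + e" by (rule measure_disc_by_le[OF N(1)]) (rule bound)
        finally show "W - e \<le> pr N" unfolding pr_def measure_disc_time_greater[OF r0] S_def by linarith
      qed
    qed
    have "ereal W \<le> liminf (\<lambda>N. ereal (pr N))"
    proof (rule ccontr)
      assume "\<not> ereal W \<le> liminf (\<lambda>N. ereal (pr N))"
      then have "liminf (\<lambda>N. ereal (pr N)) < ereal W" by simp
      then obtain r where r: "liminf (\<lambda>N. ereal (pr N)) < ereal r" "ereal r < ereal W" using ereal_dense2 by blast
      have "eventually (\<lambda>N. ereal r \<le> ereal (pr N)) sequentially" using main[of "W - r"] r(2) by simp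
      then have "ereal r \<le> liminf (\<lambda>N. ereal (pr N))" by (rule Liminf_bounded)
      then show False using r(1) by simp
    qed
    then show "liminf (\<lambda>N. ereal (measure (walk_space N d)
                 {\<omega> \<in> space (walk_space N d). ereal_of_enat (disc_time N d \<omega>) > ereal (\<gamma> * real N ^ (2 * d))}))
              \<ge> ereal (measure M {\<omega> \<in> space M. zeta L \<omega> (v / sqrt (real d + 1)) > ereal \<gamma>})"
      by (simp only: pr_def W_def u_def)
  qed
qed

theorem theorem7p3:
  fixes d :: nat
  assumes "d \<ge> 2"
  shows "(\<exists>v0>0. \<forall>v \<in> {0<..<v0}. \<forall>\<gamma>>0.
            \<forall>(M :: (real \<Rightarrow> real) measure) B L. std_BM M B \<longrightarrow> local_time M B L \<longrightarrow>
              liminf (\<lambda>N. ereal (measure (walk_space N d)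
                 {\<omega> \<in> space (walk_space N d). ereal_of_enat (disc_time N d \<omega>) > ereal (\<gamma> * real N ^ (2 * d))}))
              \<ge> ereal (measure M {\<omega> \<in> space M. zeta L \<omega> (v / sqrt (real d + 1)) > ereal \<gamma>}))
         \<and> (\<forall>\<epsilon>>0. \<exists>K::real. \<forall>N\<ge>2.
              measure (walk_space N d)
                {\<omega> \<in> space (walk_space N d).
                   ereal (real N ^ (2 * d)) / ereal_of_enat (disc_time N d \<omega>) > ereal K} \<le> \<epsilon>)"
proof
  obtain v0 :: real where v0: "v0 > 0" and lim:
    "\<And>v \<gamma> (M :: (real \<Rightarrow> real) measure) B L. 0 < v \<Longrightarrow> v < v0 \<Longrightarrow> \<gamma> > 0 \<Longrightarrow> std_BM M B \<Longrightarrow> local_time M B L \<Longrightarrow>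
       liminf (\<lambda>N. ereal (measure (walk_space N d)
                 {\<omega> \<in> space (walk_space N d). ereal_of_enat (disc_time N d \<omega>) > ereal (\<gamma> * real N ^ (2 * d))}))
              \<ge> ereal (measure M {\<omega> \<in> space M. zeta L \<omega> (v / sqrt (real d + 1)) > ereal \<gamma>})"
    by (rule liminf_disc_time_ge[OF assms]) (rule that)
  show "\<exists>v0>0. \<forall>v \<in> {0<..<v0}. \<forall>\<gamma>>0.
            \<forall>(M :: (real \<Rightarrow> real) measure) B L. std_BM M B \<longrightarrow> local_time M B L \<longrightarrow>
              liminf (\<lambda>N. ereal (measure (walk_space N d)
                 {\<omega> \<in> space (walk_space N d). ereal_of_enat (disc_time N d \<omega>) > ereal (\<gamma> * real N ^ (2 * d))}))
              \<ge> ereal (measure M {\<omega> \<in> space M. zeta L \<omega> (v / sqrt (real d + 1)) > ereal \<gamma>})"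
  proof (rule exI[of _ v0], rule conjI[OF v0], intro ballI allI impI)
    fix v \<gamma> :: real and M :: "(real \<Rightarrow> real) measure" and B L
    assume "v \<in> {0<..<v0}" "\<gamma> > 0" "std_BM M B" "local_time M B L"
    then show "liminf (\<lambda>N. ereal (measure (walk_space N d)
                 {\<omega> \<in> space (walk_space N d). ereal_of_enat (disc_time N d \<omega>) > ereal (\<gamma> * real N ^ (2 * d))}))
              \<ge> ereal (measure M {\<omega> \<in> space M. zeta L \<omega> (v / sqrt (real d + 1)) > ereal \<gamma>})"
      by (intro lim) auto
  qed
  show "\<forall>\<epsilon>>0. \<exists>K::real. \<forall>N\<ge>2.
              measure (walk_space N d)
                {\<omega> \<in> space (walk_space N d).
                   ereal (real N ^ (2 * d)) / ereal_of_enat (disc_time N d \<omega>) > ereal K} \<le> \<epsilon>"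
    using tight_inverse_disc_time[OF assms] by blast
qed

end
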